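(* For every integer $s\ge 0$, every positive integer $n$ and every finite set $S$ of positive integers there is an effectively computable constant $C=C(s,n,S)$, depending only on $s$, $n$ and $S$, such that the following holds. Let $d$ be a positive integer, let $t\ge 0$ be an integer, let $\beta_1,\dots,\beta_t$ be elements of $S$, let $\alpha_1,\dots,\alpha_s$ be positive integers, let $p_1,\dots,p_s,q_1,\dots,q_t$ be distinct primes, and put $$N=p_1^{\alpha_1}\cdots p_s^{\alpha_s}\,q_1^{2\beta_1}\cdots q_t^{2\beta_t}.$$ If $N>1$ and $h(N)=\frac{n}{d}$, then $N$ has a prime factor smaller than $C$.
   Context: For a positive integer $N$, $\sigma(N)$ denotes the sum of the positive divisors of $N$, and $h(N)=\sigma(N)/N$. "Effectively computable constant depending only on $s,n,S$" means that $(s,n,S)\mapsto C(s,n,S)$ can be taken to be a computable function. *)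

theory Defs
  imports Complex_Main "HOL-Library.Nat_Bijection" "HOL-Computational_Algebra.Primes"
begin

definition sigma :: "nat \<Rightarrow> nat" where
  "sigma N = (\<Sum>d | d dvd N. d)"

definition h :: "nat \<Rightarrow> real" where
  "h N = real (sigma N) / real N"

text \<open>Kleene's partial recursive functions, as programs with a big-step semantics:
  \<open>computes f xs y\<close> says that \<open>f\<close> halts on the argument list \<open>xs\<close> with value \<open>y\<close>.
  Programs carry no arity: the number of arguments is the length of \<open>xs\<close>, and
  \<open>Zero\<close> is the constant 0 in any number of arguments.
  \<open>PrimRec\<close> and \<open>Mu\<close> recurse and search on the first argument.\<close>

datatype recf =
    Zero
  | Succ
  | Proj nat
  | Comp recf "recf list"
  | PrimRec recf recf
  | Mu recf

inductive computes :: "recf \<Rightarrow> nat list \<Rightarrow> nat \<Rightarrow> bool" where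
  zero: "computes Zero xs 0"
| succ: "computes Succ [x] (Suc x)"
| proj: "i < length xs \<Longrightarrow> computes (Proj i) xs (xs ! i)"
| comp: "list_all2 (\<lambda>g y. computes g xs y) gs ys \<Longrightarrow> computes f ys z
    \<Longrightarrow> computes (Comp f gs) xs z"
| primrec_0: "computes f xs y \<Longrightarrow> computes (PrimRec f g) (0 # xs) y"
| primrec_Suc: "computes (PrimRec f g) (k # xs) y \<Longrightarrow> computes g (k # y # xs) z
    \<Longrightarrow> computes (PrimRec f g) (Suc k # xs) z"
| mu: "computes f (m # xs) 0 \<Longrightarrow> (\<And>i. i < m \<Longrightarrow> \<exists>y. computes f (i # xs) (Suc y))
    \<Longrightarrow> computes (Mu f) xs m"

inductive_cases computes_ZeroE: "computes Zero xs y"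
inductive_cases computes_SuccE: "computes Succ xs y"
inductive_cases computes_ProjE: "computes (Proj i) xs y"
inductive_cases computes_CompE: "computes (Comp f gs) xs y"
inductive_cases computes_PrimRec_0E: "computes (PrimRec f g) (0 # xs) y"
inductive_cases computes_PrimRec_SucE: "computes (PrimRec f g) (Suc k # xs) y"
inductive_cases computes_MuE: "computes (Mu f) xs y"

lemma computes_deterministic:
  "computes f xs y \<Longrightarrow> computes f xs z \<Longrightarrow> y = z"
proof (induction arbitrary: z rule: computes.induct)
  case (comp xs gs ys f z')
  from comp.prems obtain ys' where
    ys': "list_all2 (\<lambda>g y. computes g xs y) gs ys'" "computes f ys' z"
    by (rule computes_CompE)
  have "ys = ys'"
    using comp.IH(1) ys'(1) by (auto simp: list_all2_conv_all_nth intro: nth_equalityI)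
  with comp.IH(2) ys'(2) show ?case by simp
next
  case (primrec_Suc f g k xs y z')
  from primrec_Suc.prems obtain y' where
    "computes (PrimRec f g) (k # xs) y'" "computes g (k # y' # xs) z"
    by (rule computes_PrimRec_SucE)
  with primrec_Suc.IH show ?case by blast
next
  case (mu f m xs)
  from mu.prems have z: "computes f (z # xs) 0" "\<And>i. i < z \<Longrightarrow> \<exists>y. computes f (i # xs) (Suc y)"
    by (blast elim: computes_MuE)+
  show ?case
  proof (rule linorder_cases[of m z])
    assume "m < z"
    with z(2) mu.IH(1) show ?thesis by (metis nat.distinct(1))
  next
    assume "z < m"
    with mu.IH(2) z(1) show ?thesis by (metis nat.distinct(1))
  qed
qed (blast elim: computes_ZeroE computes_SuccE computes_ProjE computes_PrimRec_0E)+

text \<open>A finite set \<open>S\<close> of natural numbers is given to a program as the number whose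
  binary digits are the indicator of \<open>S\<close>, the sum of \<open>2 ^ i\<close> over \<open>i\<close> in \<open>S\<close>; this is
  a bijection between finite sets and natural numbers.\<close>

definition effectively_computable :: "(nat \<Rightarrow> nat \<Rightarrow> nat set \<Rightarrow> nat) \<Rightarrow> bool" where
  "effectively_computable C \<longleftrightarrow>
    (\<exists>f. \<forall>s n S. finite S \<longrightarrow> computes f [s, n, set_encode S] (C s n S))"

end

theory Submission
  imports Defs "HOL-Number_Theory.Number_Theory" "HOL-Computational_Algebra.Polynomial"
begin

text \<open>Suppose that all prime factors of \<open>N\<close> are at least \<open>C\<close>. Since \<open>1 + 1/n \<le> h N \<le> n\<close>, the sum of
  the reciprocals of the prime factors of \<open>N\<close> is bounded by \<open>n\<close> and also bounded away from 0 in
  terms of \<open>n\<close>, so it suffices to show that it is small when \<open>C\<close> is large. The \<open>s\<close> exceptional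
  primes contribute at most \<open>s/C\<close>. Fix \<open>b \<in> S\<close> and a prime \<open>l\<close> dividing \<open>2b + 1\<close>. If \<open>q\<close> occurs in
  \<open>N\<close> with exponent \<open>2b\<close>, then \<open>1 + q + \<dots> + q\<^sup>l\<^sup>-\<^sup>1\<close> divides \<open>\<sigma>(N)\<close>, which divides \<open>n N\<close>. So for
  every prime \<open>r \<equiv> 1 (mod l)\<close> dividing neither \<open>N\<close> nor \<open>n\<close>, the prime \<open>q\<close> avoids a nonzero residue
  class mod \<open>r\<close> in addition to the class 0. The removed \<open>r\<close> have bounded reciprocal sum, so Brun's
  sieve shows that the number of such \<open>q\<close> up to \<open>x\<close> is \<open>O(x / (log x)\<^sup>1\<^sup>+\<^sup>\<delta>)\<close> up to powers of \<open>log
  log x\<close>, and the sum of \<open>1/q\<close> over \<open>q \<ge> C\<close> tends to 0.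

  The sieve needs an effective lower bound \<open>\<Sum> log r / r \<ge> \<delta> log x\<close> over the primes \<open>r \<equiv> 1 (mod l)\<close>
  up to \<open>x\<close>. It comes from the ring of integers of the \<open>l\<close>-th cyclotomic field: most elements of a
  suitable large box have norm a product of distinct primes \<open>r \<equiv> 1 (mod l)\<close>, and an ideal of index
  \<open>r\<close> contains at most the expected proportion of the box, up to a constant. All constants are
  explicit and bounded by a tower of exponentials of fixed height.\<close>

subsection \<open>The norm form of a cyclotomic field\<close>

text \<open>The set of removed \<open>r\<close> varies with \<open>N\<close> and cannot be
  controlled individually. But the quotients \<open>N / p\<close> are distinct divisors of
  \<open>N\<close>, so the sum of \<open>1/p\<close> over the primes dividing \<open>N\<close> is at
  most \<open>h N \<le> n\<close>. Only this bound enters the sieve, which makes its constants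
  uniform in \<open>N\<close>, \<open>d\<close> and \<open>t\<close>.

  A second class modulo \<open>r\<close> improves the sieve factor \<open>1 - 1/r\<close> to at most
  \<open>(1 - 1/r) exp (- 1/r)\<close>. The saving is therefore governed by the sum of
  \<open>1/r\<close> over the remaining \<open>r\<close>, and any explicit positive multiple of
  \<open>log log x\<close> in it suffices for convergence. Hence the lower bound for the primes
  \<open>r\<close> may lose a huge constant, and neither their density \<open>1/(l - 1)\<close> nor
  L-functions have to appear.

  Norms and ideals are treated inside Z[X] modulo \<open>Phi l\<close>. That an ideal has index at
  least \<open>Q\<close> is expressed by a set of \<open>Q\<close> elements pairwise incongruent
  modulo it. Such an ideal contains no nonzero element whose coefficients are all much smaller than
  \<open>Q ^ (1 / (l - 1))\<close>, and this spacing bounds the number of its elements in a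
  box.\<close>

definition complex_eval :: "complex \<Rightarrow> int poly \<Rightarrow> complex" where
  "complex_eval z p = poly (map_poly of_int p) z"

lemma complex_eval_0 [simp]: "complex_eval z 0 = 0"
  by (simp add: complex_eval_def)

lemma complex_eval_pCons [simp]: "complex_eval z (pCons a p) = of_int a + z * complex_eval z p"
  by (simp add: complex_eval_def map_poly_pCons)

lemma complex_eval_1 [simp]: "complex_eval z 1 = 1"
  by (simp add: one_pCons)

lemma complex_eval_add [simp]: "complex_eval z (p + q) = complex_eval z p + complex_eval z q"
  by (induction p q rule: poly_induct2) (auto simp: algebra_simps)

lemma complex_eval_smult [simp]: "complex_eval z (smult a p) = of_int a * complex_eval z p"
  by (induction p) (auto simp: algebra_simps)

lemma complex_eval_minus [simp]: "complex_eval z (- p) = - complex_eval z p"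
  by (induction p) (auto simp: algebra_simps)

lemma complex_eval_diff [simp]: "complex_eval z (p - q) = complex_eval z p - complex_eval z q"
  using complex_eval_add[of z p "-q"] by simp

lemma complex_eval_mult [simp]: "complex_eval z (p * q) = complex_eval z p * complex_eval z q"
  by (induction p) (auto simp: algebra_simps)

lemma complex_eval_power [simp]: "complex_eval z (p ^ n) = complex_eval z p ^ n"
  by (induction n) auto

lemma complex_eval_prod: "complex_eval z (\<Prod>i\<in>A. f i) = (\<Prod>i\<in>A. complex_eval z (f i))"
  by (induction A rule: infinite_finite_induct) auto

lemma complex_eval_pcompose [simp]: "complex_eval z (pcompose p q)
    = complex_eval (complex_eval z q) p"
  by (induction p) (auto simp: pcompose_pCons algebra_simps)

definition X :: "int poly" where "X = [:0, 1:]"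

lemma complex_eval_X [simp]: "complex_eval z X = z"
  by (simp add: X_def)

lemma poly_X [simp]: "poly X z = z"
  by (simp add: X_def)

text \<open>For prime \<open>l\<close> this is the \<open>l\<close>-th cyclotomic
  polynomial.\<close>

definition Phi :: "nat \<Rightarrow> int poly" where
  "Phi l = (\<Sum>i<l. X ^ i)"

lemma X_power_minus_1: "X ^ l - 1 = (X - 1) * Phi l"
  unfolding Phi_def by (rule power_diff_1_eq)

lemma coeff_X_power: "coeff (X ^ i) k = (if k = i then 1 else 0)"
proof -
  have "X ^ i = monom 1 i" by (induction i) (auto simp: monom_Suc one_pCons monom_0 X_def)
  thus ?thesis by simp
qed

lemma coeff_Phi: "coeff (Phi l) k = (if k < l then 1 else 0)"
  unfolding Phi_def coeff_sum coeff_X_power by simp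

lemma poly_Phi: "poly (Phi l) w = (\<Sum>i<l. w ^ i)"
  by (simp add: Phi_def poly_sum)

lemma poly_eq_sum_X: "p = (\<Sum>i\<le>degree p. smult (coeff p i) (X ^ i))" for p :: "int poly"
  by (rule poly_eqI) (simp add: coeff_sum coeff_X_power if_distrib cong: if_cong, auto simp:
      coeff_eq_0 le_less_linear)

lemma pcompose_diff_dvd: "a - b dvd pcompose p a - pcompose p b" for p :: "int poly"
proof (induction p)
  case (pCons c p)
  have "pcompose (pCons c p) a - pcompose (pCons c p) b =
     (a - b) * pcompose p a + b * (pcompose p a - pcompose p b)"
    by (simp add: pcompose_pCons algebra_simps)
  then show ?case using pCons by simp
qed simp

lemma prod_diff_dvd:
  fixes f g :: "nat \<Rightarrow> int poly"
  assumes "\<And>i. i \<in> A \<Longrightarrow> m dvd f i - g i"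
  shows "m dvd (\<Prod>i\<in>A. f i) - (\<Prod>i\<in>A. g i)"
  using assms
proof (induction A rule: infinite_finite_induct)
  case (insert a A)
  have "(\<Prod>i\<in>insert a A. f i) - (\<Prod>i\<in>insert a A. g i) =
    (f a - g a) * (\<Prod>i\<in>A. f i) + g a * ((\<Prod>i\<in>A. f i) - (\<Prod>i\<in>A. g i))"
    using insert by (simp add: algebra_simps)
  then show ?case using insert by (auto intro!: dvd_add)
qed auto

lemma X_power_cong:
  assumes "i mod l = j mod l"
  shows "X ^ l - 1 dvd X ^ i - X ^ j"
proof -
  have *: "X ^ l - 1 dvd X ^ i - X ^ j" if "j \<le> i" "i mod l = j mod l" for i j
  proof -
    have "l dvd i - j" using that by (simp add: mod_eq_dvd_iff_nat)
    then obtain k where "i - j = l * k" by blast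
    then have "i = j + l * k" using that by simp
    then have "X ^ i - X ^ j = X ^ j * ((X ^ l) ^ k - 1)"
      by (simp add: power_add power_mult right_diff_distrib)
    moreover have "(X ^ l - 1) dvd ((X ^ l) ^ k - 1)"
      using power_diff_1_eq[of "X ^ l" k] by simp
    ultimately show ?thesis by simp
  qed
  show ?thesis
  proof (cases "j \<le> i")
    case False
    then have "X ^ l - 1 dvd X ^ j - X ^ i" using *[of i j] assms by simp
    then show ?thesis by (metis dvd_minus_iff minus_diff_eq)
  qed (use * assms in simp)
qed

lemma pcompose_power: "pcompose (p ^ n) q = pcompose p q ^ n" for p q :: "int poly"
  by (induction n) (auto simp: pcompose_mult pcompose_1)

lemma pcompose_X [simp]: "pcompose X q = q"
  by (simp add: X_def pcompose_pCons)

text \<open>The representative of \<open>pcompose p (X ^ k)\<close> modulo \<open>X ^ l - 1\<close>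
  with exponents below \<open>l\<close>. If \<open>p\<close> itself has degree below
  \<open>l\<close> and \<open>k\<close> is prime to \<open>l\<close>, this only permutes the
  coefficients.\<close>

definition fold_poly :: "nat \<Rightarrow> nat \<Rightarrow> int poly \<Rightarrow> int poly" where
  "fold_poly l k p = (\<Sum>i\<le>degree p. smult (coeff p i) (X ^ ((i * k) mod l)))"

lemma fold_poly_cong:
  "X ^ l - 1 dvd pcompose p (X ^ k) - fold_poly l k p"
proof -
  have "pcompose p (X ^ k) = (\<Sum>i\<le>degree p. smult (coeff p i) (X ^ (i * k)))"
  proof -
    have "pcompose p (X ^ k) = pcompose (\<Sum>i\<le>degree p. smult (coeff p i) (X ^ i)) (X ^ k)"
      using poly_eq_sum_X[of p] by simp
    also have "\<dots> = (\<Sum>i\<le>degree p. smult (coeff p i) (X ^ (i * k)))"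
      by (simp add: pcompose_sum pcompose_smult pcompose_power power_mult[symmetric] mult.commute)
    finally show ?thesis .
  qed
  then have "pcompose p (X ^ k) - fold_poly l k p =
     (\<Sum>i\<le>degree p. smult (coeff p i) (X ^ (i * k) - X ^ ((i * k) mod l)))"
    unfolding fold_poly_def by (simp add: sum_subtractf smult_diff_right)
  also have "X ^ l - 1 dvd \<dots>"
    by (intro dvd_sum dvd_smult X_power_cong) simp
  finally show ?thesis .
qed

lemma coeff_fold_poly_ge: "l > 0 \<Longrightarrow> i \<ge> l \<Longrightarrow> coeff (fold_poly l k p) i = 0"
  unfolding fold_poly_def
  by (auto simp: coeff_sum coeff_X_power intro!: sum.neutral) (metis mod_less_divisor not_le)

lemma degree_X_power_minus_1: "l > 0 \<Longrightarrow> degree (X ^ l - 1) = l"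
proof -
  assume "l > 0"
  then have "coeff (X ^ l - 1) l = 1" "\<And>i. i > l \<Longrightarrow> coeff (X ^ l - 1) i = 0"
    by (auto simp: coeff_X_power)
  then show ?thesis by (metis le_degree degree_le le_antisym zero_neq_one)
qed

lemma X_power_minus_1_dvd_imp_0:
  assumes "X ^ l - 1 dvd p" "\<And>i. i \<ge> l \<Longrightarrow> coeff p i = 0" "l > 0"
  shows "p = 0"
proof (rule ccontr)
  assume "p \<noteq> 0"
  then have "degree p < l" using assms(2) by (metis leading_coeff_0_iff not_le)
  moreover have "degree (X ^ l - 1) \<le> degree p"
    using \<open>p \<noteq> 0\<close> assms(1) by (rule dvd_imp_degree_le[rotated])
  ultimately show False using degree_X_power_minus_1[OF assms(3)] by simp
qed

lemma coprime_mult_mod_inj: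
  assumes "prime l" "0 < k" "k < l" "i < l" "(i * k) mod l = (k::nat)"
  shows "i = 1"
proof -
  have "coprime k l" using assms by (metis coprime_commute nat_dvd_not_less prime_imp_coprime)
  moreover have "[i * k = 1 * k] (mod l)" using assms by (simp add: cong_def)
  ultimately have "[i = 1] (mod l)" using cong_mult_rcancel_nat[of k l i 1] by blast
  moreover have "1 < l" using assms prime_gt_1_nat by blast
  ultimately show ?thesis using assms by (simp add: cong_def)
qed

text \<open>Modulo \<open>X\<^sup>l - 1\<close> the product is invariant under \<open>X \<mapsto> X\<^sup>k\<close> for all \<open>k\<close> prime to \<open>l\<close>, so all its
  coefficients except the constant one agree, and modulo \<open>Phi l\<close> it becomes a constant.\<close>

theorem norm_exists:
  fixes p :: "int poly"
  assumes l: "prime l"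
  shows "\<exists>N u. (\<Prod>j=1..<l. pcompose p (X ^ j)) = [:N:] + Phi l * u"
proof -
  define P where "P = (\<Prod>j=1..<l. pcompose p (X ^ j))"
  define F where "F = fold_poly l 1 P"
  have l1: "l > 1" using l prime_gt_1_nat by blast
  let ?m = "X ^ l - 1"
  have PF: "?m dvd P - F"
    using fold_poly_cong[of l P 1] by (simp add: F_def X_def pcompose_idR)
  have Fge: "coeff F i = 0" if "i \<ge> l" for i
    unfolding F_def using l1 that by (intro coeff_fold_poly_ge) auto
  have inv: "?m dvd pcompose P (X ^ k) - P" if k: "0 < k" "k < l" for k
  proof -
    have "pcompose P (X ^ k) = (\<Prod>j=1..<l. pcompose p (X ^ (j * k)))"
      unfolding P_def
      by (simp add: pcompose_prod pcompose_assoc[symmetric] pcompose_power power_mult[symmetric]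
          mult.commute)
    moreover have "?m dvd (\<Prod>j=1..<l. pcompose p (X ^ (j * k)))
        - (\<Prod>j=1..<l. pcompose p (X ^ ((j * k) mod l)))"
      by (intro prod_diff_dvd dvd_trans[OF _ pcompose_diff_dvd] X_power_cong) simp
    moreover have "(\<Prod>j=1..<l. pcompose p (X ^ ((j * k) mod l))) = P"
      unfolding P_def
    proof (rule prod.reindex_bij_betw[where h = "\<lambda>j. (j * k) mod l"])
      have kl: "coprime k l" using k l by (metis coprime_commute nat_dvd_not_less prime_imp_coprime)
      have inj: "inj_on (\<lambda>j. (j * k) mod l) {1..<l}"
      proof (rule inj_onI)
        fix x y assume "x \<in> {1..<l}" "y \<in> {1..<l}" "(x * k) mod l = (y * k) mod l"
        then show "x = y" using kl by (metis cong_def cong_mult_rcancel_nat atLeastLessThan_iff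
            mod_less)
      qed
      moreover have "(\<lambda>j. (j * k) mod l) ` {1..<l} \<subseteq> {1..<l}"
      proof safe
        fix j assume j: "j \<in> {1..<l}"
        have "\<not> l dvd j * k" using j k l by (auto simp: prime_dvd_mult_iff dest: nat_dvd_not_less)
        then show "(j * k) mod l \<in> {1..<l}" using l1 by (simp add: Suc_leI dvd_eq_mod_eq_0)
      qed
      ultimately show "bij_betw (\<lambda>j. (j * k) mod l) {1..<l} {1..<l}"
        by (simp add: bij_betw_def endo_inj_surj)
    qed
    ultimately show ?thesis by simp
  qed
  have c1: "coeff F k = coeff F 1" if k: "0 < k" "k < l" for k
  proof -
    have "?m dvd pcompose P (X ^ k) - pcompose F (X ^ k)"
    proof -
      obtain q where q: "P - F = ?m * q" using PF by blast
      have "pcompose P (X ^ k) - pcompose F (X ^ k) = pcompose (?m * q) (X ^ k)"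
        by (simp add: q[symmetric] pcompose_diff)
      also have "\<dots> = ((X ^ l) ^ k - 1) * pcompose q (X ^ k)"
        by (simp add: pcompose_mult pcompose_diff pcompose_power pcompose_1 power_mult[symmetric]
            mult.commute)
      also have "?m dvd \<dots>" using power_diff_1_eq[of "X ^ l" k] by (metis dvd_mult2 dvd_triv_left)
      finally show ?thesis .
    qed
    from dvd_diff[OF dvd_add[OF this fold_poly_cong[of l F k]] inv[OF k]]
    have "?m dvd P - fold_poly l k F" by (simp add: algebra_simps)
    from dvd_diff[OF this PF] have "?m dvd F - fold_poly l k F" by simp
    then have "F - fold_poly l k F = 0"
      by (rule X_power_minus_1_dvd_imp_0) (use l1 Fge coeff_fold_poly_ge in auto)
    \<comment> \<open>Among the indices \<open>i < l\<close> only \<open>i = 1\<close> has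
      \<open>i * k\<close> congruent to \<open>k\<close>, so the coefficient at \<open>k\<close>
      comes from the one at 1.\<close>
    then have "coeff F k = coeff (fold_poly l k F) k" by simp
    also have "\<dots> = (\<Sum>i\<le>degree F. coeff F i * (if k = (i * k) mod l then 1 else 0))"
      by (simp only: fold_poly_def coeff_sum coeff_smult coeff_X_power)
    also have "\<dots> = (\<Sum>i\<le>degree F. if i = 1 then coeff F 1 else 0)"
    proof (intro sum.cong refl)
      fix i assume "i \<in> {..degree F}"
      show "coeff F i * (if k = (i * k) mod l then 1 else 0) = (if i = 1 then coeff F 1 else 0)"
      proof (cases "i < l")
        case True
        show ?thesis
        proof (cases "i = 1")
          case False
          then have "k \<noteq> (i * k) mod l" using coprime_mult_mod_inj[OF l k True] by metis
          then show ?thesis using False by (simp only: if_False mult_zero_right)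
        qed (use k in simp)
      next
        case False
        then have "coeff F i = 0" "i \<noteq> 1" using Fge[of i] l1 by auto
        then show ?thesis by (simp only: if_False mult_zero_left)
      qed
    qed
    also have "\<dots> = coeff F 1" by (auto simp: coeff_eq_0)
    finally show ?thesis .
  qed
  have "F = [:coeff F 0 - coeff F 1:] + smult (coeff F 1) (Phi l)"
  proof (rule poly_eqI)
    fix i
    consider "i = 0" | "0 < i" "i < l" | "i \<ge> l" "i \<noteq> 0" using l1 by linarith
    then show "coeff F i = coeff ([:coeff F 0 - coeff F 1:] + smult (coeff F 1) (Phi l)) i"
    proof cases
      case 2
      then show ?thesis unfolding c1[OF 2] by (simp add: coeff_Phi coeff_pCons split: nat.splits)
    qed (use Fge l1 in \<open>auto simp: coeff_Phi coeff_pCons split: nat.splits\<close>)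
  qed
  moreover obtain q where "P - F = ?m * q" using PF by blast
  ultimately have "P = [:coeff F 0 - coeff F 1:] + Phi l * ([:coeff F 1:] + (X - 1) * q)"
    by (simp add: X_power_minus_1 algebra_simps)
  then show ?thesis unfolding P_def by blast
qed

section \<open>Conjugates and the norm\<close>

definition zeta :: "nat \<Rightarrow> complex" where
  "zeta l = cis (2 * pi / real l)"

lemma zeta_power_eq_1: "l > 0 \<Longrightarrow> zeta l ^ l = 1"
  by (simp add: zeta_def DeMoivre)

lemma zeta_power_neq_1:
  assumes "0 < j" "j < l"
  shows "zeta l ^ j \<noteq> 1"
proof
  assume "zeta l ^ j = 1"
  then have "cis (2 * pi * real j / real l) = cis (2 * pi * real 0 / real l)"
    by (simp add: zeta_def DeMoivre algebra_simps)
  moreover have "inj_on (\<lambda>k. cis (2 * pi * real k / real l)) {..<l}"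
    using bij_betw_roots_unity[of l] assms by (simp add: bij_betw_def)
  ultimately have "j = 0" using assms inj_onD[of _ "{..<l}" j 0] by fastforce
  then show False using assms by simp
qed

lemma norm_zeta [simp]: "norm (zeta l) = 1"
  by (simp add: zeta_def)

lemma complex_eval_Phi_zeta:
  assumes "0 < j" "j < l"
  shows "complex_eval (zeta l ^ j) (Phi l) = 0"
proof -
  have "(zeta l ^ j - 1) * complex_eval (zeta l ^ j) (Phi l)
      = complex_eval (zeta l ^ j) (X ^ l - 1)"
    by (simp add: X_power_minus_1)
  also have "\<dots> = 0"
    using assms by (simp add: power_mult[symmetric] mult.commute[of j l])
        (simp add: power_mult zeta_power_eq_1)
  finally show ?thesis using zeta_power_neq_1[OF assms] by simp
qed

text \<open>For prime \<open>l\<close>, the norm of \<open>p(zeta l)\<close> from the cyclotomic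
  field to the rationals. It is chosen through the congruence because the arithmetic uses only that;
  evaluation at \<open>zeta l\<close> shows that the choice is unique.\<close>

definition cyclo_norm :: "nat \<Rightarrow> int poly \<Rightarrow> int" where
  "cyclo_norm l p = (SOME N. \<exists>u. (\<Prod>j=1..<l. pcompose p (X ^ j)) = [:N:] + Phi l * u)"

lemma cyclo_norm: "prime l \<Longrightarrow> \<exists>u. (\<Prod>j=1..<l. pcompose p (X ^ j)) = [:cyclo_norm l p:] + Phi l * u"
  unfolding cyclo_norm_def using norm_exists[of l p] by (rule someI_ex)

lemma cyclo_norm_zeta:
  assumes "prime l"
  shows "of_int (cyclo_norm l p) = (\<Prod>j=1..<l. complex_eval (zeta l ^ j) p)"
proof -
  obtain u where u: "(\<Prod>j=1..<l. pcompose p (X ^ j)) = [:cyclo_norm l p:] + Phi l * u"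
    using cyclo_norm[OF assms] by blast
  have "complex_eval (zeta l) (\<Prod>j=1..<l. pcompose p (X ^ j)) = of_int (cyclo_norm l p)"
    unfolding u using complex_eval_Phi_zeta[of 1 l] prime_gt_1_nat[OF assms] by simp
  then show ?thesis by (simp add: complex_eval_prod)
qed

text \<open>An integer root \<open>w\<close> of \<open>Phi l\<close> modulo \<open>r\<close> plays
  the role of \<open>zeta l\<close>: evaluating the defining congruence there splits the norm into
  factors modulo \<open>r\<close>. The applications are \<open>w = 1\<close> modulo
  \<open>l\<close>, and roots modulo primes and modulo squares of primes.\<close>

lemma cyclo_norm_cong:
  assumes "prime l" "r dvd poly (Phi l) w"
  shows "r dvd (\<Prod>j=1..<l. poly p (w ^ j)) - cyclo_norm l p"
proof -
  obtain u where u: "(\<Prod>j=1..<l. pcompose p (X ^ j)) = [:cyclo_norm l p:] + Phi l * u"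
    using cyclo_norm[OF assms(1)] by blast
  from arg_cong[OF u, of "\<lambda>p. poly p w"]
  have "(\<Prod>j=1..<l. poly p (w ^ j)) - cyclo_norm l p = poly (Phi l) w * poly u w"
    by (simp add: poly_prod poly_pcompose)
  then show ?thesis using assms(2) by simp
qed

text \<open>A zero at \<open>zeta l\<close> makes the norm vanish, and 1 is a root of
  \<open>Phi l\<close> modulo \<open>l\<close>, so the norm is congruent to
  \<open>p(1) ^ (l - 1)\<close> modulo \<open>l\<close>.\<close>

lemma complex_eval_zeta_0_imp_dvd:
  assumes l: "prime l" and "complex_eval (zeta l) p = 0"
  shows "int l dvd poly p 1"
proof -
  have l1: "l > 1" using l by (rule prime_gt_1_nat)
  have "(of_int (cyclo_norm l p) :: complex) = 0"
    unfolding cyclo_norm_zeta[OF l] using l1 assms(2)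
      by (intro prod_zero) (auto intro!: bexI[of _ 1])
  then have "cyclo_norm l p = 0" by simp
  moreover have "int l dvd (\<Prod>j=1..<l. poly p (1 ^ j)) - cyclo_norm l p"
    by (rule cyclo_norm_cong[OF l]) (simp add: poly_Phi)
  ultimately have "int l dvd poly p 1 ^ (l - 1)" by simp
  then show ?thesis using l by (meson prime_dvd_power prime_nat_int_transfer)
qed

lemma smult_sum_distrib: "smult c (\<Sum>i\<in>A. f i) = (\<Sum>i\<in>A. smult c (f i))"
  by (induction A rule: infinite_finite_induct) (auto simp: smult_add_right)

text \<open>Expand \<open>X ^ l\<close> as \<open>((X - 1) + 1) ^ l\<close>: the middle binomial
  coefficients are divisible by \<open>l\<close>, and a factor \<open>X - 1\<close> cancels. The
  value \<open>g(1) = 1\<close> follows from \<open>Phi l (1) = l\<close>. This is the total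
  ramification of \<open>l\<close>, in Eisenstein form.\<close>

lemma Phi_eq_power_plus:
  assumes l: "prime l"
  shows "\<exists>g. Phi l = (X - 1) ^ (l - 1) + smult (int l) g \<and> poly g 1 = 1"
proof -
  have l1: "l > 1" using l by (rule prime_gt_1_nat)
  have "\<exists>f. (X - 1 + 1) ^ l = (X - 1) ^ l + 1 + smult (int l) ((X - 1) * f)"
  proof -
    have "(X - 1 + 1) ^ l = (\<Sum>k\<le>l. of_nat (l choose k) * (X - 1) ^ k)"
      by (simp only: binomial_ring power_one mult_1_right)
    also have "{..l} = insert 0 (insert l {1..<l})" using l1 by auto
    also have "(\<Sum>k\<in>insert 0 (insert l {1..<l}). of_nat (l choose k) * (X - 1) ^ k) =
      1 + ((X - 1) ^ l + (\<Sum>k\<in>{1..<l}. of_nat (l choose k) * (X - 1) ^ k))"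
      using l1 by (subst sum.insert; simp)
    also have "(\<Sum>k\<in>{1..<l}. of_nat (l choose k) * (X - 1) ^ k) =
       (\<Sum>k\<in>{1..<l}. smult (int l) ((X - 1) * (smult (int ((l choose k) div l)) ((X - 1) ^
           (k - 1)))))"
    proof (intro sum.cong refl)
      fix k assume k: "k \<in> {1..<l}"
      then have "l dvd (l choose k)" using l by (intro dvd_choose_prime) auto
      then have "(l choose k) = l * ((l choose k) div l)" by simp
      then have "of_nat (l choose k) * (X - 1) ^ k
          = smult (int l * int ((l choose k) div l)) ((X - 1) ^ k)"
        by (simp add: of_nat_poly flip: of_nat_mult)
      moreover have "(X - 1) ^ k = (X - 1) * (X - 1) ^ (k - 1)" using k by (cases k) auto
      ultimately show "of_nat (l choose k) * (X - 1) ^ k =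
        smult (int l) ((X - 1) * (smult (int ((l choose k) div l)) ((X - 1) ^ (k - 1))))" by simp
    qed
    also have "\<dots> = smult (int l) ((X - 1)
        * (\<Sum>k\<in>{1..<l}. smult (int ((l choose k) div l)) ((X - 1) ^ (k - 1))))"
      by (simp add: sum_distrib_left smult_sum_distrib)
    finally have "(X - 1 + 1) ^ l = 1 + ((X - 1) ^ l +
       smult (int l) ((X - 1) * (\<Sum>k\<in>{1..<l}. smult (int ((l choose k) div l)) ((X - 1) ^
           (k - 1)))))" .
    then show ?thesis by (intro exI, subst add.assoc, subst add.left_commute)
  qed
  then obtain f where f: "X ^ l = (X - 1) ^ l + 1 + smult (int l) ((X - 1) * f)"
    unfolding diff_add_cancel by blast
  have "(X - 1) * Phi l = X ^ l - 1" by (simp add: X_power_minus_1)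
  also have "\<dots> = (X - 1) * ((X - 1) ^ (l - 1) + smult (int l) f)"
  proof -
    have "(X - 1) ^ l = (X - 1) * (X - 1) ^ (l - 1)" using l1 by (cases l) auto
    then show ?thesis unfolding f by (simp only: distrib_left mult_smult_right
        add_diff_cancel_right' add.assoc add.commute[of 1])
  qed
  finally have "(X - 1) * Phi l = (X - 1) * ((X - 1) ^ (l - 1) + smult (int l) f)" .
  moreover have "X - 1 \<noteq> 0" by (simp add: X_def one_pCons)
  ultimately have eq: "Phi l = (X - 1) ^ (l - 1) + smult (int l) f"
    by (metis mult_left_cancel)
  from arg_cong[OF this, of "\<lambda>p. poly p 1"] have "poly f 1 = 1"
    using l1 by (simp add: poly_Phi power_0_left)
  with eq show ?thesis by blast
qed

text \<open>This is the irreducibility of \<open>Phi l\<close>. A primitive \<open>p\<close> vanishing at \<open>zeta l\<close> would, modulo \<open>l\<close>,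
  be divisible by \<open>(X - 1)\<^sup>i\<close> for all \<open>i \<le> l - 1\<close>: the induction step rests on \<open>Phi l \<equiv> (X -
  1)\<^sup>l\<^sup>-\<^sup>1 (mod l)\<close> and on the norm, through which vanishing at \<open>zeta l\<close> implies \<open>l dvd p(1)\<close>.\<close>

theorem complex_eval_zeta_eq_0_imp:
  assumes l: "prime l" and deg: "\<And>i. i \<ge> l - 1 \<Longrightarrow> coeff p i = 0"
    and zero: "complex_eval (zeta l) p = 0"
  shows "p = 0"
proof (rule ccontr)
  assume "p \<noteq> 0"
  have l1: "l > 1" using l by (rule prime_gt_1_nat)
  obtain g where g: "Phi l = (X - 1) ^ (l - 1) + smult (int l) g" "poly g 1 = 1"
    using Phi_eq_power_plus[OF l] by blast
  have pz: "(zeta l - 1) ^ (l - 1) = - of_int l * complex_eval (zeta l) g"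
    using arg_cong[OF g(1), of "complex_eval (zeta l)"] complex_eval_Phi_zeta[of 1 l] l1
    by (simp add: eq_neg_iff_add_eq_0)
  define q where "q = primitive_part p"
  have pq: "p = smult (content p) q" by (simp add: q_def)
  have norm_scale: "content p \<noteq> 0" using \<open>p \<noteq> 0\<close> by simp
  have qz: "complex_eval (zeta l) q = 0" using zero norm_scale by (subst (asm) pq) simp
  have qdeg: "degree q < l - 1"
    using deg \<open>p \<noteq> 0\<close> unfolding q_def by (metis degree_primitive_part leading_coeff_0_iff not_le)
  have "\<exists>u v. q = smult (int l) u + (X - 1) ^ i * v \<and> (v = 0 \<or> degree v + i < l - 1)"
    if "i \<le> l - 1" for i
    using that
  proof (induction i)
    case 0
    show ?case using qdeg by (intro exI[of _ 0] exI[of _ q]) simp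
  next
    case (Suc i)
    then obtain u v where uv: "q = smult (int l) u + (X - 1) ^ i * v" "v = 0 \<or> degree v + i < l - 1"
      by auto
    \<comment> \<open>Multiplication by \<open>(zeta l - 1) ^ D\<close> completes
      \<open>(X - 1) ^ i\<close> to \<open>(zeta l - 1) ^ (l - 1)\<close>, a multiple of
      \<open>l\<close>. After division by \<open>l\<close> there remains a polynomial vanishing at
      \<open>zeta l\<close> whose value at 1 is \<open>- v(1)\<close>, because \<open>D > 0\<close>
      and \<open>g(1) = 1\<close>.\<close>
    define D where "D = l - 1 - i"
    have D: "D > 0" "(zeta l - 1) ^ D * (zeta l - 1) ^ i = (zeta l - 1) ^ (l - 1)"
      using Suc.prems by (auto simp: D_def power_add[symmetric])
    have "0 = (zeta l - 1) ^ D * complex_eval (zeta l) q" using qz by simp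
    also have "\<dots> = of_int l * ((zeta l - 1) ^ D * complex_eval (zeta l) u)
        + ((zeta l - 1) ^ D * (zeta l - 1) ^ i) * complex_eval (zeta l) v"
      unfolding uv(1) by (simp add: algebra_simps)
    also have "\<dots> = of_int l * complex_eval (zeta l) ((X - 1) ^ D * u - g * v)"
      unfolding D(2) pz by (simp add: algebra_simps)
    finally have "complex_eval (zeta l) ((X - 1) ^ D * u - g * v) = 0" using l1 by simp
    from complex_eval_zeta_0_imp_dvd[OF l this] have "int l dvd poly v 1"
      using D(1) g(2) by (simp add: power_0_left)
    then obtain c where c: "poly v 1 = int l * c" by blast
    define v' where "v' = synthetic_div v 1"
    have v': "v = smult (int l) [:c:] + (X - 1) * v'"
      using synthetic_div_correct'[of 1 v] by (simp add: v'_def X_def one_pCons c)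
    show ?case
    proof (intro exI conjI)
      show "q = smult (int l) (u + (X - 1) ^ i * [:c:]) + (X - 1) ^ (Suc i) * v'"
        unfolding uv(1) by (subst v') (simp add: algebra_simps smult_add_right)
      have "degree v' = degree v - 1" by (simp add: v'_def degree_synthetic_div)
      moreover have "v' = 0" if "degree v = 0"
        using that by (simp add: v'_def synthetic_div_eq_0_iff)
      ultimately show "v' = 0 \<or> degree v' + Suc i < l - 1" using uv(2)
        by (cases "degree v = 0") (auto simp: v'_def)
    qed
  qed
  \<comment> \<open>For \<open>i = l - 1\<close> the degree condition leaves only
    \<open>v = 0\<close>, so \<open>l\<close> divides every coefficient of the primitive
    \<open>q\<close>.\<close>
  from this[of "l - 1"] obtain u where "q = smult (int l) u" by auto
  then have "int l dvd content q" by (simp add: const_poly_dvd_iff_dvd_content[symmetric])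
  moreover have "content q = 1" using \<open>p \<noteq> 0\<close> by (simp add: q_def)
  ultimately show False using l1 by simp
qed

subsection \<open>Ideals and boxes\<close>

text \<open>With \<open>D = l - 1\<close> the members are reduced representatives modulo
  \<open>Phi l\<close>; by its irreducibility distinct members have distinct values at
  \<open>zeta l\<close>.\<close>

definition coeff_box :: "nat \<Rightarrow> int set \<Rightarrow> int poly set" where
  "coeff_box D A = {p. (\<forall>i<D. coeff p i \<in> A) \<and> (\<forall>i\<ge>D. coeff p i = 0)}"

lemma coeff_box_0: "coeff_box 0 A = {0}"
  by (auto simp: coeff_box_def intro: poly_eqI)

lemma coeff_box_Suc: "coeff_box (Suc D) A = (\<lambda>(a, q). pCons a q) ` (A \<times> coeff_box D A)"
proof
  show "coeff_box (Suc D) A \<subseteq> (\<lambda>(a, q). pCons a q) ` (A \<times> coeff_box D A)"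
  proof
    fix p assume p: "p \<in> coeff_box (Suc D) A"
    obtain a q where aq: "p = pCons a q" by (cases p)
    have "a \<in> A" using p unfolding aq coeff_box_def by force
    moreover have "coeff q i \<in> A" if "i < D" for i
      using p that unfolding aq coeff_box_def by (auto dest!: spec[of _ "Suc i"])
    moreover have "coeff q i = 0" if "i \<ge> D" for i
      using p that unfolding aq coeff_box_def by (auto dest!: spec[of _ "Suc i"])
    ultimately show "p \<in> (\<lambda>(a, q). pCons a q) ` (A \<times> coeff_box D A)"
      unfolding aq coeff_box_def by auto
  qed
qed (auto simp: coeff_box_def coeff_pCons split: nat.splits)

lemma card_coeff_box:
  assumes "finite A"
  shows "finite (coeff_box D A) \<and> card (coeff_box D A) = card A ^ D"
proof (induction D)
  case (Suc D)
  have "inj_on (\<lambda>(a, q). pCons a q) (A \<times> coeff_box D A)" by (auto intro: inj_onI)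
  then show ?case using Suc assms by (simp add: coeff_box_Suc card_image card_cartesian_product)
qed (simp add: coeff_box_0)

lemma coeff_box_diffI:
  assumes "p \<in> coeff_box D A" "q \<in> coeff_box D A" "\<And>i. i < D \<Longrightarrow> \<bar>coeff p i - coeff q i\<bar> \<le> T"
  shows "p - q \<in> coeff_box D {-T..T}"
  unfolding coeff_box_def
proof (intro CollectI conjI allI impI)
  fix i assume "i < D"
  then show "coeff (p - q) i \<in> {-T..T}" using assms(3)[of i] by (auto simp: abs_le_iff)
qed (use assms in \<open>auto simp: coeff_box_def\<close>)

lemma coeff_X_mult: "coeff (X * p) i = (case i of 0 \<Rightarrow> 0 | Suc j \<Rightarrow> coeff p j)"
  by (simp add: X_def coeff_pCons)

text \<open>Only the coefficient of \<open>X * p\<close> at index \<open>l - 1\<close> is in excess.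
  One multiple of \<open>Phi l\<close> removes it and changes every other coefficient by at most
  \<open>K\<close>.\<close>

lemma reduce_X_mult:
  assumes l: "l > 1" and p: "p \<in> coeff_box (l - 1) {-K..K}"
  shows "\<exists>q \<in> coeff_box (l - 1) {-(2 * K)..2 * K}. Phi l dvd q - X * p"
proof
  let ?c = "coeff p (l - 2)"
  define q where "q = X * p - smult ?c (Phi l)"
  show "Phi l dvd q - X * p" by (simp add: q_def dvd_smult)
  have c: "\<bar>coeff p i\<bar> \<le> K" if "i < l - 1" for i
    using p that by (auto simp: coeff_box_def)
  have K0: "0 \<le> K" using c[of 0] l by simp
  show "q \<in> coeff_box (l - 1) {-(2 * K)..2 * K}"
    unfolding coeff_box_def
  proof (intro CollectI conjI allI impI)
    fix i assume i: "i < l - 1"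
    have "\<bar>coeff q i\<bar> \<le> \<bar>coeff (X * p) i\<bar> + \<bar>?c\<bar>"
    proof -
      have "i < l" using i by simp
      then show ?thesis by (simp add: q_def coeff_Phi abs_triangle_ineq4)
    qed
    also have "\<bar>coeff (X * p) i\<bar> \<le> K" using c[of "i - 1"] i K0
      by (auto simp: coeff_X_mult split: nat.splits)
    also have "\<bar>?c\<bar> \<le> K" using c[of "l - 2"] l by simp
    finally show "coeff q i \<in> {-(2 * K)..2 * K}" by auto
  next
    fix i assume i: "i \<ge> l - 1"
    then show "coeff q i = 0"
    proof (cases "i = l - 1")
      case True
      then show ?thesis using l by (cases l)
          (auto simp: q_def coeff_Phi coeff_X_mult split: nat.splits)
    next
      case False
      then have "coeff p (i - 1) = 0" "i \<ge> l" using i p l by (auto simp: coeff_box_def)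
      then show ?thesis using l by (auto simp: q_def coeff_Phi coeff_X_mult split: nat.splits)
    qed
  qed
qed

text \<open>Horner's scheme: \<open>d * (a + X * b') = a * d + X * (d * b')\<close>. Each step turns
  a bound \<open>K\<close> into \<open>m * T + 2 * K\<close>, which yields the factor
  \<open>2 ^ k - 1\<close>.\<close>

lemma reduce_mult:
  assumes l: "l > 1" and d: "d \<in> coeff_box (l - 1) {-T..T}" and "b \<in> coeff_box k {0..<m}"
    and "m \<ge> 0"
  shows "\<exists>q \<in> coeff_box (l - 1) {-(m * T * (2 ^ k - 1))..m * T * (2 ^ k - 1)}. Phi l dvd q - d * b"
  using assms(3)
proof (induction k arbitrary: b)
  case 0
  then have "b = 0" by (simp add: coeff_box_0)
  then show ?case by (intro bexI[of _ 0]) (auto simp: coeff_box_def)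
next
  case (Suc k)
  from Suc.prems obtain a b' where b: "b = pCons a b'" "a \<in> {0..<m}" "b' \<in> coeff_box k {0..<m}"
    by (auto simp: coeff_box_Suc)
  let ?K = "m * T * (2 ^ k - 1)"
  obtain q where q: "q \<in> coeff_box (l - 1) {-?K..?K}" "Phi l dvd q - d * b'"
    using Suc.IH[OF b(3)] by blast
  obtain q' where q': "q' \<in> coeff_box (l - 1) {-(2 * ?K)..2 * ?K}" "Phi l dvd q' - X * q"
    using reduce_X_mult[OF l q(1)] by blast
  show ?case
  proof
    have "smult a d + q' - d * b = (q' - X * q) + X * (q - d * b')"
      by (simp add: b(1) algebra_simps X_def)
    then show "Phi l dvd smult a d + q' - d * b"
      using q(2) q'(2) by (metis dvd_add dvd_mult)
    have "\<bar>a * coeff d i + coeff q' i\<bar> \<le> m * T * (2 ^ Suc k - 1)" if i: "i < l - 1" for i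
    proof -
      have "\<bar>a * coeff d i\<bar> = a * \<bar>coeff d i\<bar>" using b(2) by (simp add: abs_mult)
      also have "\<dots> \<le> m * T" using b(2) d i by (intro mult_mono) (auto simp: coeff_box_def)
      finally have "\<bar>a * coeff d i\<bar> \<le> m * T" .
      moreover have "\<bar>coeff q' i\<bar> \<le> 2 * ?K" using q'(1) i by (auto simp: coeff_box_def)
      ultimately show ?thesis by (simp add: algebra_simps)
    qed
    then show "smult a d + q' \<in> coeff_box (l - 1) {-(m * T * (2 ^ Suc k - 1))..m * T
        * (2 ^ Suc k - 1)}"
      using d q'(1) by (fastforce simp: coeff_box_def abs_le_iff)
  qed
qed

text \<open>Ideals of Z[X]. Those that contain \<open>Phi l\<close> stand for the ideals of the ring
  of integers of the cyclotomic field.\<close>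

definition poly_ideal :: "int poly set \<Rightarrow> bool" where
  "poly_ideal I \<longleftrightarrow> 0 \<in> I \<and> (\<forall>a\<in>I. \<forall>b\<in>I. a - b \<in> I) \<and> (\<forall>a\<in>I. \<forall>b. a * b \<in> I)"

text \<open>Pigeonhole principle: the elements \<open>e + d b\<close> with \<open>e \<in> E\<close> and \<open>b\<close> in a box are distinct modulo
  \<open>Phi l\<close>, and their reduced representatives lie in a common box. This replaces the comparison of
  the index of an ideal with the norms of its elements.\<close>

theorem ideal_index_le:
  assumes l: "prime l" and I: "poly_ideal I" "Phi l \<in> I"
    and E: "E \<subseteq> coeff_box (l - 1) {0..<m}" "\<And>e e'. e \<in> E \<Longrightarrow> e' \<in> E \<Longrightarrow> e - e' \<in> I \<Longrightarrow> e = e'"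
    and d: "d \<in> I" "d \<in> coeff_box (l - 1) {-T..T}" "d \<noteq> 0" and m: "m \<ge> 1" and T: "T \<ge> 1"
  shows "int (card E) \<le> (2 ^ (l + 2) * T) ^ (l - 1)"
proof -
  have l1: "l > 1" using l by (rule prime_gt_1_nat)
  define D where "D = l - 1"
  define B where "B = coeff_box D {0..<m}"
  define K where "K = m * T * 2 ^ l"
  have B: "finite B" "card B = nat m ^ D" using card_coeff_box[of "{0..<m}" D] by (auto simp: B_def)
  have "\<forall>b\<in>B. \<exists>q. q \<in> coeff_box D {-(m * T * (2 ^ D - 1))..m * T * (2 ^ D - 1)} \<and> Phi l dvd q - d
      * b"
    using reduce_mult[OF l1 d(2), of _ "l - 1" m] m unfolding B_def D_def by fastforce
  then obtain R where R: "\<And>b. b \<in> B \<Longrightarrow> R b \<in> coeff_box D {-(m * T * (2 ^ D - 1))..m * T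
      * (2 ^ D - 1)}"
     "\<And>b. b \<in> B \<Longrightarrow> Phi l dvd R b - d * b"
    by metis
  have mT: "m \<le> m * T" using m T by simp
  have le: "m + m * T * (2 ^ D - 1) \<le> K"
  proof -
    have "m + m * T * (2 ^ D - 1) \<le> m * T * 2 ^ D" using mT by (simp add: algebra_simps)
    also have "\<dots> \<le> K" unfolding K_def D_def using m T
      by (intro mult_left_mono power_increasing) auto
    finally show ?thesis .
  qed
  let ?F = "\<lambda>(e, b). e + R b"
  have "?F ` (E \<times> B) \<subseteq> coeff_box D {-K..K}"
  proof safe
    fix e b assume eb: "e \<in> E" "b \<in> B"
    have "0 \<le> coeff e i \<and> coeff e i < m" if "i < D" for i
      using E(1) eb(1) that by (auto simp: coeff_box_def D_def)
    moreover have "\<bar>coeff (R b) i\<bar> \<le> m * T * (2 ^ D - 1)" if "i < D" for i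
      using R(1)[OF eb(2)] that by (auto simp: coeff_box_def)
    moreover have "coeff e i = 0" "coeff (R b) i = 0" if "i \<ge> D" for i
      using E(1) eb(1) R(1)[OF eb(2)] that by (auto simp: coeff_box_def D_def)
    ultimately show "e + R b \<in> coeff_box D {-K..K}" using le by (fastforce simp: coeff_box_def)
  qed
  moreover have "inj_on ?F (E \<times> B)"
  proof (rule inj_onI, clarify)
    fix e b e' b' assume eb: "e \<in> E" "b \<in> B" "e' \<in> E" "b' \<in> B" and eq: "e + R b = e' + R b'"
    have 1: "Phi l dvd (e - e') + d * (b - b')"
    proof -
      have "(e - e') + d * (b - b') = (R b' - d * b') - (R b - d * b)"
        using eq by (simp add: algebra_simps)
      then show ?thesis using R(2)[OF eb(2)] R(2)[OF eb(4)] by (metis dvd_diff)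
    qed
    then obtain u where u: "(e - e') + d * (b - b') = Phi l * u" by blast
    then have "e - e' = Phi l * u - d * (b - b')" by (simp add: algebra_simps)
    then have "e - e' \<in> I" using I d(1) unfolding poly_ideal_def by auto
    then have ee: "e = e'" using E(2) eb by blast
    \<comment> \<open>With \<open>e = e'\<close> the product \<open>d * (b - b')\<close> is a
      multiple of \<open>Phi l\<close>. The nonzero reduced \<open>d\<close> does not vanish at
      \<open>zeta l\<close>, hence \<open>b - b'\<close> does, and it is reduced as well.\<close>
    have "complex_eval (zeta l) d * complex_eval (zeta l) (b - b') = 0"
      using arg_cong[OF u, of "complex_eval (zeta l)"] complex_eval_Phi_zeta[of 1 l] l1 ee by simp
    moreover have "complex_eval (zeta l) d \<noteq> 0"
      using complex_eval_zeta_eq_0_imp[OF l, of d] d(2,3) by (auto simp: coeff_box_def)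
    ultimately have "complex_eval (zeta l) (b - b') = 0" by simp
    then have "b - b' = 0"
      by (rule complex_eval_zeta_eq_0_imp[OF l, rotated])
          (use eb(2,4) in \<open>auto simp: B_def coeff_box_def D_def\<close>)
    then show "e = e' \<and> b = b'" using ee by simp
  qed
  ultimately have "card (E \<times> B) \<le> card (coeff_box D {-K..K})"
    using card_coeff_box[of "{-K..K}" D] by (intro card_inj_on_le) auto
  also have "\<dots> = nat (2 * K + 1) ^ D"
    using card_coeff_box[of "{-K..K}" D] by (simp add: algebra_simps)
  finally have "int (card E * nat m ^ D) \<le> int (nat (2 * K + 1) ^ D)"
    using B by (simp only: card_cartesian_product of_nat_le_iff)
  moreover have "K \<ge> 0" using m T by (simp add: K_def)
  ultimately have "int (card E) * m ^ D \<le> (2 * K + 1) ^ D" using m by simp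
  \<comment> \<open>\<open>K\<close> carries a factor \<open>m\<close> that cancels against the
    cardinality \<open>m ^ D\<close> of \<open>B\<close>, so the final bound does not depend on the
    size of the box that holds \<open>E\<close>.\<close>
  also have "\<dots> \<le> (2 ^ (l + 2) * T * m) ^ D"
  proof (rule power_mono)
    have "1 \<le> m * T * 1" using mT m by linarith
    also have "m * T * 1 \<le> m * T * 2 ^ l" using mT m by (intro mult_left_mono) auto
    finally show "2 * K + 1 \<le> 2 ^ (l + 2) * T * m" by (simp add: K_def algebra_simps)
  qed (use m T in \<open>simp add: K_def\<close>)
  finally have "int (card E) * m ^ D \<le> (2 ^ (l + 2) * T) ^ D * m ^ D"
    by (simp add: power_mult_distrib)
  then show ?thesis using m by (simp add: D_def)
qed

text \<open>Cut the box into cubes of side about \<open>Q\<^sup>1\<^sup>/\<^sup>D / k\<close>; each contains at most one element of \<open>G\<close>.\<close>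

lemma poly_packing:
  fixes Y :: nat
  assumes G: "G \<subseteq> coeff_box D {0..<int Y}" and D: "D > 0" and k: "k \<ge> 1" and Y: "Y \<ge> 1"
    and sep: "\<And>p q T. p \<in> G \<Longrightarrow> q \<in> G \<Longrightarrow> p \<noteq> q \<Longrightarrow> T \<ge> 1 \<Longrightarrow> p - q \<in> coeff_box D {- int T..int T}
       \<Longrightarrow> Q \<le> (k * T) ^ D"
  shows "card G * Q \<le> (4 * k * Y) ^ D \<or> card G \<le> 1"
proof -
  have finG: "finite G" using G card_coeff_box[of "{0..<int Y}" D] by (auto intro: finite_subset)
  have cG: "card G \<le> Y ^ D"
    using card_mono[OF _ G] card_coeff_box[of "{0..<int Y}" D] by simp
  show ?thesis
  proof (cases "Q \<le> k ^ D")
    case True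
    then have "card G * Q \<le> Y ^ D * k ^ D" using cG by (intro mult_mono) auto
    also have "\<dots> \<le> (4 * k * Y) ^ D" by (simp add: power_mult_distrib[symmetric] power_mono)
    finally show ?thesis ..
  next
    case False
    \<comment> \<open>The largest side for which \<open>sep\<close> still keeps two elements of
      \<open>G\<close> from differing by at most \<open>t\<close> in all coefficients. Maximality
      gives \<open>Q \<le> (k * Suc t) ^ D\<close>, which bounds \<open>Q\<close> in terms of
      \<open>t\<close>.\<close>
    define t where "t = (GREATEST t. (k * t) ^ D < Q)"
    have bound: "y \<le> Q" if "(k * y) ^ D < Q" for y
    proof -
      have "y \<le> k * y" using k by simp
      also have "\<dots> \<le> (k * y) ^ D" using D by (cases "k * y = 0") (auto intro: self_le_power)
      finally show "y \<le> Q" using that by simp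
    qed
    have ex: "(k * 1) ^ D < Q" using False by simp
    have t1: "(k * t) ^ D < Q" unfolding t_def
      by (rule GreatestI_nat[where P = "\<lambda>t. (k * t) ^ D < Q", OF ex bound])
    have "1 \<le> t" unfolding t_def by (rule Greatest_le_nat[where P =
        "\<lambda>t. (k * t) ^ D < Q", OF ex bound])
    have "\<not> (k * Suc t) ^ D < Q"
      using Greatest_le_nat[of "\<lambda>t. (k * t) ^ D < Q" "Suc t" Q] bound unfolding t_def[symmetric]
        by auto
    then have Q2: "Q \<le> (k * Suc t) ^ D" by simp
    have sep': "p = q" if "p \<in> G" "q \<in> G" "p - q \<in> coeff_box D {- int t..int t}" for p q
      using sep[OF that(1,2) _ \<open>1 \<le> t\<close> that(3)] t1 by auto
    show ?thesis
    proof (cases "t \<ge> Y")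
      case True
      have "p = q" if "p \<in> G" "q \<in> G" for p q
      proof (rule sep'[OF that])
        show "p - q \<in> coeff_box D {- int t..int t}" 
        proof (rule coeff_box_diffI)
          show pq: "p \<in> coeff_box D {0..<int Y}" "q \<in> coeff_box D {0..<int Y}" using that G by auto
          fix i assume "i < D"
          then have "coeff p i \<in> {0..<int Y}" "coeff q i \<in> {0..<int Y}" using pq
            by (auto simp: coeff_box_def)
          then show "\<bar>coeff p i - coeff q i\<bar> \<le> int t" using True by auto
        qed
      qed
      then have "card G \<le> 1" using finG by (auto simp: card_le_Suc0_iff_eq)
      then show ?thesis ..
    next
      case False
      let ?f = "map_poly (\<lambda>c. c div int t)"
      have cf: "coeff (?f p) i = coeff p i div int t" for p i by (simp add: coeff_map_poly)
      have "inj_on ?f G"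
      proof (rule inj_onI)
        fix p q assume pq: "p \<in> G" "q \<in> G" "?f p = ?f q"
        have "\<bar>coeff p i - coeff q i\<bar> < int t" for i
        proof -
          have "coeff p i div int t = coeff q i div int t"
            using arg_cong[OF pq(3), of "\<lambda>p. coeff p i"] by (simp add: cf)
          then have "coeff p i - coeff q i = coeff p i mod int t - coeff q i mod int t"
            by (simp add: minus_div_mult_eq_mod[symmetric])
          moreover have "0 \<le> coeff p i mod int t" "coeff p i mod int t < int t" 
             "0 \<le> coeff q i mod int t" "coeff q i mod int t < int t" using \<open>1 \<le> t\<close> by auto
          ultimately show ?thesis by linarith
        qed
        then have "p - q \<in> coeff_box D {- int t..int t}" 
          using pq(1,2) G by (intro coeff_box_diffI[of _ D "{0..<int Y}"]) (auto intro: less_imp_le)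
        then show "p = q" by (rule sep'[OF pq(1,2)])
      qed
      moreover have "?f ` G \<subseteq> coeff_box D {0..int (Y div t)}"
      proof safe
        fix p assume "p \<in> G"
        then have "p \<in> coeff_box D {0..<int Y}" using G by blast
        then show "?f p \<in> coeff_box D {0..int (Y div t)}" using \<open>1 \<le> t\<close>
          by (auto simp: coeff_box_def cf zdiv_int pos_imp_zdiv_nonneg_iff intro!:
              zdiv_mono1[OF less_imp_le])
      qed
      ultimately have "card G \<le> card (coeff_box D {0..int (Y div t)})"
        using card_coeff_box[of "{0..int (Y div t)}" D] by (intro card_inj_on_le) auto
      also have "\<dots> = (Y div t + 1) ^ D" using card_coeff_box[of "{0..int (Y div t)}" D]
        by simp (simp add: nat_add_distrib)
      finally have "card G * Q \<le> (Y div t + 1) ^ D * (k * Suc t) ^ D" using Q2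
        by (intro mult_mono) auto
      also have "\<dots> = ((Y div t + 1) * (k * Suc t)) ^ D" by (simp only: power_mult_distrib)
      also have "\<dots> \<le> (4 * k * Y) ^ D"
      proof (rule power_mono)
        have "(Y div t + 1) * (k * Suc t) \<le> (Y div t + 1) * (k * (2 * t))" using \<open>1 \<le> t\<close>
          by (intro mult_left_mono) auto
        also have "\<dots> = 2 * k * (Y div t * t + t)" by (simp add: algebra_simps)
        also have "\<dots> \<le> 2 * k * (Y + Y)" using False by (intro mult_left_mono add_mono) auto
        also have "\<dots> = 4 * k * Y" by simp
        finally show "(Y div t + 1) * (k * Suc t) \<le> 4 * k * Y" .
      qed simp
      finally show ?thesis ..
    qed
  qed
qed

lemma poly_idealD:
  assumes "poly_ideal I"
  shows "0 \<in> I" "a \<in> I \<Longrightarrow> b \<in> I \<Longrightarrow> a - b \<in> I" "a \<in> I \<Longrightarrow> a * b \<in> I" "a \<in> I \<Longrightarrow> b * a \<in> I"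
    "a \<in> I \<Longrightarrow> smult c a \<in> I" "a \<in> I \<Longrightarrow> - a \<in> I" "a \<in> I \<Longrightarrow> b \<in> I \<Longrightarrow> a + b \<in> I"
proof -
  show "0 \<in> I" "a \<in> I \<Longrightarrow> b \<in> I \<Longrightarrow> a - b \<in> I" and m: "a \<in> I \<Longrightarrow> a * b \<in> I"
    for a b using assms unfolding poly_ideal_def by auto
  then show "a \<in> I \<Longrightarrow> - a \<in> I" for a by (metis diff_0)
  then show "a \<in> I \<Longrightarrow> b \<in> I \<Longrightarrow> a + b \<in> I"
    using assms unfolding poly_ideal_def by (metis diff_minus_eq_add)
  show "a \<in> I \<Longrightarrow> b * a \<in> I" using m by (simp add: mult.commute)
  show "a \<in> I \<Longrightarrow> smult c a \<in> I" using m[of a "[:c:]"] by simp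
qed

section \<open>Prime ideals above a rational prime and their conjugates\<close>

definition prime_poly_ideal :: "int poly set \<Rightarrow> bool" where
  "prime_poly_ideal P \<longleftrightarrow> poly_ideal P \<and> 1 \<notin> P \<and> (\<forall>a b. a * b \<in> P \<longrightarrow> a \<in> P \<or> b \<in> P)"

text \<open>An ideal maximal among those that contain \<open>r\<close> and \<open>Phi l\<close> but
  not 1 is prime. The ideal generated by \<open>r\<close> and \<open>Phi l\<close> is proper:
  \<open>1 = r * u(zeta ^ j)\<close> for all conjugates would, on taking the product over
  \<open>j\<close>, make \<open>r ^ (l - 1)\<close> divide 1.\<close>

lemma prime_poly_ideal_exists:
  assumes l: "prime l" and r: "prime (r :: nat)"
  shows "\<exists>P. prime_poly_ideal P \<and> [:int r:] \<in> P \<and> Phi l \<in> P"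
proof -
  have l1: "l > 1" using l by (rule prime_gt_1_nat)
  define \<A> where "\<A> = {I. poly_ideal I \<and> [:int r:] \<in> I \<and> Phi l \<in> I \<and> 1 \<notin> I}"
  let ?I0 = "{smult (int r) u + Phi l * v | u v. True}"
  have "1 \<notin> ?I0"
  proof
    assume "1 \<in> ?I0"
    then obtain u v where uv: "1 = smult (int r) u + Phi l * v" by blast
    have "1 = of_int (int r) * complex_eval (zeta l ^ j) u" if "j \<in> {1..<l}" for j
      using arg_cong[OF uv, of "complex_eval (zeta l ^ j)"] complex_eval_Phi_zeta[of j l] that
        by simp
    then have "(\<Prod>j=1..<l. 1 :: complex) = (\<Prod>j=1..<l. of_int (int r) * complex_eval (zeta l ^ j) u)"
      by (intro prod.cong) auto
    then have "(1 :: complex) = of_int (int r) ^ (l - 1) * of_int (cyclo_norm l u)"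
      by (simp only: prod.distrib cyclo_norm_zeta[OF l, symmetric]) simp
    also have "\<dots> = of_int (int r ^ (l - 1) * cyclo_norm l u)" by simp
    finally have "1 = int r ^ (l - 1) * cyclo_norm l u" by (metis of_int_1 of_int_eq_iff)
    then have "int r ^ (l - 1) dvd 1" by (metis dvd_triv_left)
    moreover have "int r dvd int r ^ (l - 1)" using l1 by (intro dvd_power) auto
    ultimately have "int r dvd 1" by (rule dvd_trans[rotated])
    then show False using r by (metis int_dvd_int_iff not_prime_unit of_nat_1)
  qed
  moreover have "poly_ideal ?I0"
    unfolding poly_ideal_def
  proof (intro conjI ballI allI)
    show "0 \<in> ?I0" by (auto intro!: exI[of _ 0])
  next
    fix a b assume "a \<in> ?I0" "b \<in> ?I0"
    then obtain u v u' v' where "a = smult (int r) u + Phi l * v"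
        "b = smult (int r) u' + Phi l * v'" by blast
    then have "a - b = smult (int r) (u - u') + Phi l * (v - v')"
      by (simp add: algebra_simps smult_diff_right)
    then show "a - b \<in> ?I0" by blast
  next
    fix a b assume "a \<in> ?I0"
    then obtain u v where "a = smult (int r) u + Phi l * v" by blast
    then have "a * b = smult (int r) (u * b) + Phi l * (v * b)" by (simp add: algebra_simps)
    then show "a * b \<in> ?I0" by blast
  qed
  moreover have "[:int r:] \<in> ?I0" by (intro CollectI exI[of _ 1] exI[of _ 0]) simp
  moreover have "Phi l \<in> ?I0" by (intro CollectI exI[of _ 0] exI[of _ 1]) simp
  ultimately have ne: "\<A> \<noteq> {}" unfolding \<A>_def by blast
  have "\<exists>P\<in>\<A>. \<forall>I\<in>\<A>. P \<subseteq> I \<longrightarrow> I = P"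
  proof (rule subset_Zorn_nonempty[OF ne])
    fix \<C> assume C: "\<C> \<noteq> {}" "subset.chain \<A> \<C>"
    then have sub: "\<C> \<subseteq> \<A>" and ch: "\<And>I J. I \<in> \<C> \<Longrightarrow> J \<in> \<C> \<Longrightarrow> I \<subseteq> J \<or> J \<subseteq> I"
      by (auto simp: subset.chain_def)
    have "a - b \<in> \<Union>\<C>" if ab: "a \<in> \<Union>\<C>" "b \<in> \<Union>\<C>" for a b
    proof -
      obtain I J where IJ: "I \<in> \<C>" "a \<in> I" "J \<in> \<C>" "b \<in> J" using ab by blast
      then obtain K where "K \<in> \<C>" "a \<in> K" "b \<in> K" using ch[of I J] by blast
      moreover have "poly_ideal K" using \<open>K \<in> \<C>\<close> sub by (auto simp: \<A>_def)
      ultimately show ?thesis using poly_idealD(2) by (metis Union_iff)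
    qed
    moreover have mem: "poly_ideal I \<and> [:int r:] \<in> I \<and> Phi l \<in> I \<and> 1 \<notin> I" if "I \<in> \<C>" for I
      using that sub by (auto simp: \<A>_def)
    moreover obtain I0 where I0: "I0 \<in> \<C>" using C(1) by blast
    moreover have "a * b \<in> \<Union>\<C>" if ab: "a \<in> \<Union>\<C>" for a b
      using ab mem poly_idealD(3) by (metis Union_iff)
    moreover have "0 \<in> \<Union>\<C>" using I0 mem poly_idealD(1) by (metis Union_iff)
    moreover have "[:int r:] \<in> \<Union>\<C>" "Phi l \<in> \<Union>\<C>" "1 \<notin> \<Union>\<C>" using I0 mem by (metis Union_iff)+
    ultimately show "\<Union>\<C> \<in> \<A>" unfolding \<A>_def poly_ideal_def mem_Collect_eq
      by (intro conjI ballI allI)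
  qed
  then obtain P where P: "P \<in> \<A>" and max: "\<And>I. I \<in> \<A> \<Longrightarrow> P \<subseteq> I \<Longrightarrow> I = P" by blast
  have PI: "poly_ideal P" using P by (simp add: \<A>_def)
  \<comment> \<open>If \<open>a\<close> is outside \<open>P\<close>, then adjoining it to
    \<open>P\<close> produces 1 by maximality; multiply that representation of 1 by
    \<open>b\<close>.\<close>
  have "b \<in> P" if ab: "a * b \<in> P" "a \<notin> P" for a b
  proof -
    let ?I = "{p + a * c | p c. p \<in> P}"
    have sub: "P \<subseteq> ?I"
    proof
      fix p assume "p \<in> P"
      then show "p \<in> ?I" by (intro CollectI exI[of _ p] exI[of _ 0]) simp
    qed
    have "a \<in> ?I" using poly_idealD(1)[OF PI] by (intro CollectI exI[of _ 0] exI[of _ 1]) simp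
    then have "?I \<noteq> P" using ab(2) by blast
    then have "?I \<notin> \<A>" using max[OF _ sub] by blast
    moreover have "poly_ideal ?I"
      unfolding poly_ideal_def
    proof (intro conjI ballI allI)
      show "0 \<in> ?I" using sub poly_idealD(1)[OF PI] by blast
    next
      fix x y assume "x \<in> ?I" "y \<in> ?I"
      then obtain p c p' c' where "x = p + a * c" "y = p' + a * c'" "p \<in> P" "p' \<in> P" by blast
      then have "x - y = (p - p') + a * (c - c')" "p - p' \<in> P"
        using PI by (auto simp: algebra_simps poly_idealD)
      then show "x - y \<in> ?I" by blast
    next
      fix x y assume "x \<in> ?I"
      then obtain p c where "x = p + a * c" "p \<in> P" by blast
      then have "x * y = p * y + a * (c * y)" "p * y \<in> P"
        using PI by (auto simp: algebra_simps poly_idealD)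
      then show "x * y \<in> ?I" by blast
    qed
    ultimately have "1 \<in> ?I" using P sub unfolding \<A>_def by blast
    then obtain p c where "1 = p + a * c" "p \<in> P" by blast
    then have "b = p * b + (a * b) * c" by
        (metis mult.commute mult.left_commute distrib_right mult_1)
    then show "b \<in> P" using \<open>p \<in> P\<close> ab(1) PI by (metis poly_idealD(3,7))
  qed
  then show ?thesis using P unfolding prime_poly_ideal_def \<A>_def by blast
qed

lemma prime_poly_ideal_prodD:
  assumes "prime_poly_ideal P" "finite A" "(\<Prod>j\<in>A. f j) \<in> P"
  shows "\<exists>j\<in>A. f j \<in> P"
  using assms(2,3)
proof (induction A rule: finite_induct)
  case empty
  then show ?case using assms(1) by (simp add: prime_poly_ideal_def)
next
  case (insert a A)
  then show ?case using assms(1) unfolding prime_poly_ideal_def by auto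
qed

text \<open>This replaces the factorisation of \<open>(r)\<close> into prime ideals. The norm, a
  multiple of \<open>r\<close>, lies in \<open>P\<close>, and \<open>P\<close> contains
  \<open>Phi l\<close>, so the product of the conjugates of \<open>p\<close> lies in
  \<open>P\<close>; primality selects one of them.\<close>

lemma cyclo_norm_in_ideal:
  assumes l: "prime l" and P: "prime_poly_ideal P" "[:int r:] \<in> P" "Phi l \<in> P"
    and r: "int r dvd cyclo_norm l p"
  shows "\<exists>j\<in>{1..<l}. pcompose p (X ^ j) \<in> P"
proof -
  have PI: "poly_ideal P" using P by (simp add: prime_poly_ideal_def)
  obtain u where u: "(\<Prod>j=1..<l. pcompose p (X ^ j)) = [:cyclo_norm l p:] + Phi l * u"
    using cyclo_norm[OF l] by blast
  obtain k where "cyclo_norm l p = int r * k" using r by blast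
  then have "[:cyclo_norm l p:] = [:int r:] * [:k:]" by simp
  then have "[:cyclo_norm l p:] \<in> P" using P(2) poly_idealD(3)[OF PI] by metis
  then have "(\<Prod>j=1..<l. pcompose p (X ^ j)) \<in> P" unfolding u using P(3) PI
    by (intro poly_idealD) auto
  then show ?thesis using prime_poly_ideal_prodD[OF P(1), of "{1..<l}"] by blast
qed

text \<open>An integer of \<open>P\<close> prime to \<open>r\<close> would give
  \<open>1 \<in> P\<close> by Bezout.\<close>

lemma const_in_ideal:
  assumes P: "prime_poly_ideal P" "[:int r:] \<in> P" and r: "prime r"
  shows "[:c:] \<in> P \<longleftrightarrow> int r dvd c"
proof
  have PI: "poly_ideal P" using P by (simp add: prime_poly_ideal_def)
  show "[:c:] \<in> P" if "int r dvd c"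
  proof -
    obtain k where "c = int r * k" using \<open>int r dvd c\<close> by blast
    then have "[:c:] = [:int r:] * [:k:]" by simp
    then show ?thesis using P(2) poly_idealD(3)[OF PI] by metis
  qed
  show "int r dvd c" if c: "[:c:] \<in> P"
  proof (rule ccontr)
    assume "\<not> int r dvd c"
    then have "coprime (int r) c" using r by (simp add: prime_imp_coprime)
    then obtain a b where "a * int r + b * c = 1" by (metis bezout_int coprime_imp_gcd_eq_1)
    then have "1 = smult a [:int r:] + smult b [:c:]" by (simp add: one_pCons)
    then have "1 \<in> P" using P(2) c PI by (metis poly_idealD(5,7))
    then show False using P by (simp add: prime_poly_ideal_def)
  qed
qed

lemma X_power_diff_in_ideal:
  assumes P: "poly_ideal P" "X ^ i - [:c:] \<in> P"
  shows "X ^ (i * k) - [:c ^ k:] \<in> P"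
proof -
  have "(X ^ i - [:c:]) dvd (X ^ i) ^ k - [:c:] ^ k"
    by (metis dvd_triv_left power_diff_sumr2)
  then obtain q where "(X ^ i) ^ k - [:c:] ^ k = (X ^ i - [:c:]) * q" by blast
  moreover have "[:c:] ^ k = [:c ^ k:]" by (induction k) (auto simp: one_pCons)
  ultimately show ?thesis using P poly_idealD(3)[OF P(1)] by (metis power_mult)
qed

text \<open>Modulo \<open>P\<close> the element \<open>X\<close> has order exactly \<open>l\<close>.
  If some \<open>X ^ j\<close> were 1, then inverting \<open>j\<close> modulo \<open>l\<close> would
  make \<open>X\<close> congruent to 1, so \<open>Phi l\<close> to \<open>l\<close>, and
  \<open>r\<close> would divide \<open>l\<close>.\<close>

lemma X_power_minus_1_notin:
  assumes l: "prime l" and P: "prime_poly_ideal P" "[:int r:] \<in> P" "Phi l \<in> P"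
    and r: "prime r" "r \<noteq> l" and j: "j \<in> {1..<l}"
  shows "X ^ j - 1 \<notin> P"
proof
  assume A: "X ^ j - 1 \<in> P"
  have PI: "poly_ideal P" using P by (simp add: prime_poly_ideal_def)
  have "X ^ l - 1 \<in> P" unfolding X_power_minus_1 by (rule poly_idealD(4)[OF PI P(3)])
  have "\<not> l dvd j" using nat_dvd_not_less[of j l] j by auto
  then have "coprime l j" by (rule prime_imp_coprime[OF l])
  then have "coprime j l" by (rule coprime_commute[THEN iffD1])
  then obtain k where k: "[j * k = 1] (mod l)" using cong_solve_coprime_nat[of j l] by auto
  have "X ^ (j * k) - [:1 ^ k:] \<in> P" using A
    by (intro X_power_diff_in_ideal[OF PI]) (simp add: one_pCons)
  moreover have "X ^ (j * k) - X ^ 1 \<in> P"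
  proof -
    have "X ^ l - 1 dvd X ^ (j * k) - X ^ 1" using k by (intro X_power_cong) (simp add: cong_def)
    then show ?thesis using \<open>X ^ l - 1 \<in> P\<close> poly_idealD(3)[OF PI] by (metis dvdE)
  qed
  ultimately have "(X ^ (j * k) - [:1 ^ k:]) - (X ^ (j * k) - X ^ 1) \<in> P"
    by (rule poly_idealD(2)[OF PI])
  then have X1: "X - 1 \<in> P" by (simp flip: one_pCons)
  have "Phi l - [:int l:] = (X - 1) * synthetic_div (Phi l) 1"
    using synthetic_div_correct'[of 1 "Phi l"] by (simp add: X_def one_pCons poly_Phi algebra_simps)
  then have "Phi l - [:int l:] \<in> P" using poly_idealD(3)[OF PI X1] by metis
  from poly_idealD(2)[OF PI P(3) this] have "[:int l:] \<in> P" by simp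
  then have "int r dvd int l" using const_in_ideal[OF P(1,2) r(1)] by simp
  then show False using r l by (simp add: primes_dvd_imp_eq)
qed

text \<open>The product of \<open>X ^ j - 1\<close> and \<open>Phi l\<close> at \<open>X ^ j\<close>
  is \<open>X ^ (l * j) - 1\<close>, which lies in \<open>P\<close>, and the first factor does
  not.\<close>

lemma twisted_Phi_in_ideal:
  assumes l: "prime l" and P: "prime_poly_ideal P" "[:int r:] \<in> P" "Phi l \<in> P"
    and r: "prime r" "r \<noteq> l" and j: "j \<in> {1..<l}"
  shows "pcompose (Phi l) (X ^ j) \<in> P"
proof -
  have PI: "poly_ideal P" using P by (simp add: prime_poly_ideal_def)
  have "X ^ l - 1 \<in> P" unfolding X_power_minus_1 by (rule poly_idealD(4)[OF PI P(3)])
  have "(X ^ j - 1) * pcompose (Phi l) (X ^ j) = pcompose (X ^ l - 1) (X ^ j)"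
    by (simp add: X_power_minus_1 pcompose_mult pcompose_diff pcompose_1)
  also have "\<dots> = (X ^ l) ^ j - 1"
    by (simp add: pcompose_diff pcompose_power pcompose_1 power_mult[symmetric] mult.commute)
  also have "\<dots> = (X ^ l - 1) * (\<Sum>i<j. (X ^ l) ^ i)" by (rule power_diff_1_eq)
  also have "\<dots> \<in> P" by (intro poly_idealD(3)[OF PI]) fact
  finally show ?thesis using X_power_minus_1_notin[OF assms] P(1) unfolding prime_poly_ideal_def
    by blast
qed

text \<open>A single \<open>P\<close> suffices above each \<open>r\<close>: the other prime ideals
  needed are its preimages under the substitutions of \<open>X ^ j\<close> for
  \<open>X\<close>.\<close>

lemma twisted_ideal: "poly_ideal P \<Longrightarrow> poly_ideal {c. pcompose c q \<in> P}"
  unfolding poly_ideal_def by (auto simp: pcompose_diff pcompose_mult)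

text \<open>If \<open>X\<^sup>j\<close> were congruent to an integer \<open>c\<close> modulo \<open>P\<close>, then the order of \<open>c\<close> modulo \<open>r\<close> would
  divide both \<open>l\<close> and \<open>r - 1\<close>, hence be 1.\<close>

lemma bad_prime_separation:
  assumes l: "prime l" and P: "prime_poly_ideal P" "[:int r:] \<in> P" "Phi l \<in> P"
    and r: "prime r" "r \<noteq> l" "r mod l \<noteq> 1" and j: "j \<in> {1..<l}"
    and ab: "[:a, b:] \<in> {c. pcompose c (X ^ j) \<in> P}"
  shows "int r dvd a \<and> int r dvd b"
proof -
  have PI: "poly_ideal P" using P by (simp add: prime_poly_ideal_def)
  have l1: "l > 1" using l by (rule prime_gt_1_nat)
  have r1: "r > 1" using r prime_gt_1_nat by blast
  have ab': "[:a:] + smult b (X ^ j) \<in> P" using ab by (simp add: pcompose_pCons)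
  have "int r dvd b"
  proof (rule ccontr)
    assume "\<not> int r dvd b"
    then have "coprime (int r) b" using r by (simp add: prime_imp_coprime)
    then obtain u v where uv: "u * int r + v * b = 1" by (metis bezout_int coprime_imp_gcd_eq_1)
    define c where "c = - (v * a)"
    have "X ^ j - [:c:] = smult v ([:a:] + smult b (X ^ j)) + smult u ([:int r:] * X ^ j)"
    proof -
      have "X ^ j = smult (u * int r + v * b) (X ^ j)" by (simp add: uv)
      also have "\<dots> = smult (v * b) (X ^ j) + smult (u * int r) (X ^ j)"
        by (simp only: smult_add_left add.commute)
      finally have e: "X ^ j = smult (v * b) (X ^ j) + smult (u * int r) (X ^ j)" .
      have "smult v ([:a:] + smult b (X ^ j)) + smult u ([:int r:] * X ^ j) =
         [:v * a:] + (smult (v * b) (X ^ j) + smult (u * int r) (X ^ j))"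
        by (simp add: smult_add_right add.assoc)
      also have "\<dots> = [:v * a:] + X ^ j" by (simp only: e[symmetric])
      also have "[:v * a:] = - [:c:]" by (simp add: c_def)
      finally show ?thesis by simp
    qed
    then have Xc: "X ^ j - [:c:] \<in> P" using ab' P(2) PI by (simp only: poly_idealD)
    have 1: "X ^ (j * l) - [:c ^ l:] \<in> P" by (rule X_power_diff_in_ideal[OF PI Xc])
    have 2: "X ^ (l * j) - [:1 ^ j:] \<in> P"
      using poly_idealD(4)[OF PI P(3), of "X - 1"]
      by (intro X_power_diff_in_ideal[OF PI]) (simp add: X_power_minus_1 one_pCons[symmetric])
    have "(X ^ (l * j) - [:1 ^ j:]) - (X ^ (j * l) - [:c ^ l:]) \<in> P"
      by (rule poly_idealD(2)[OF PI 2 1])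
    then have "[:c ^ l - 1:] \<in> P" by (simp add: mult.commute)
    then have "int r dvd c ^ l - 1" using const_in_ideal[OF P(1,2) r(1)] by simp
    then have cl: "[c ^ l = 1] (mod int r)" by (simp add: cong_iff_dvd_diff)
    then have "coprime c (int r)" using l1
      by (metis coprime_power_left_iff cong_imp_coprime cong_sym coprime_1_left neq0_conv
          not_less_zero less_trans zero_less_one)
    define c' where "c' = nat (c mod int r)"
    have c'c: "[int c' = c] (mod int r)" using r1 by (simp add: c'_def cong_def)
    have cop: "coprime c' r" using \<open>coprime c (int r)\<close> c'c
      by (metis cong_imp_coprime cong_sym coprime_int_iff)
    have c'l: "[c' ^ l = 1] (mod r)"
      using cong_trans[OF cong_pow[OF c'c, of l] cl] by (metis cong_int_iff of_nat_1 of_nat_power)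
    have c'r: "[c' ^ (r - 1) = 1] (mod r)"
      using r(1) cop by (intro fermat_theorem)
          (metis coprime_common_divisor dvd_refl not_prime_unit)+
    have "\<not> l dvd r - 1"
    proof
      assume "l dvd r - 1"
      then have "r mod l = 1 mod l" using r1 by (metis mod_eq_dvd_iff_nat less_imp_le)
      then show False using r(3) l1 by simp
    qed
    then have "coprime l (r - 1)" using l by (simp add: prime_imp_coprime)
    then have "ord r c' = 1"
    proof -
      have "ord r c' dvd l" "ord r c' dvd r - 1"
        using c'l c'r ord_divides[of c' _ r] by auto
      then show ?thesis using \<open>coprime l (r - 1)\<close> by (metis coprime_common_divisor nat_dvd_1_iff_1)
    qed
    then have "[c' = 1] (mod r)" by (metis ord_works power_one_right)
    then have "[c = 1] (mod int r)" using c'c by (metis cong_int_iff cong_sym cong_trans of_nat_1)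
    then have "[:c - 1:] \<in> P" using const_in_ideal[OF P(1,2) r(1)] by (simp add: cong_iff_dvd_diff)
    from poly_idealD(7)[OF PI Xc this] have "X ^ j - [:c:] + [:c - 1:] \<in> P" .
    moreover have "[:c - 1:] = [:c:] - 1" by (simp add: one_pCons)
    ultimately have "X ^ j - 1 \<in> P" by simp
    then show False using X_power_minus_1_notin[OF l P r(1,2) j] by blast
  qed
  moreover from this have "smult b (X ^ j) \<in> P"
    using const_in_ideal[OF P(1,2) r(1), of b] poly_idealD(3)[OF PI, of "[:b:]" "X ^ j"] by simp
  from poly_idealD(2)[OF PI ab' this] have "[:a:] \<in> P" by simp
  then have "int r dvd a" using const_in_ideal[OF P(1,2) r(1)] by simp
  ultimately show ?thesis by simp
qed

text \<open>The constant term dominates the other coefficients, so every conjugate has absolute value at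
  least \<open>Y\<close>. No prime dividing \<open>M\<close> divides the norm.\<close>

definition box_elt :: "nat \<Rightarrow> nat \<Rightarrow> nat \<Rightarrow> int poly \<Rightarrow> int poly" where
  "box_elt l M Y g = [:1 + int M * int l * int Y:] + smult (int M) g"

section \<open>Box elements: sizes, membership in ideals, norms\<close>

lemma box_elt_bounds:
  assumes "l > 1" "M \<ge> 1" "Y \<ge> 1" "g \<in> coeff_box (l - 1) {0..<int Y}"
  shows "box_elt l M Y g \<in> coeff_box (l - 1) {- int (3 * l * M * Y)..int (3 * l * M * Y)}"
      "box_elt l M Y g \<noteq> 0"
proof -
  have g: "0 \<le> coeff g i" "coeff g i \<le> int Y" if "i < l - 1" for i
    using assms(4) that by (auto simp: coeff_box_def intro: less_imp_le)
  have g0: "coeff g i = 0" if "i \<ge> l - 1" for i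
    using assms(4) that by (auto simp: coeff_box_def)
  have Mg: "0 \<le> int M * coeff g i" "int M * coeff g i \<le> int M * int Y" if "i < l - 1" for i
    using g[OF that] by (auto intro: mult_left_mono)
  have MY: "1 \<le> int M * int Y" using assms(2,3)
    by (metis int_one_le_iff_zero_less mult_pos_pos of_nat_0_less_iff less_le_trans zero_less_one)
  have lMY: "int M * int Y \<le> int M * int l * int Y"
  proof -
    have "int M * int Y * 1 \<le> int M * int Y * int l" using assms(1) by (intro mult_left_mono) auto
    then show ?thesis by (simp add: mult.commute mult.left_commute)
  qed
  define L where "L = int M * int l * int Y"
  have e: "int (3 * l * M * Y) = 3 * L" by (simp add: L_def)
  show "box_elt l M Y g \<in> coeff_box (l - 1) {- int (3 * l * M * Y)..int (3 * l * M * Y)}"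
    unfolding coeff_box_def e
  proof (intro CollectI conjI allI impI)
    fix i assume i: "i < l - 1"
    have "coeff (box_elt l M Y g) i = (if i = 0 then 1 + L else 0) + int M * coeff g i"
      by (simp add: box_elt_def L_def coeff_pCons split: nat.splits)
    then show "coeff (box_elt l M Y g) i \<in> {- (3 * L)..3 * L}"
      using Mg[OF i] MY lMY[folded L_def] by (auto split: if_splits)
  next
    fix i assume i: "i \<ge> l - 1"
    then show "coeff (box_elt l M Y g) i = 0" using g0[OF i] assms(1)
      by (auto simp: box_elt_def coeff_pCons split: nat.splits)
  qed
  have "coeff (box_elt l M Y g) 0 \<ge> 1"
    using Mg[of 0] assms(1) by (simp add: box_elt_def)
  then show "box_elt l M Y g \<noteq> 0" by auto
qed

text \<open>If two box elements lie in \<open>I\<close>, then so does \<open>M * (p - q)\<close>,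
  and \<open>R \<in> I\<close> with \<open>R\<close> prime to \<open>M\<close> gives
  \<open>p - q \<in> I\<close>. By \<open>ideal_index_le\<close> such a difference cannot be small,
  which is the separation that \<open>poly_packing\<close> requires. For the second claim the same
  bound is applied to one box element itself.\<close>

lemma ideal_count:
  assumes l: "prime l" and M: "M \<ge> 1" and Y: "Y \<ge> 1"
    and I: "poly_ideal I" "Phi l \<in> I" "[:int R:] \<in> I" and R: "coprime R M"
    and E: "E \<subseteq> coeff_box (l - 1) {0..<m}" "\<And>e e'. e \<in> E \<Longrightarrow> e' \<in> E \<Longrightarrow> e - e' \<in> I \<Longrightarrow> e = e'"
      and m: "m \<ge> 1"
  defines "G \<equiv> {g \<in> coeff_box (l - 1) {0..<int Y}. box_elt l M Y g \<in> I}"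
  shows "card G * card E \<le> (4 * 2 ^ (l + 2) * Y) ^ (l - 1) \<or> card G \<le> 1"
    and "G \<noteq> {} \<Longrightarrow> card E \<le> (2 ^ (l + 2) * (3 * l * M * Y)) ^ (l - 1)"
proof -
  have l1: "l > 1" using l by (rule prime_gt_1_nat)
  have idx: "card E \<le> (2 ^ (l + 2) * T) ^ (l - 1)"
    if "d \<in> I" "d \<in> coeff_box (l - 1) {- int T..int T}" "d \<noteq> 0" "T \<ge> 1" for d and T :: nat
  proof -
    have "int (card E) \<le> (2 ^ (l + 2) * int T) ^ (l - 1)"
      by (rule ideal_index_le[OF l I(1,2) E that(1-3) m]) (use that(4) in simp_all)
    also have "\<dots> = int ((2 ^ (l + 2) * T) ^ (l - 1))" by simp
    finally show ?thesis by (simp only: of_nat_le_iff)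
  qed
  show "card G * card E \<le> (4 * 2 ^ (l + 2) * Y) ^ (l - 1) \<or> card G \<le> 1"
  proof (rule poly_packing)
    fix p q :: "int poly" and T :: nat
    assume pq: "p \<in> G" "q \<in> G" "p \<noteq> q" and T: "1 \<le> T" "p - q \<in> coeff_box (l - 1) {- int T..int T}"
    have "box_elt l M Y p - box_elt l M Y q = smult (int M) (p - q)"
      by (simp add: box_elt_def smult_diff_right)
    then have 1: "smult (int M) (p - q) \<in> I"
      using pq(1,2) poly_idealD(2)[OF I(1), of "box_elt l M Y p" "box_elt l M Y q"]
      by (simp add: G_def)
    obtain u v where uv: "u * int R + v * int M = 1" using R
      by (metis bezout_int coprime_int_iff coprime_imp_gcd_eq_1)
    have "p - q = smult (u * int R + v * int M) (p - q)" by (simp add: uv)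
    also have "\<dots> = smult u ([:int R:] * (p - q)) + smult v (smult (int M) (p - q))"
      by (simp add: smult_add_left)
    also have "\<dots> \<in> I"
      using 1 poly_idealD(3)[OF I(1,3), of "p - q"] poly_idealD(5,7)[OF I(1)] by blast
    finally have "p - q \<in> I" .
    then show "card E \<le> (2 ^ (l + 2) * T) ^ (l - 1)" using idx T pq(3) by auto
  qed (use l1 Y in \<open>auto simp: G_def\<close>)
  assume "G \<noteq> {}"
  then obtain g where g: "g \<in> coeff_box (l - 1) {0..<int Y}" "box_elt l M Y g \<in> I"
    by (auto simp: G_def)
  show "card E \<le> (2 ^ (l + 2) * (3 * l * M * Y)) ^ (l - 1)"
    using box_elt_bounds[OF l1 M Y g(1)] idx[OF g(2), of "3 * l * M * Y"] l1 M Y by simp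
qed

lemma norm_complex_eval_coeff_box:
  assumes "p \<in> coeff_box k {0..<int Y}" "norm w = 1"
  shows "norm (complex_eval w p) \<le> real k * real Y"
  using assms(1)
proof (induction k arbitrary: p)
  case (Suc k)
  then obtain a q where p: "p = pCons a q" "a \<in> {0..<int Y}" "q \<in> coeff_box k {0..<int Y}"
    by (auto simp: coeff_box_Suc)
  have "norm (complex_eval w p) \<le> norm (of_int a :: complex) + norm (w * complex_eval w q)"
    unfolding p(1) complex_eval_pCons by (rule norm_triangle_ineq)
  also have "\<dots> \<le> real Y + real k * real Y"
    using Suc.IH[OF p(3)] p(2) assms(2) by (intro add_mono) (auto simp: norm_mult)
  finally show ?case by (simp add: algebra_simps)
qed (simp add: coeff_box_0)

lemma cyclo_norm_box_elt_bounds: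
  assumes l: "prime l" and M: "M \<ge> 1" and Y: "Y \<ge> 1" and g: "g \<in> coeff_box (l - 1) {0..<int Y}"
  shows "int Y ^ (l - 1) \<le> \<bar>cyclo_norm l (box_elt l M Y g)\<bar>"
      "\<bar>cyclo_norm l (box_elt l M Y g)\<bar> \<le> int (3 * l * M * Y) ^ (l - 1)"
proof -
  have l1: "l > 1" using l by (rule prime_gt_1_nat)
  have MY: "real Y \<le> real M * real Y" "1 \<le> real M * real Y"
    using M Y mult_right_mono[of 1 "real M" "real Y"] mult_mono[of 1 "real M" 1 "real Y"]
      by simp_all
  have *: "real Y \<le> norm (complex_eval w (box_elt l M Y g))
      \<and> norm (complex_eval w (box_elt l M Y g)) \<le> real (3 * l * M * Y)"
    if w: "norm w = 1" for w
  proof -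
    define c where "c = 1 + real M * real l * real Y"
    have complex_eval: "complex_eval w (box_elt l M Y g) = of_real c + of_real (real M)
        * complex_eval w g" by (simp add: box_elt_def c_def)
    have n1: "norm (of_real c :: complex) = c" by (simp only: norm_of_real) (simp add: c_def)
    have "norm (complex_eval w g) \<le> real (l - 1) * real Y"
      by (rule norm_complex_eval_coeff_box[OF g w])
    then have "real M * norm (complex_eval w g) \<le> real M * (real (l - 1) * real Y)"
      by (intro mult_left_mono) auto
    also have "\<dots> = real M * real l * real Y - real M * real Y"
      using l1 by (simp add: of_nat_diff algebra_simps)
    finally have n2: "norm (of_real (real M) * complex_eval w g) \<le> real M * real l * real Y
        - real M * real Y"
      by (simp add: norm_mult)
    have "norm (of_real c :: complex) - norm (of_real (real M) * complex_eval w g)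
        \<le> norm (complex_eval w (box_elt l M Y g))"
      unfolding complex_eval by (metis add.commute norm_diff_ineq)
    then have lo: "real Y \<le> norm (complex_eval w (box_elt l M Y g))" using n1 n2 MY
      by (simp add: c_def)
    have "norm (complex_eval w (box_elt l M Y g)) \<le> norm (of_real c :: complex)
        + norm (of_real (real M) * complex_eval w g)"
      unfolding complex_eval by (rule norm_triangle_ineq)
    moreover have "0 \<le> real M * real l * real Y" by simp
    moreover have "real (3 * l * M * Y) = 3 * (real M * real l * real Y)" by simp
    ultimately have "norm (complex_eval w (box_elt l M Y g)) \<le> real (3 * l * M * Y)"
      using n1 n2 MY unfolding c_def by linarith
    with lo show ?thesis by simp
  qed
  have "real_of_int \<bar>cyclo_norm l (box_elt l M Y g)\<bar>
      = norm (of_int (cyclo_norm l (box_elt l M Y g)) :: complex)" by simp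
  also have "\<dots> = (\<Prod>j=1..<l. norm (complex_eval (zeta l ^ j) (box_elt l M Y g)))"
    by (simp only: cyclo_norm_zeta[OF l] prod_norm)
  finally have N: "real_of_int \<bar>cyclo_norm l (box_elt l M Y g)\<bar>
      = (\<Prod>j=1..<l. norm (complex_eval (zeta l ^ j) (box_elt l M Y g)))" .
  have "(\<Prod>j=1..<l. real Y) \<le> (\<Prod>j=1..<l. norm (complex_eval (zeta l ^ j) (box_elt l M Y g)))"
    using *[of "zeta l ^ _"] by (intro prod_mono) (auto simp: norm_power)
  then have "real_of_int (int Y ^ (l - 1)) \<le> real_of_int \<bar>cyclo_norm l (box_elt l M Y g)\<bar>"
    unfolding N by simp
  then show "int Y ^ (l - 1) \<le> \<bar>cyclo_norm l (box_elt l M Y g)\<bar>" by (simp only: of_int_le_iff)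
  have "(\<Prod>j=1..<l. norm (complex_eval (zeta l ^ j) (box_elt l M Y g)))
      \<le> (\<Prod>j=1..<l. real (3 * l * M * Y))"
    using *[of "zeta l ^ _"] by (intro prod_mono) (auto simp: norm_power)
  then have "real_of_int \<bar>cyclo_norm l (box_elt l M Y g)\<bar>
      \<le> real_of_int (int (3 * l * M * Y) ^ (l - 1))" unfolding N by simp
  then show "\<bar>cyclo_norm l (box_elt l M Y g)\<bar> \<le> int (3 * l * M * Y) ^ (l - 1)"
    by (simp only: of_int_le_iff)
qed

text \<open>With \<open>r - 1 = l * e\<close> and a primitive root \<open>g\<close>, the element
  \<open>g ^ e\<close> has order \<open>l\<close> modulo \<open>r\<close>. Its \<open>r\<close>-th
  power is congruent to it modulo \<open>r\<close>, and has \<open>l\<close>-th power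
  \<open>g ^ (r * (r - 1))\<close>, which is 1 modulo \<open>r ^ 2\<close> by Euler. Since
  \<open>W ^ j - 1\<close> is prime to \<open>r\<close>, the factor \<open>Phi l\<close> of
  \<open>X ^ l - 1\<close> absorbs all of \<open>r ^ 2\<close> at \<open>W ^ j\<close>.\<close>

lemma root_of_unity_mod:
  assumes l: "prime l" and r: "prime r" "r mod l = 1"
  shows "\<exists>W::int. (\<forall>j\<in>{1..<l}. int r ^ 2 dvd poly (Phi l) (W ^ j)) \<and>
           (\<forall>i\<in>{1..<l}. \<forall>j\<in>{1..<l}. int r dvd W ^ i - W ^ j \<longrightarrow> i = j)"
proof -
  have l1: "l > 1" using l by (rule prime_gt_1_nat)
  have r1: "r > 1" using r prime_gt_1_nat by blast
  have "[1 = r] (mod l)" using r l1 by (simp add: cong_def)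
  then have "l dvd r - 1" using r1 by (metis cong_altdef_nat cong_sym less_imp_le)
  then obtain e where e: "r - 1 = l * e" by blast
  then have e0: "e > 0" using r1 by (cases e) auto
  obtain g where g: "residue_primroot r g" using prime_primitive_root_exists[of r] r1 r by auto
  then have cop: "coprime r g" and ordg: "ord r g = r - 1"
    using r by (auto simp: residue_primroot_def totient_prime)
  define w where "w = g ^ (r * e)"
  have inj: "i = j" if "i < l" "j < l" "[w ^ i = w ^ j] (mod r)" for i j
  proof -
    have "[g ^ (r * e * i) = g ^ (r * e * j)] (mod r)"
      using that(3) by (simp add: w_def power_mult)
    then have "[r * e * i = r * e * j] (mod (r - 1))"
      using order_divides_expdiff[OF cop] ordg by simp
    moreover have "[r * e * i = e * i] (mod (r - 1))" "[r * e * j = e * j] (mod (r - 1))"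
    proof -
      have "[r = 1] (mod (r - 1))" using r1 by (simp add: cong_altdef_nat)
      from cong_scalar_right[OF this, of "e * i"] cong_scalar_right[OF this, of "e * j"]
      show "[r * e * i = e * i] (mod (r - 1))" "[r * e * j = e * j] (mod (r - 1))"
        by (simp_all add: mult.assoc)
    qed
    ultimately have "[e * i = e * j] (mod (r - 1))" by (metis cong_sym cong_trans)
    then have "[i = j] (mod l)" unfolding e using e0
      by (simp add: cong_def mult.commute[of l] mult_mod_right[symmetric])
    then show ?thesis using that by (simp add: cong_def)
  qed
  have wl: "[w ^ l = 1] (mod r ^ 2)"
  proof -
    have "w ^ l = g ^ (r * (r - 1))" unfolding e by (simp add: w_def power_mult[symmetric] mult_ac)
    moreover have "totient (r ^ 2) = r * (r - 1)" using r by (simp add: totient_prime_power)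
    moreover have "coprime g (r ^ 2)" using cop by (simp add: coprime_commute)
    ultimately show ?thesis using euler_theorem[of g "r ^ 2"] by simp
  qed
  show ?thesis
  proof (intro exI[of _ "int w"] conjI ballI impI)
    fix j assume j: "j \<in> {1..<l}"
    have "(int w ^ j - 1) * poly (Phi l) (int w ^ j) = poly (X ^ l - 1) (int w ^ j)"
      by (simp add: X_power_minus_1)
    also have "\<dots> = (int w ^ l) ^ j - 1" by (simp add: power_mult[symmetric] mult.commute)
    finally have eq: "(int w ^ j - 1) * poly (Phi l) (int w ^ j) = (int w ^ l) ^ j - 1" .
    have "[(w ^ l) ^ j = 1 ^ j] (mod r ^ 2)" by (rule cong_pow[OF wl])
    then have "[int ((w ^ l) ^ j) = int 1] (mod int (r ^ 2))" by (simp only: cong_int_iff power_one)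
    then have d: "int r ^ 2 dvd (int w ^ l) ^ j - 1" by (simp add: cong_iff_dvd_diff)
    have "\<not> [w ^ j = w ^ 0] (mod r)" using inj[of j 0] j by auto
    have "\<not> int r dvd int w ^ j - 1"
    proof
      assume "int r dvd int w ^ j - 1"
      then have "[int (w ^ j) = int (w ^ 0)] (mod int r)" by (simp add: cong_iff_dvd_diff)
      then show False using \<open>\<not> [w ^ j = w ^ 0] (mod r)\<close> by (simp only: cong_int_iff)
    qed
    then have "coprime (int r ^ 2) (int w ^ j - 1)" using r(1) by (simp add: prime_imp_coprime)
    then show "int r ^ 2 dvd poly (Phi l) (int w ^ j)"
      using d unfolding eq[symmetric] by (simp add: coprime_dvd_mult_right_iff)
  next
    fix i j assume ij: "i \<in> {1..<l}" "j \<in> {1..<l}" "int r dvd int w ^ i - int w ^ j"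
    then have "[int (w ^ i) = int (w ^ j)] (mod int r)" by (simp add: cong_iff_dvd_diff)
    then show "i = j" using inj ij by (simp only: cong_int_iff) auto
  qed
qed

text \<open>The alternative \<open>card (G k) \<le> 1\<close> is the exceptional case of the packing
  bound; it is paid for by the summand \<open>Q\<close>.\<close>

lemma card_UN_bound:
  fixes A Q :: nat
  assumes "finite K" "S \<subseteq> (\<Union>k\<in>K. G k)" "\<And>k. k \<in> K \<Longrightarrow> finite (G k)"
    "\<And>k. k \<in> K \<Longrightarrow> card (G k) * Q \<le> A \<or> card (G k) \<le> 1"
  shows "card S * Q \<le> card K * (A + Q)"
proof -
  have "card S \<le> card (\<Union>k\<in>K. G k)" using assms(1-3) by (intro card_mono) auto
  also have "\<dots> \<le> (\<Sum>k\<in>K. card (G k))" by (rule card_UN_le[OF assms(1)])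
  finally have "card S * Q \<le> (\<Sum>k\<in>K. card (G k)) * Q" by (rule mult_right_mono) simp
  also have "\<dots> = (\<Sum>k\<in>K. card (G k) * Q)" by (simp add: sum_distrib_right)
  also have "\<dots> \<le> (\<Sum>k\<in>K. A + Q)"
  proof (rule sum_mono)
    fix k assume "k \<in> K"
    then show "card (G k) * Q \<le> A + Q" using assms(4)[of k]
      by (auto intro: trans_le_add1 trans_le_add2 mult_le_mono1[of _ 1 , simplified])
  qed
  finally show ?thesis by simp
qed

lemma linear_in_coeff_box: "l \<ge> 3 \<Longrightarrow> a \<in> A \<Longrightarrow> b \<in> A \<Longrightarrow> 0 \<in> A \<Longrightarrow> [:a, b:] \<in> coeff_box (l - 1) A"
  by (auto simp: coeff_box_def coeff_pCons split: nat.splits)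

lemma const_in_coeff_box: "l \<ge> 2 \<Longrightarrow> a \<in> A \<Longrightarrow> 0 \<in> A \<Longrightarrow> [:a:] \<in> coeff_box (l - 1) A"
  by (auto simp: coeff_box_def coeff_pCons split: nat.splits)

lemma eq_if_dvd_diff: "a \<in> {0..<n} \<Longrightarrow> b \<in> {0..<n} \<Longrightarrow> n dvd a - b \<Longrightarrow> a = (b :: int)"
  by (auto dest: zdvd_not_zless zdvd_imp_le simp: mod_eq_dvd_iff[symmetric])

lemma prime_sq_dvd_prod:
  fixes f :: "nat \<Rightarrow> int"
  assumes A: "finite A" and r: "prime r" and d: "int r ^ 2 dvd (\<Prod>j\<in>A. f j)"
  shows "(\<exists>j\<in>A. int r ^ 2 dvd f j) \<or> (\<exists>i\<in>A. \<exists>j\<in>A. i \<noteq> j \<and> int r dvd f i \<and> int r dvd f j)"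
proof -
  have pr: "prime (int r)" using r by simp
  have "int r dvd int r ^ 2" by simp
  then have "int r dvd (\<Prod>j\<in>A. f j)" using d dvd_trans by blast
  then obtain j where j: "j \<in> A" "int r dvd f j" using prime_dvd_prod_iff[OF A pr] by blast
  have e: "(\<Prod>j\<in>A. f j) = f j * (\<Prod>i\<in>A - {j}. f i)" using A j(1) by (rule prod.remove)
  show ?thesis
  proof (cases "int r dvd (\<Prod>i\<in>A - {j}. f i)")
    case True
    then obtain i where "i \<in> A - {j}" "int r dvd f i"
      using prime_dvd_prod_iff[of "A - {j}" "int r"] A pr by blast
    then show ?thesis using j by blast
  next
    case False
    then have "coprime (int r ^ 2) (\<Prod>i\<in>A - {j}. f i)" using pr by (simp add: prime_imp_coprime)
    then have "int r ^ 2 dvd f j" using d unfolding e by (simp add: coprime_dvd_mult_left_iff)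
    then show ?thesis using j(1) by blast
  qed
qed

lemma divisor_ideal: "poly_ideal {c. n dvd poly c w}"
  unfolding poly_ideal_def by auto

text \<open>A residue field above such an \<open>r\<close> is larger than the field with
  \<open>r\<close> elements: the \<open>r ^ 2\<close> polynomials \<open>a + b X\<close> with
  \<open>0 \<le> a, b < r\<close> are incongruent modulo \<open>P\<close> and its conjugates. The
  resulting proportion \<open>1 / r ^ 2\<close> is summable over \<open>r\<close>, which
  \<open>1 / r\<close> would not be.\<close>

lemma bad_prime_count:
  assumes l: "prime l" "l \<ge> 3" and M: "M \<ge> 1" and Y: "Y \<ge> 1"
    and r: "prime r" "coprime r M" "r \<noteq> l" "r mod l \<noteq> 1"
    and S: "S \<subseteq> {g \<in> coeff_box (l - 1) {0..<int Y}. int r dvd cyclo_norm l (box_elt l M Y g)}"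
  shows "card S * r ^ 2 \<le> l ^ 2 * ((4 * 2 ^ (l + 2) * Y) ^ (l - 1) + r ^ 2)"
    and "S \<noteq> {} \<Longrightarrow> r ^ 2 \<le> (2 ^ (l + 2) * (3 * l * M * Y)) ^ (l - 1)"
proof -
  obtain P where P: "prime_poly_ideal P" "[:int r:] \<in> P" "Phi l \<in> P"
    using prime_poly_ideal_exists[OF l(1) r(1)] by blast
  have PI: "poly_ideal P" using P by (simp add: prime_poly_ideal_def)
  define I where "I j = {c. pcompose c (X ^ j) \<in> P}" for j
  define G where "G j = {g \<in> coeff_box (l - 1) {0..<int Y}. box_elt l M Y g \<in> I j}" for j
  define E where "E = (\<lambda>(a, b). [:a, b:]) ` ({0..<int r} \<times> {0..<int r})"
  have r0: "r > 0" using r(1) by (rule prime_gt_0_nat)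
  have cE: "card E = r ^ 2"
  proof -
    have "inj_on (\<lambda>(a, b). [:a, b:]) ({0..<int r} \<times> {0..<int r})" by (auto intro: inj_onI)
    then show ?thesis by (simp add: E_def card_image card_cartesian_product power2_eq_square)
  qed
  have EB: "E \<subseteq> coeff_box (l - 1) {0..<int r}" 
    unfolding E_def using linear_in_coeff_box[OF l(2), of _ "{0..<int r}"] r0 by auto
  have sep: "e = e'" if j: "j \<in> {1..<l}" and e: "e \<in> E" "e' \<in> E" "e - e' \<in> I j" for j e e'
  proof -
    obtain a b a' b' where ab: "e = [:a, b:]" "e' = [:a', b':]" "a \<in> {0..<int r}" "b \<in> {0..<int r}"
      "a' \<in> {0..<int r}" "b' \<in> {0..<int r}" using e(1,2) by (auto simp: E_def)
    have "[:a - a', b - b':] \<in> {c. pcompose c (X ^ j) \<in> P}" using e(3) by (simp add: I_def ab)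
    from bad_prime_separation[OF l(1) P r(1,3,4) j this] show ?thesis
      using ab eq_if_dvd_diff[of a "int r" a'] eq_if_dvd_diff[of b "int r" b'] by simp
  qed
  have II: "poly_ideal (I j)" for j unfolding I_def by (rule twisted_ideal[OF PI])
  have IP: "Phi l \<in> I j" if "j \<in> {1..<l}" for j
    unfolding I_def using twisted_Phi_in_ideal[OF l(1) P r(1,3) that] by simp
  have Ir: "[:int r:] \<in> I j" for j using P(2) by (simp add: I_def)
  have sub: "S \<subseteq> (\<Union>j\<in>{1..<l}. G j)"
  proof
    fix g assume "g \<in> S"
    then have g: "g \<in> coeff_box (l - 1) {0..<int Y}" "int r dvd cyclo_norm l (box_elt l M Y g)"
      using S by auto
    from cyclo_norm_in_ideal[OF l(1) P g(2)] show "g \<in> (\<Union>j\<in>{1..<l}. G j)" using g(1)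
      by (auto simp: G_def I_def)
  qed
  have "card S * r ^ 2 \<le> card {1..<l} * ((4 * 2 ^ (l + 2) * Y) ^ (l - 1) + r ^ 2)"
  proof (rule card_UN_bound[OF _ sub])
    fix j assume j: "j \<in> {1..<l}"
    show "finite (G j)" unfolding G_def using card_coeff_box[of "{0..<int Y}" "l - 1"] by simp
    show "card (G j) * r ^ 2 \<le> (4 * 2 ^ (l + 2) * Y) ^ (l - 1) \<or> card (G j) \<le> 1"
      using ideal_count(1)[OF l(1) M Y II IP[OF j] Ir r(2) EB sep[OF j]] r0 unfolding cE G_def
        by simp
  qed simp
  also have "\<dots> \<le> l ^ 2 * ((4 * 2 ^ (l + 2) * Y) ^ (l - 1) + r ^ 2)"
    using l(2) by (intro mult_right_mono)
        (auto simp: power2_eq_square intro: le_trans[OF diff_le_self])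
  finally show "card S * r ^ 2 \<le> l ^ 2 * ((4 * 2 ^ (l + 2) * Y) ^ (l - 1) + r ^ 2)" .
  assume "S \<noteq> {}"
  then obtain j where j: "j \<in> {1..<l}" "G j \<noteq> {}" using sub by blast
  show "r ^ 2 \<le> (2 ^ (l + 2) * (3 * l * M * Y)) ^ (l - 1)"
    using ideal_count(2)[OF l(1) M Y II IP[OF j(1)] Ir r(2) EB sep[OF j(1)]] r0 j(2)
      unfolding cE G_def by simp
qed

text \<open>By \<open>prime_sq_dvd_prod\<close> either one of the values at the \<open>W ^ j\<close>
  is divisible by \<open>r ^ 2\<close>, or two of them by \<open>r\<close>. Both kinds of ideal,
  indexed by pairs with \<open>i = j\<close> and \<open>i \<noteq> j\<close>, separate
  \<open>r ^ 2\<close> elements: the constants below \<open>r ^ 2\<close>, and the linear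
  polynomials with coefficients below \<open>r\<close>, as \<open>W ^ i\<close> and
  \<open>W ^ j\<close> are incongruent modulo \<open>r\<close>.\<close>

lemma square_count:
  assumes l: "prime l" "l \<ge> 3" and M: "M \<ge> 1" and Y: "Y \<ge> 1"
    and r: "prime r" "coprime r M" "r mod l = 1"
    and S: "S \<subseteq> {g \<in> coeff_box (l - 1) {0..<int Y}. int r ^ 2 dvd cyclo_norm l (box_elt l M Y g)}"
  shows "card S * r ^ 2 \<le> l ^ 2 * ((4 * 2 ^ (l + 2) * Y) ^ (l - 1) + r ^ 2)"
    and "S \<noteq> {} \<Longrightarrow> r ^ 2 \<le> (2 ^ (l + 2) * (3 * l * M * Y)) ^ (l - 1)"
proof -
  obtain W :: int where W: "\<And>j. j \<in> {1..<l} \<Longrightarrow> int r ^ 2 dvd poly (Phi l) (W ^ j)"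
    "\<And>i j. i \<in> {1..<l} \<Longrightarrow> j \<in> {1..<l} \<Longrightarrow> int r dvd W ^ i - W ^ j \<Longrightarrow> i = j"
    using root_of_unity_mod[OF l(1) r(1,3)] by blast
  have l1: "l > 1" using l by simp
  have r0: "r > 0" using r(1) by (rule prime_gt_0_nat)
  define I where "I = (\<lambda>(i, j). if i = j then {c. int r ^ 2 dvd poly c (W ^ i)}
     else {c. int r dvd poly c (W ^ i)} \<inter> {c. int r dvd poly c (W ^ j)})"
  define E where "E = (\<lambda>(i::nat, j::nat). if i = j then (\<lambda>a. [:a:]) ` {0..<int (r ^ 2)}
     else (\<lambda>(a, b). [:a, b:]) ` ({0..<int r} \<times> {0..<int r}))"
  define m where "m = int (r ^ 2)"
  define G where "G k = {g \<in> coeff_box (l - 1) {0..<int Y}. box_elt l M Y g \<in> I k}" for k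
  let ?K = "{1..<l} \<times> {1..<l}"
  have rm: "int r \<le> m" "m \<ge> 1" using r0
    by (auto simp: m_def power2_eq_square simp flip: of_nat_mult)
  have cE: "card (E k) = r ^ 2" for k
  proof -
    have 1: "inj_on (\<lambda>(a, b). [:a, b:]) ({0..<int r} \<times> {0..<int r})" by (auto intro: inj_onI)
    have 2: "inj_on (\<lambda>a. [:a:]) {0..<int (r ^ 2)}" by (auto intro: inj_onI)
    have "card ((\<lambda>(a, b). [:a, b:]) ` ({0..<int r} \<times> {0..<int r})) = r ^ 2"
      using card_image[OF 1] by (simp add: card_cartesian_product power2_eq_square)
    moreover have "card ((\<lambda>a. [:a:]) ` {0..<int (r ^ 2)}) = r ^ 2"
      using card_image[OF 2] by (simp only: card_atLeastLessThan_int diff_zero nat_int)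
    ultimately show ?thesis unfolding E_def by (simp only: split: prod.split if_split) simp
  qed
  have EB: "E k \<subseteq> coeff_box (l - 1) {0..<m}" for k
  proof -
    have "(\<lambda>a. [:a:]) ` {0..<int (r ^ 2)} \<subseteq> coeff_box (l - 1) {0..<m}"
      using const_in_coeff_box[of l _ "{0..<m}"] l(2) rm r0 unfolding m_def by auto
    moreover have "(\<lambda>(a, b). [:a, b:]) ` ({0..<int r} \<times> {0..<int r}) \<subseteq> coeff_box (l - 1) {0..<m}"
      using linear_in_coeff_box[OF l(2), of _ "{0..<m}"] rm by auto
    ultimately show ?thesis unfolding E_def by (auto split: prod.split)
  qed
  have II: "poly_ideal (I k)" for k
  proof -
    have "poly_ideal (A \<inter> B)" if "poly_ideal A" "poly_ideal B" for A B
      using that unfolding poly_ideal_def by blast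
    then show ?thesis unfolding I_def using divisor_ideal by (auto split: prod.split)
  qed
  have rr: "int r dvd x" if "int r ^ 2 dvd x" for x
    using that by (metis dvd_trans dvd_triv_left power2_eq_square)
  have IP: "Phi l \<in> I k" if "k \<in> ?K" for k
    using that W(1) rr unfolding I_def by (auto split: prod.split)
  have Ir: "[:int (r ^ 2):] \<in> I k" for k
    unfolding I_def by (auto split: prod.split)
  have cop: "coprime (r ^ 2) M" using r(2) by simp
  have sep: "e = e'" if k: "k \<in> ?K" and e: "e \<in> E k" "e' \<in> E k" "e - e' \<in> I k" for k e e'
  proof -
    obtain i j where ij: "k = (i, j)" "i \<in> {1..<l}" "j \<in> {1..<l}" using k by blast
    show ?thesis
    proof (cases "i = j")
      case True
      then obtain a a' where a: "e = [:a:]" "e' = [:a':]" "a \<in> {0..<int (r ^ 2)}"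
          "a' \<in> {0..<int (r ^ 2)}"
        using e(1,2) by (auto simp: E_def ij)
      then have "int (r ^ 2) dvd a - a'" using e(3) True by (simp add: I_def ij)
      then show ?thesis using a eq_if_dvd_diff by blast
    next
      case False
      then obtain a b a' b' where ab: "e = [:a, b:]" "e' = [:a', b':]" "a \<in> {0..<int r}"
          "b \<in> {0..<int r}"
        "a' \<in> {0..<int r}" "b' \<in> {0..<int r}" using e(1,2) by (auto simp: E_def ij)
      have d1: "int r dvd (a - a') + W ^ i * (b - b')"
        and d2: "int r dvd (a - a') + W ^ j * (b - b')"
        using e(3) False by (simp_all add: I_def ij ab)
      have "int r dvd ((a - a') + W ^ i * (b - b')) - ((a - a') + W ^ j * (b - b'))"
        using d1 d2 by (rule dvd_diff)
      then have "int r dvd (W ^ i - W ^ j) * (b - b')" by (simp add: algebra_simps)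
      moreover have "\<not> int r dvd W ^ i - W ^ j" using W(2)[OF ij(2,3)] False by blast
      ultimately have b: "int r dvd b - b'" using r(1) by (simp add: prime_dvd_mult_iff)
      then have "int r dvd W ^ i * (b - b')" by simp
      then have "int r dvd a - a'" using d1 by (simp add: dvd_add_left_iff)
      then show ?thesis
        using b ab eq_if_dvd_diff[of a "int r" a'] eq_if_dvd_diff[of b "int r" b'] by simp
    qed
  qed
  have sub: "S \<subseteq> (\<Union>k\<in>?K. G k)"
  proof
    fix g assume "g \<in> S"
    then have g: "g \<in> coeff_box (l - 1) {0..<int Y}"
        "int r ^ 2 dvd cyclo_norm l (box_elt l M Y g)" using S by auto
    have "int r ^ 2 dvd (\<Prod>j=1..<l. poly (box_elt l M Y g) (W ^ j)) - cyclo_norm l (box_elt l M Y g)"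
      by (rule cyclo_norm_cong[OF l(1)]) (use W(1)[of 1] l1 in simp)
    from dvd_add[OF this g(2)] have "int r ^ 2 dvd (\<Prod>j=1..<l. poly (box_elt l M Y g) (W ^ j))"
      by simp
    from prime_sq_dvd_prod[OF _ r(1) this] consider
      j where "j \<in> {1..<l}" "int r ^ 2 dvd poly (box_elt l M Y g) (W ^ j)" |
      i j where "i \<in> {1..<l}" "j \<in> {1..<l}" "i \<noteq> j" "int r dvd poly (box_elt l M Y g) (W ^ i)"
          "int r dvd poly (box_elt l M Y g) (W ^ j)"
      by auto
    then show "g \<in> (\<Union>k\<in>?K. G k)"
    proof cases
      case (1 j)
      then have "g \<in> G (j, j)" using g(1) by (simp add: G_def I_def)
      then show ?thesis using 1(1) by blast
    next
      case (2 i j)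
      then have "g \<in> G (i, j)" using g(1) by (simp add: G_def I_def)
      then show ?thesis using 2(1,2) by blast
    qed
  qed
  have "card S * r ^ 2 \<le> card ?K * ((4 * 2 ^ (l + 2) * Y) ^ (l - 1) + r ^ 2)"
  proof (rule card_UN_bound[OF _ sub])
    fix k assume k: "k \<in> ?K"
    show "finite (G k)" unfolding G_def using card_coeff_box[of "{0..<int Y}" "l - 1"] by simp
    show "card (G k) * r ^ 2 \<le> (4 * 2 ^ (l + 2) * Y) ^ (l - 1) \<or> card (G k) \<le> 1"
      using ideal_count(1)[OF l(1) M Y II IP[OF k] Ir cop EB sep[OF k] rm(2)] unfolding cE G_def
        by simp
  qed simp
  also have "\<dots> \<le> l ^ 2 * ((4 * 2 ^ (l + 2) * Y) ^ (l - 1) + r ^ 2)"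
    by (intro mult_right_mono) (auto simp: power2_eq_square card_cartesian_product intro!:
        mult_mono)
  finally show "card S * r ^ 2 \<le> l ^ 2 * ((4 * 2 ^ (l + 2) * Y) ^ (l - 1) + r ^ 2)" .
  assume "S \<noteq> {}"
  then obtain k where k: "k \<in> ?K" "G k \<noteq> {}" using sub by blast
  show "r ^ 2 \<le> (2 ^ (l + 2) * (3 * l * M * Y)) ^ (l - 1)"
    using ideal_count(2)[OF l(1) M Y II IP[OF k(1)] Ir cop EB sep[OF k(1)] rm(2)] k(2)
      unfolding cE G_def by simp
qed

text \<open>Here only the constants below \<open>r\<close> are separated, so the proportion is of
  order \<open>1 / r\<close>. That is the true order for a split prime, and it is needed as an upper
  bound in the double count of \<open>sum_ln_good_primes_ge_aux\<close>.\<close>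

lemma good_prime_count:
  assumes l: "prime l" "l \<ge> 3" and M: "M \<ge> 1" and Y: "Y \<ge> 1"
    and r: "prime r" "coprime r M" "r mod l = 1"
    and S: "S \<subseteq> {g \<in> coeff_box (l - 1) {0..<int Y}. int r dvd cyclo_norm l (box_elt l M Y g)}"
  shows "card S * r \<le> (l - 1) * ((4 * 2 ^ (l + 2) * Y) ^ (l - 1) + r)"
    and "S \<noteq> {} \<Longrightarrow> r \<le> (2 ^ (l + 2) * (3 * l * M * Y)) ^ (l - 1)"
proof -
  obtain W :: int where W: "\<And>j. j \<in> {1..<l} \<Longrightarrow> int r ^ 2 dvd poly (Phi l) (W ^ j)"
    using root_of_unity_mod[OF l(1) r(1,3)] by blast
  have l1: "l > 1" using l by simp
  have r0: "r > 0" using r(1) by (rule prime_gt_0_nat)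
  define I where "I j = {c. int r dvd poly c (W ^ j)}" for j
  define G where "G j = {g \<in> coeff_box (l - 1) {0..<int Y}. box_elt l M Y g \<in> I j}" for j
  define E where "E = (\<lambda>a. [:a:]) ` {0..<int r}"
  have cE: "card E = r"
  proof -
    have "inj_on (\<lambda>a. [:a:]) {0..<int r}" by (auto intro: inj_onI)
    then show ?thesis by (simp add: E_def card_image)
  qed
  have EB: "E \<subseteq> coeff_box (l - 1) {0..<int r}" 
    unfolding E_def using const_in_coeff_box[of l _ "{0..<int r}"] l(2) r0 by auto
  have sep: "e = e'" if "e \<in> E" "e' \<in> E" "e - e' \<in> I j" for j e e'
    using that eq_if_dvd_diff[of _ "int r"] by (auto simp: E_def I_def)
  have II: "poly_ideal (I j)" for j unfolding I_def by (rule divisor_ideal)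
  have rr: "int r dvd x" if "int r ^ 2 dvd x" for x
    using that by (metis dvd_trans dvd_triv_left power2_eq_square)
  have IP: "Phi l \<in> I j" if "j \<in> {1..<l}" for j using W[OF that] rr by (simp add: I_def)
  have Ir: "[:int r:] \<in> I j" for j by (simp add: I_def)
  have sub: "S \<subseteq> (\<Union>j\<in>{1..<l}. G j)"
  proof
    fix g assume "g \<in> S"
    then have g: "g \<in> coeff_box (l - 1) {0..<int Y}" "int r dvd cyclo_norm l (box_elt l M Y g)"
      using S by auto
    have "int r dvd (\<Prod>j=1..<l. poly (box_elt l M Y g) (W ^ j)) - cyclo_norm l (box_elt l M Y g)"
      by (rule cyclo_norm_cong[OF l(1)]) (use W[of 1] rr l1 in simp)
    from dvd_add[OF this g(2)] have "int r dvd (\<Prod>j=1..<l. poly (box_elt l M Y g) (W ^ j))" by simp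
    then obtain j where "j \<in> {1..<l}" "int r dvd poly (box_elt l M Y g) (W ^ j)"
      using prime_dvd_prod_iff[of "{1..<l}" "int r"] r(1) by auto
    then show "g \<in> (\<Union>j\<in>{1..<l}. G j)" using g(1) by (auto simp: G_def I_def)
  qed
  have "card S * r \<le> card {1..<l} * ((4 * 2 ^ (l + 2) * Y) ^ (l - 1) + r)"
  proof (rule card_UN_bound[OF _ sub])
    fix j assume j: "j \<in> {1..<l}"
    show "finite (G j)" unfolding G_def using card_coeff_box[of "{0..<int Y}" "l - 1"] by simp
    show "card (G j) * r \<le> (4 * 2 ^ (l + 2) * Y) ^ (l - 1) \<or> card (G j) \<le> 1"
      using ideal_count(1)[OF l(1) M Y II IP[OF j] Ir r(2) EB sep] r0 unfolding cE G_def by simp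
  qed simp
  then show "card S * r \<le> (l - 1) * ((4 * 2 ^ (l + 2) * Y) ^ (l - 1) + r)" by simp
  assume "S \<noteq> {}"
  then obtain j where j: "j \<in> {1..<l}" "G j \<noteq> {}" using sub by blast
  show "r \<le> (2 ^ (l + 2) * (3 * l * M * Y)) ^ (l - 1)"
    using ideal_count(2)[OF l(1) M Y II IP[OF j(1)] Ir r(2) EB sep] r0 j(2) unfolding cE G_def
      by simp
qed

text \<open>A box element is 1 plus a multiple of \<open>M\<close>, and so is each of its
  conjugates; a conjugate in a prime ideal above a divisor \<open>r\<close> of \<open>M\<close>
  would force 1 into that ideal.\<close>

lemma small_prime_not_dvd_cyclo_norm:
  assumes l: "prime l" and r: "prime r" "r dvd M"
  shows "\<not> int r dvd cyclo_norm l (box_elt l M Y g)"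
proof
  assume d: "int r dvd cyclo_norm l (box_elt l M Y g)"
  obtain P where P: "prime_poly_ideal P" "[:int r:] \<in> P" "Phi l \<in> P"
    using prime_poly_ideal_exists[OF l r(1)] by blast
  have PI: "poly_ideal P" using P by (simp add: prime_poly_ideal_def)
  obtain j where j: "pcompose (box_elt l M Y g) (X ^ j) \<in> P" using cyclo_norm_in_ideal[OF l P d]
    by blast
  obtain k where k: "int M = int r * k" using r(2) by (metis dvd_def int_dvd_int_iff)
  define q where "q = [:k:] * ([:int l * int Y:] + pcompose g (X ^ j))"
  have "pcompose (box_elt l M Y g) (X ^ j) = 1 + [:int r:] * q"
    by (simp add: box_elt_def q_def k pcompose_add pcompose_smult one_pCons smult_add_right
        mult.assoc mult.left_commute)
  then have "1 = pcompose (box_elt l M Y g) (X ^ j) - [:int r:] * q" by simp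
  also have "\<dots> \<in> P" by (intro poly_idealD(2)[OF PI] j poly_idealD(3)[OF PI] P(2))
  finally show False using P(1) by (simp add: prime_poly_ideal_def)
qed

subsection \<open>Primes congruent to 1 modulo l\<close>

text \<open>The primes \<open>r \<noteq> l\<close> that split completely in the \<open>l\<close>-th cyclotomic field.\<close>

definition split_primes :: "nat \<Rightarrow> nat \<Rightarrow> nat set" where
  "split_primes l n = {r. prime r \<and> r mod l = 1 \<and> r \<le> n}"

lemma finite_split_primes [simp]: "finite (split_primes l n)"
  by (rule finite_subset[of _ "{..n}"]) (auto simp: split_primes_def)

lemma ln2_ge_half: "1 / 2 \<le> ln (2 :: real)"
proof -
  have "ln (exp (1 / 2)) \<le> ln (2 :: real)" using exp_half_le2 by (intro ln_mono) auto
  then show ?thesis by simp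
qed

lemma ln_div_nat_nonneg [simp]: "0 \<le> ln (real n) / real n"
  by (cases "n = 0") auto

lemma sum_inverse_squares_le:
  assumes "0 < a" "a \<le> b"
  shows "(\<Sum>r\<in>{a<..b}. 1 / real r ^ 2) \<le> 1 / real a - 1 / real b"
  using assms(2)
proof (induction b rule: dec_induct)
  case (step b)
  have "{a<..Suc b} = insert (Suc b) {a<..b}" using step by auto
  then have "(\<Sum>r\<in>{a<..Suc b}. 1 / real r ^ 2) = 1 / real (Suc b) ^ 2
      + (\<Sum>r\<in>{a<..b}. 1 / real r ^ 2)" by simp
  also have "\<dots> \<le> 1 / real (Suc b) ^ 2 + (1 / real a - 1 / real b)" using step by simp
  also have "1 / real (Suc b) ^ 2 \<le> 1 / (real b * real (Suc b))"
    using step assms by (intro divide_left_mono)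
        (auto simp: power2_eq_square intro!: mult_right_mono)
  also have "1 / (real b * real (Suc b)) = 1 / real b - 1 / real (Suc b)"
    using step assms by (simp add: field_simps)
  finally show ?case by simp
qed simp

lemma squarefree_ln:
  fixes n :: nat
  assumes "n > 0" "\<And>r. prime r \<Longrightarrow> r dvd n \<Longrightarrow> \<not> r ^ 2 dvd n"
  shows "ln (real n) = (\<Sum>r\<in>prime_factors n. ln (real r))"
proof -
  have "multiplicity p n = 1" if p: "p \<in> prime_factors n" for p
  proof (rule multiplicity_eqI)
    show "p ^ 1 dvd n" using p by auto
    show "\<not> p ^ Suc 1 dvd n" using p assms(2)[of p] by (auto simp: power2_eq_square)
  qed
  then have "(\<Prod>p\<in>prime_factors n. p ^ multiplicity p n) = (\<Prod>p\<in>prime_factors n. p)" by simp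
  then have n: "n = (\<Prod>p\<in>prime_factors n. p)" using prod_prime_factors[of n] assms(1) by simp
  have "ln (real n) = ln (\<Prod>p\<in>prime_factors n. real p)" by (subst n) simp
  also have "\<dots> = (\<Sum>p\<in>prime_factors n. ln (real p))"
    by (rule ln_prod) (auto simp: in_prime_factors_iff prime_gt_0_nat)
  finally show ?thesis .
qed

text \<open>The bound is chosen such that at most an eighth of the box has a norm divisible by \<open>r\<^sup>2\<close>, or by
  a non-split \<open>r\<close>, for some larger prime \<open>r\<close> up to the square root of the largest possible index;
  the number of these \<open>r\<close> is negligible once \<open>Y\<close> is large.\<close>

definition small_prime_bound :: "nat \<Rightarrow> nat" where
    "small_prime_bound l = 8 * l ^ 2 * (4 * 2 ^ (l + 2)) ^ (l - 1)"
definition box_modulus :: "nat \<Rightarrow> nat" where "box_modulus l = fact (small_prime_bound l)"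
definition norm_scale :: "nat \<Rightarrow> nat" where "norm_scale l = 2 ^ (l + 2) * (3 * l * box_modulus l)"

text \<open>Count the pairs \<open>(g, r)\<close> with \<open>r\<close> dividing the norm of
  \<open>g\<close>, with weight \<open>ln r\<close>. Each \<open>g\<close> outside the exceptional
  set contributes at least \<open>(l - 1) ln Y\<close>, and each split \<open>r\<close> at most
  \<open>2 (l - 1) Z ln r / r\<close>, where \<open>Z = (norm_scale l * Y) ^ (l - 1)\<close>. At
  least half of the box is unexceptional, and the powers of \<open>Y\<close> cancel.\<close>

theorem sum_ln_good_primes_ge_aux:
  assumes l: "prime l" "l \<ge> 3" and Y: "Y \<ge> 8 * l ^ 2 * norm_scale l"
  shows "(\<Sum>r\<in>split_primes l ((norm_scale l * Y) ^ (l - 1)). ln (real r) / real r) \<ge> ln (real Y)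
      / (4 * real (norm_scale l) ^ (l - 1))"
proof -
  define D where "D = l - 1"
  define M where "M = box_modulus l"
  define c where "c = norm_scale l"
  define k where "k = (4 * 2 ^ (l + 2) :: nat)"
  define A where "A = (k * Y) ^ D"
  define Z where "Z = (c * Y) ^ D"
  \<comment> \<open>As \<open>l\<close> is odd, \<open>l - 1 = 2 e\<close> and \<open>Z\<close> is
    the square of \<open>R\<close>. So \<open>r ^ 2 \<le> Z\<close>, which holds whenever
    \<open>Bad r\<close> is nonempty, means \<open>r \<le> R\<close>.\<close>
  define e where "e = D div 2"
  define R where "R = (c * Y) ^ e"
  define Box where "Box = coeff_box D {0..<int Y}"
  define N where "N g = nat \<bar>cyclo_norm l (box_elt l M Y g)\<bar>" for g
  define Bad where "Bad r = {g \<in> Box. r dvd N g \<and> (r mod l \<noteq> 1 \<or> r ^ 2 dvd N g)}" for r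
  have D0: "D > 0" using l by (simp add: D_def)
  have "odd l" using prime_odd_nat[OF l(1)] l(2) by simp
  then have Dh: "D = 2 * e" using l by (auto simp: D_def e_def elim!: oddE)
  have e0: "e > 0" using D0 Dh by simp
  have M1: "M \<ge> 1" unfolding M_def box_modulus_def by (simp add: fact_ge_1)
  have c_eq: "c = 2 ^ (l + 2) * (3 * l * M)" by (simp add: c_def norm_scale_def M_def)
  have lM: "3 \<le> l * M" using l(2) M1 by (metis mult_le_mono mult.right_neutral)
  have c1: "k \<le> c"
  proof -
    have "2 ^ (l + 2) * 4 \<le> 2 ^ (l + 2) * (3 * (l * M))" using lM by (intro mult_le_mono2) simp
    then show ?thesis by (simp add: k_def c_eq mult.assoc)
  qed
  have norm_scale': "c \<ge> 1" by (rule le_trans[OF _ c1]) (simp add: k_def)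
  have Y8: "8 * l ^ 2 * c \<le> Y" using Y by (simp add: c_def)
  have Y1: "Y \<ge> 1"
  proof -
    have "1 \<le> 8 * l ^ 2 * c" using norm_scale' l by simp
    then show ?thesis using Y8 by (rule le_trans)
  qed
  have ZR: "Z = R ^ 2" by (simp add: Z_def R_def Dh power_mult[symmetric] mult.commute)
  have small_prime_bound_pos: "small_prime_bound l > 0" using l by (simp add: small_prime_bound_def)
  have ly: "l \<le> small_prime_bound l"
  proof -
    have "l * 1 \<le> (8 * l ^ 2) * (4 * 2 ^ (l + 2)) ^ (l - 1)"
      by (intro mult_le_mono) (simp_all add: power2_eq_square)
    then show ?thesis by (simp add: small_prime_bound_def)
  qed
  have finBox: "finite Box" and cBox: "card Box = Y ^ D"
    unfolding Box_def using card_coeff_box[of "{0..<int Y}" D] by auto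
  have Ndvd: "m dvd N g \<longleftrightarrow> int m dvd cyclo_norm l (box_elt l M Y g)" for m g
    unfolding N_def by (metis dvd_abs_iff int_dvd_int_iff int_nat_eq abs_ge_zero nat_0_le)
  have small: "\<not> r dvd N g" if "prime r" "r \<le> small_prime_bound l" for r g
    using small_prime_not_dvd_cyclo_norm[OF l(1), of r M Y g] that
      by (simp add: Ndvd M_def box_modulus_def prime_dvd_fact_iff)
  have large: "coprime r M" "r \<noteq> l" if "prime r" "r > small_prime_bound l" for r
  proof -
    have "\<not> r dvd M" using that by (simp add: M_def box_modulus_def prime_dvd_fact_iff)
    then show "coprime r M" by (rule prime_imp_coprime[OF that(1)])
    show "r \<noteq> l" using that ly by auto
  qed
  have bad: "card (Bad r) * r ^ 2 \<le> l ^ 2 * (A + r ^ 2) \<and> (Bad r \<noteq> {} \<longrightarrow> r \<le> R)"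
    if r: "prime r" "r > small_prime_bound l" for r
  proof -
    have "card (Bad r) * r ^ 2 \<le> l ^ 2 * (A + r ^ 2) \<and> (Bad r \<noteq> {} \<longrightarrow> r ^ 2 \<le> Z)"
    proof (cases "r mod l = 1")
      case True
      then have S: "Bad r \<subseteq> {g \<in> coeff_box (l
          - 1) {0..<int Y}. int r ^ 2 dvd cyclo_norm l (box_elt l M Y g)}"
        unfolding Bad_def Box_def D_def using Ndvd[of "r ^ 2"] by auto
      show ?thesis using square_count[OF l M1 Y1 r(1) large(1)[OF r] True S]
        unfolding A_def Z_def k_def c_eq D_def by (simp add: mult.assoc)
    next
      case False
      then have S: "Bad r \<subseteq> {g \<in> coeff_box (l
          - 1) {0..<int Y}. int r dvd cyclo_norm l (box_elt l M Y g)}"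
        unfolding Bad_def Box_def D_def using Ndvd[of r] by auto
      show ?thesis using bad_prime_count[OF l M1 Y1 r(1) large[OF r] False S]
        unfolding A_def Z_def k_def c_eq D_def by (simp add: mult.assoc)
    qed
    then show ?thesis unfolding ZR by (simp add: power2_nat_le_eq_le)
  qed
  define Ex where "Ex = (\<Union>r\<in>{r\<in>{small_prime_bound l<..R}. prime r}. Bad r)"
  have Ex_Box: "Ex \<subseteq> Box" by (auto simp: Ex_def Bad_def)
  have "real (card Ex) \<le> (\<Sum>r\<in>{r\<in>{small_prime_bound l<..R}. prime r}. real (card (Bad r)))"
  proof -
    have "card Ex \<le> (\<Sum>r\<in>{r\<in>{small_prime_bound l<..R}. prime r}. card (Bad r))" unfolding Ex_def
      by (rule card_UN_le) simp
    then have "real (card Ex) \<le> real (\<Sum>r\<in>{r\<in>{small_prime_bound l<..R}. prime r}. card (Bad r))"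
      by (simp only: of_nat_le_iff)
    then show ?thesis by simp
  qed
  also have "\<dots> \<le> (\<Sum>r\<in>{r\<in>{small_prime_bound l<..R}. prime r}. real l ^ 2 * real A
      * (1 / real r ^ 2) + real l ^ 2)"
  proof (rule sum_mono)
    fix r assume "r \<in> {r\<in>{small_prime_bound l<..R}. prime r}"
    then have r: "prime r" "r > small_prime_bound l" by auto
    then have r0: "real r > 0" by (simp add: prime_gt_0_nat)
    have "real (card (Bad r) * r ^ 2) \<le> real (l ^ 2 * (A + r ^ 2))" using bad[OF r]
      by (simp only: of_nat_le_iff)
    then have "real (card (Bad r)) * real r ^ 2 \<le> real l ^ 2 * real A + real l ^ 2 * real r ^ 2"
      by (simp add: distrib_left)
    then show "real (card (Bad r)) \<le> real l ^ 2 * real A * (1 / real r ^ 2) + real l ^ 2"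
      using r0 by (simp add: field_simps)
  qed
  also have "\<dots> \<le> (\<Sum>r\<in>{small_prime_bound l<..R}. real l ^ 2 * real A * (1 / real r ^ 2)
      + real l ^ 2)"
    by (rule sum_mono2) auto
  also have "\<dots> = real l ^ 2 * real A * (\<Sum>r\<in>{small_prime_bound l<..R}. 1 / real r ^ 2) + real l ^ 2
      * real (R - small_prime_bound l)"
    by (simp only: sum.distrib sum_distrib_left[symmetric]) simp
  also have "\<dots> \<le> real l ^ 2 * real A * (1 / real (small_prime_bound l)) + real l ^ 2 * real R"
  proof (intro add_mono mult_left_mono)
    show "(\<Sum>r\<in>{small_prime_bound l<..R}. 1 / real r ^ 2) \<le> 1 / real (small_prime_bound l)"
    proof (cases "small_prime_bound l \<le> R")
      case True
      have "(\<Sum>r\<in>{small_prime_bound l<..R}. 1 / real r ^ 2) \<le> 1 / real (small_prime_bound l) - 1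
          / real R"
        by (rule sum_inverse_squares_le[OF small_prime_bound_pos True])
      also have "\<dots> \<le> 1 / real (small_prime_bound l)" by simp
      finally show ?thesis .
    qed simp
  qed auto
  also have "real l ^ 2 * real A * (1 / real (small_prime_bound l)) = real Y ^ D / 8"
    using l unfolding A_def k_def small_prime_bound_def D_def
      by (simp add: power_mult_distrib field_simps)
  \<comment> \<open>The summand 1 in each count adds up to at most \<open>l ^ 2 * R\<close>, of
    order \<open>Y ^ e\<close> only, whereas the box has \<open>Y ^ (2 * e)\<close>
    elements.\<close>
  also have "real l ^ 2 * real R \<le> real Y ^ D / 8"
  proof -
    have "8 * l ^ 2 * c ^ e \<le> (8 * l ^ 2) ^ e * c ^ e"
    proof (rule mult_le_mono1, rule self_le_power)
      show "1 \<le> 8 * l ^ 2" using l by simp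
    qed (rule e0)
    also have "\<dots> = (8 * l ^ 2 * c) ^ e" by (simp add: power_mult_distrib)
    also have "\<dots> \<le> Y ^ e" using Y8 by (intro power_mono) auto
    finally have "8 * l ^ 2 * c ^ e * Y ^ e \<le> Y ^ e * Y ^ e" by (rule mult_le_mono1)
    then have "8 * (l ^ 2 * R) \<le> Y ^ D" by
        (simp add: R_def Dh power_mult_distrib power_add[symmetric] mult_2 mult.assoc)
    then have "real (8 * (l ^ 2 * R)) \<le> real (Y ^ D)" by (simp only: of_nat_le_iff)
    then show ?thesis by simp
  qed
  finally have cEx: "real (card Ex) \<le> real Y ^ D / 4" by simp
  define Nice where "Nice = Box - Ex"
  have cNice: "real (card Nice) \<ge> real Y ^ D / 2"
  proof -
    have "card Nice = card Box - card Ex" unfolding Nice_def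
      by (rule card_Diff_subset[OF finite_subset[OF Ex_Box finBox] Ex_Box])
    then have "real (card Nice) \<ge> real (card Box) - real (card Ex)" by linarith
    then show ?thesis using cEx unfolding cBox by simp
  qed
  define Pg where "Pg = {r \<in> split_primes l Z. r > small_prime_bound l}"
  have finPg: "finite Pg" by (simp add: Pg_def)
  have nice: "real D * ln (real Y) \<le> (\<Sum>r\<in>Pg. if r dvd N g then ln (real r) else 0)"
    if g: "g \<in> Nice" for g
  proof -
    have gB: "g \<in> Box" using g by (simp add: Nice_def)
    have gB': "g \<in> coeff_box (l - 1) {0..<int Y}" using gB by (simp add: Box_def D_def)
    have b1: "Y ^ D \<le> N g" and b2: "N g \<le> (3 * l * M * Y) ^ D"
      using cyclo_norm_box_elt_bounds[OF l(1) M1 Y1 gB'] unfolding N_def D_def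
      by (simp_all add: le_nat_iff nat_le_iff)
    have Npos: "N g > 0" using b1 Y1 by (metis less_le_trans zero_less_power less_le_trans
        zero_less_one)
    have NZ: "N g \<le> Z"
    proof -
      have "(3 * l * M * Y) ^ D \<le> Z" unfolding Z_def c_eq by (intro power_mono) auto
      then show ?thesis using b2 by simp
    qed
    have pf: "r \<in> Pg \<and> \<not> r ^ 2 dvd N g" if r: "prime r" "r dvd N g" for r
    proof -
      have ry: "r > small_prime_bound l" using small[OF r(1)] r(2) not_less by blast
      have "g \<notin> Bad r"
      proof
        assume gr: "g \<in> Bad r"
        then have "r \<le> R" using bad[OF r(1) ry] by blast
        then have "g \<in> Ex" using gr ry r(1) by (auto simp: Ex_def)
        then show False using g by (simp add: Nice_def)
      qed
      then have "r mod l = 1" "\<not> r ^ 2 dvd N g" using gB r(2) by (auto simp: Bad_def)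
      moreover have "r \<le> Z" using dvd_imp_le[OF r(2) Npos] NZ by simp
      ultimately show ?thesis using r ry by (auto simp: Pg_def split_primes_def)
    qed
    have "real D * ln (real Y) = ln (real Y ^ D)" using Y1 by (simp add: ln_realpow)
    also have "\<dots> \<le> ln (real (N g))"
    proof -
      have "real (Y ^ D) \<le> real (N g)" using b1 by (simp only: of_nat_le_iff)
      then show ?thesis using Y1 by (intro ln_mono) auto
    qed
    also have "\<dots> = (\<Sum>r\<in>prime_factors (N g). ln (real r))"
      using squarefree_ln[OF Npos] pf by blast
    also have "\<dots> \<le> (\<Sum>r\<in>{r\<in>Pg. r dvd N g}. ln (real r))"
      using pf finPg by (intro sum_mono2) (auto simp: Pg_def split_primes_def prime_ge_1_nat
          in_prime_factors_iff)
    also have "\<dots> = (\<Sum>r\<in>Pg. if r dvd N g then ln (real r) else 0)"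
      by (rule sum.inter_filter[OF finPg])
    finally show ?thesis .
  qed
  have "real Y ^ D / 2 * (real D * ln (real Y)) \<le> real (card Nice) * (real D * ln (real Y))"
    using cNice Y1 by (intro mult_right_mono) auto
  also have "\<dots> = (\<Sum>g\<in>Nice. real D * ln (real Y))" by simp
  also have "\<dots> \<le> (\<Sum>g\<in>Nice. \<Sum>r\<in>Pg. if r dvd N g then ln (real r) else 0)"
    by (rule sum_mono[OF nice])
  also have "\<dots> = (\<Sum>r\<in>Pg. \<Sum>g\<in>Nice. if r dvd N g then ln (real r) else 0)" by (rule sum.swap)
  also have "\<dots> = (\<Sum>r\<in>Pg. real (card {g \<in> Nice. r dvd N g}) * ln (real r))"
  proof (rule sum.cong[OF refl])
    fix r
    have "finite Nice" using finBox by (simp add: Nice_def)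
    then show "(\<Sum>g\<in>Nice. if r dvd N g then ln (real r) else 0) = real (card {g \<in> Nice. r dvd N g})
        * ln (real r)"
      by (subst sum.inter_filter[symmetric]) auto
  qed
  also have "\<dots> \<le> (\<Sum>r\<in>Pg. 2 * real D * real Z * (ln (real r) / real r))"
  proof (rule sum_mono)
    fix r assume "r \<in> Pg"
    then have r: "prime r" "r mod l = 1" "r \<le> Z" "r > small_prime_bound l"
      by (auto simp: Pg_def split_primes_def)
    have r0: "real r > 0" "ln (real r) \<ge> 0" using prime_ge_1_nat[OF r(1)] by auto
    have S: "{g \<in> Nice. r dvd N g} \<subseteq> {g \<in> coeff_box (l
        - 1) {0..<int Y}. int r dvd cyclo_norm l (box_elt l M Y g)}"
      using Ndvd[of r] by (auto simp: Nice_def Box_def D_def)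
    have "card {g \<in> Nice. r dvd N g} * r \<le> D * (A + r)"
      using good_prime_count(1)[OF l M1 Y1 r(1) large(1)[OF r(1,4)] r(2) S]
      unfolding A_def k_def D_def by (simp add: mult.assoc)
    \<comment> \<open>Since \<open>r \<le> Z\<close>, the error term \<open>r\<close> of the count
      is no larger than \<open>Z\<close> and costs only a factor 2.\<close>
    also have "A \<le> Z" unfolding A_def Z_def using c1 by (intro power_mono mult_le_mono1) auto
    then have "D * (A + r) \<le> D * (Z + Z)" using r(3) by (intro mult_le_mono2) simp
    finally have "real (card {g \<in> Nice. r dvd N g} * r) \<le> real (D * (Z + Z))"
      by (simp only: of_nat_le_iff)
    then have "real (card {g \<in> Nice. r dvd N g}) \<le> 2 * real D * real Z / real r"
      using r0 by (simp add: field_simps)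
    then have "real (card {g \<in> Nice. r dvd N g}) * ln (real r) \<le> 2 * real D * real Z / real r
        * ln (real r)"
      using r0(2) by (rule mult_right_mono)
    then show "real (card {g \<in> Nice. r dvd N g}) * ln (real r) \<le> 2 * real D * real Z
        * (ln (real r) / real r)"
      by simp
  qed
  also have "\<dots> = 2 * real D * real Z * (\<Sum>r\<in>Pg. ln (real r) / real r)"
    by (rule sum_distrib_left[symmetric])
  also have "\<dots> \<le> 2 * real D * real Z * (\<Sum>r\<in>split_primes l Z. ln (real r) / real r)"
    by (intro mult_left_mono sum_mono2 ln_div_nat_nonneg) (auto simp: Pg_def)
  finally have fin: "real Y ^ D / 2 * (real D * ln (real Y)) \<le> 2 * real D * real Z
      * (\<Sum>r\<in>split_primes l Z. ln (real r) / real r)" .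
  have "real D * real Y ^ D > 0" using D0 Y1 by simp
  moreover have "(real D * real Y ^ D) * ln (real Y) \<le> (real D * real Y ^ D)
      * (4 * real c ^ D * (\<Sum>r\<in>split_primes l Z. ln (real r) / real r))"
    using fin by (simp add: Z_def power_mult_distrib algebra_simps)
  ultimately have "ln (real Y) \<le> 4 * real c ^ D * (\<Sum>r\<in>split_primes l Z. ln (real r) / real r)"
    by (simp only: mult_le_cancel_left_pos)
  then show ?thesis using norm_scale' unfolding Z_def c_def D_def
    by (simp add: divide_le_eq mult.commute)
qed

text \<open>One number serves both as the threshold for \<open>x\<close> and as the reciprocal of
  the slope in the lower bound below.\<close>

definition mertens_const :: "nat \<Rightarrow> nat" where "mertens_const l = 64 * l ^ 3 * norm_scale l ^ l"

theorem sum_ln_good_primes_ge: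
  assumes l: "prime l" "l \<ge> 3" and x: "x \<ge> mertens_const l"
  shows "(\<Sum>r\<in>split_primes l (2 ^ x). ln (real r) / real r) \<ge> real x / real (mertens_const l)"
proof -
  define D where "D = l - 1"
  define c where "c = norm_scale l"
  \<comment> \<open>With \<open>Y = 2 ^ u\<close> and \<open>norm_scale l \<le> 2 ^ u\<close> the
    range \<open>(norm_scale l * Y) ^ (l - 1)\<close> is at most
    \<open>2 ^ (2 * u * (l - 1)) \<le> 2 ^ x\<close>.\<close>
  define u where "u = x div (2 * D)"
  have D: "D > 0" "2 * D \<le> 2 * l" using l by (auto simp: D_def)
  have c1: "c \<ge> 1" by (simp add: c_def norm_scale_def box_modulus_def) (use l in simp)
  have cl: "c \<le> c ^ l" using c1 l by (simp add: self_le_power)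
  have A: "mertens_const l = 64 * l ^ 3 * c ^ l" by (simp add: mertens_const_def c_def)
  have u8: "8 * l ^ 2 * c \<le> u"
  proof -
    have "8 * l ^ 2 * c * (2 * D) \<le> 8 * l ^ 2 * c * (2 * l)" by (rule mult_le_mono2[OF D(2)])
    also have "\<dots> = 16 * l ^ 3 * c" by (simp add: power3_eq_cube power2_eq_square)
    also have "\<dots> \<le> 64 * l ^ 3 * c ^ l" using cl by (intro mult_le_mono) auto
    also have "\<dots> \<le> x" using x by (simp add: A)
    finally show ?thesis using D by (simp add: u_def less_eq_div_iff_mult_less_eq)
  qed
  have cu: "c \<le> u"
  proof -
    have "1 * c \<le> 8 * l ^ 2 * c" using l by (intro mult_le_mono1) simp
    then have "c \<le> 8 * l ^ 2 * c" by (simp only: mult_1)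
    then show ?thesis using u8 by (rule le_trans)
  qed
  have Y: "8 * l ^ 2 * norm_scale l \<le> 2 ^ u" 
    using le_trans[OF u8 less_imp_le[OF less_exp]] by (simp only: c_def)
  have le: "(norm_scale l * 2 ^ u) ^ (l - 1) \<le> 2 ^ x"
  proof -
    have "c * 2 ^ u \<le> 2 ^ u * 2 ^ u"
      by (rule mult_le_mono1[OF le_trans[OF cu less_imp_le[OF less_exp]]])
    also have "\<dots> = (2::nat) ^ (2 * u)" by (simp add: power_add[symmetric] mult_2)
    finally have "(c * 2 ^ u) ^ D \<le> (2 ^ (2 * u)) ^ D" by (intro power_mono) auto
    also have "\<dots> = 2 ^ (u * (2 * D))" by (simp add: power_mult[symmetric] mult_ac)
    also have "\<dots> \<le> 2 ^ x" by (intro power_increasing) (auto simp: u_def)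
    finally show ?thesis by (simp add: c_def D_def)
  qed
  have "x < (u + 1) * (2 * D)" using D unfolding u_def
    by (metis Suc_eq_plus1 dividend_less_div_times mult_Suc add.commute mult_pos_pos
        zero_less_numeral)
  also have "\<dots> \<le> (u + u) * (2 * D)" using cu c1 by (intro mult_le_mono1) simp
  also have "\<dots> \<le> (u + u) * (2 * l)" by (rule mult_le_mono2[OF D(2)])
  finally have xu: "real x \<le> 4 * real l * real u" 
    by (metis (no_types, lifting) less_imp_le mult.assoc mult.commute mult_2 of_nat_le_iff
        of_nat_mult of_nat_numeral numeral_Bit0_eq_double)
  have "real x / real (mertens_const l) \<le> (4 * real l * real u) / (64 * real l * real c ^ l)"
  proof -
    have "64 * real l * real c ^ l \<le> real (mertens_const l)"
    proof -
      have "64 * l * c ^ l \<le> 64 * l ^ 3 * c ^ l" 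
        using l by (intro mult_le_mono1 mult_le_mono2 self_le_power) auto
      then have "real (64 * l * c ^ l) \<le> real (64 * l ^ 3 * c ^ l)" by (simp only: of_nat_le_iff)
      then show ?thesis by (simp add: A)
    qed
    then show ?thesis using xu l c1 by (intro frac_le) auto
  qed
  also have "\<dots> = (real u / 2) / (8 * real c ^ l)" using l c1 by (simp add: field_simps)
  also have "\<dots> \<le> (real u / 2) / (4 * real c ^ D)"
  proof -
    have "real c ^ D \<le> real c ^ l" using c1 by (intro power_increasing) (auto simp: D_def)
    moreover have "real c ^ D > 0" "real c ^ l > 0" using c1 by auto
    ultimately have "4 * real c ^ D \<le> 8 * real c ^ l" "real c ^ D > 0" "real c ^ l > 0" by linarith+
    then show ?thesis by (intro divide_left_mono mult_pos_pos) simp_all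
  qed
  also have "\<dots> \<le> (real u * ln 2) / (4 * real c ^ D)"
    using mult_left_mono[OF ln2_ge_half, of "real u"] by (intro divide_right_mono) auto
  also have "real u * ln 2 = ln (real (2 ^ u))" by (simp add: ln_realpow)
  also have "ln (real (2 ^ u)) / (4 * real c ^ D)
      \<le> (\<Sum>r\<in>split_primes l ((norm_scale l * 2 ^ u) ^ (l - 1)). ln (real r) / real r)"
    using sum_ln_good_primes_ge_aux[OF l Y] by (simp add: c_def D_def)
  also have "\<dots> \<le> (\<Sum>r\<in>split_primes l (2 ^ x). ln (real r) / real r)"
    using le by (intro sum_mono2 ln_div_nat_nonneg) (auto simp: split_primes_def)
  finally show ?thesis .
qed

subsection \<open>Brun's sieve\<close>

text \<open>The elementary symmetric functions: the terms of order \<open>j\<close> in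
  inclusion-exclusion, used for indicators, for densities and for numbers of residue
  classes.\<close>

definition esym :: "nat \<Rightarrow> 'a set \<Rightarrow> ('a \<Rightarrow> real) \<Rightarrow> real" where
  "esym j D y = (\<Sum>E | E \<subseteq> D \<and> card E = j. \<Prod>r\<in>E. y r)"

lemma esym_0: "finite D \<Longrightarrow> esym 0 D y = 1"
proof -
  assume "finite D"
  then have "{E. E \<subseteq> D \<and> card E = 0} = {{}}" by (auto dest: finite_subset)
  then show ?thesis by (simp add: esym_def)
qed

lemma esym_Suc_empty: "esym (Suc j) {} y = 0"
proof -
  have "{E. E \<subseteq> ({}::'a set) \<and> card E = Suc j} = {}" by auto
  then show ?thesis unfolding esym_def by (simp only: sum.empty)
qed

lemma esym_insert:
  assumes "finite D" "a \<notin> D"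
  shows "esym (Suc j) (insert a D) y = esym (Suc j) D y + y a * esym j D y"
proof -
  let ?A = "{E. E \<subseteq> D \<and> card E = Suc j}" and ?B = "{E. E \<subseteq> D \<and> card E = j}"
  have fin: "finite ?A" "finite ?B" using assms(1) by auto
  have eq: "{E. E \<subseteq> insert a D \<and> card E = Suc j} = ?A \<union> insert a ` ?B"
  proof (intro equalityI subsetI)
    fix E assume E: "E \<in> {E. E \<subseteq> insert a D \<and> card E = Suc j}"
    then have "E \<subseteq> insert a D" by blast
    then have finE: "finite E" by (rule finite_subset) (simp add: assms(1))
    show "E \<in> ?A \<union> insert a ` ?B"
    proof (cases "a \<in> E")
      case True
      then have "E - {a} \<in> ?B" using E finE by auto
      moreover have "E = insert a (E - {a})" using True by auto
      ultimately show ?thesis by (intro UnI2 image_eqI)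
    qed (use E in auto)
  next
    fix E assume "E \<in> ?A \<union> insert a ` ?B"
    then show "E \<in> {E. E \<subseteq> insert a D \<and> card E = Suc j}"
    proof
      assume "E \<in> insert a ` ?B"
      then obtain F where F: "E = insert a F" "F \<subseteq> D" "card F = j" by auto
      then have "finite F" "a \<notin> F" using assms by (auto dest: finite_subset)
      then show ?thesis using F by auto
    qed auto
  qed
  have inj: "inj_on (insert a) ?B"
  proof (rule inj_onI)
    fix E F assume "E \<in> ?B" "F \<in> ?B" "insert a E = insert a F"
    then show "E = F" using assms(2) by (metis Diff_insert_absorb mem_Collect_eq subsetD)
  qed
  have "esym (Suc j) (insert a D) y = (\<Sum>E\<in>?A. \<Prod>r\<in>E. y r) + (\<Sum>E\<in>insert a ` ?B. \<Prod>r\<in>E. y r)"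
    unfolding esym_def eq using fin assms(2) by (intro sum.union_disjoint) auto
  also have "(\<Sum>E\<in>insert a ` ?B. \<Prod>r\<in>E. y r) = (\<Sum>E\<in>?B. y a * (\<Prod>r\<in>E. y r))"
    unfolding sum.reindex[OF inj] o_def
  proof (intro sum.cong refl)
    fix E assume "E \<in> ?B"
    then have "finite E" "a \<notin> E" using assms by (auto dest: finite_subset)
    then show "prod y (insert a E) = y a * prod y E" by simp
  qed
  finally show ?thesis by (simp add: esym_def sum_distrib_left)
qed

lemma power_Suc_add_ge:
  fixes S y :: real
  assumes "0 \<le> S" "0 \<le> y"
  shows "S ^ Suc j + real (Suc j) * y * S ^ j \<le> (S + y) ^ Suc j"
proof (induction j)
  case (Suc j)
  have "S ^ Suc (Suc j) + real (Suc (Suc j)) * y * S ^ Suc j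
        \<le> S ^ Suc (Suc j) + real (Suc (Suc j)) * y * S ^ Suc j + real (Suc j) * y ^ 2 * S ^ j"
    using assms by simp
  also have "\<dots> = (S + y) * (S ^ Suc j + real (Suc j) * y * S ^ j)"
    by (simp add: algebra_simps power2_eq_square)
  also have "\<dots> \<le> (S + y) * (S + y) ^ Suc j" using Suc assms by (intro mult_left_mono) auto
  finally show ?case by simp
qed simp

text \<open>In the \<open>j\<close>-th power of the sum each subset of size \<open>j\<close> arises
  \<open>fact j\<close> times. The induction needs only the first two terms of the binomial
  expansion, \<open>power_Suc_add_ge\<close>.\<close>

lemma esym_le:
  assumes "finite D" "\<And>r. r \<in> D \<Longrightarrow> 0 \<le> y r"
  shows "esym j D y \<le> (\<Sum>r\<in>D. y r) ^ j / fact j"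
  using assms
proof (induction D arbitrary: j rule: finite_induct)
  case empty
  then show ?case by (cases j) (auto simp: esym_0 esym_Suc_empty)
next
  case (insert a D)
  let ?S = "\<Sum>r\<in>D. y r"
  have S: "0 \<le> ?S" using insert by (intro sum_nonneg) auto
  show ?case
  proof (cases j)
    case 0
    then show ?thesis using insert by (simp add: esym_0)
  next
    case (Suc i)
    have "esym j (insert a D) y = esym (Suc i) D y + y a * esym i D y"
      using insert Suc by (simp add: esym_insert)
    also have "\<dots> \<le> ?S ^ Suc i / fact (Suc i) + y a * (?S ^ i / fact i)"
      using insert by (intro add_mono mult_left_mono insert.IH) auto
    also have "\<dots> = (?S ^ Suc i + real (Suc i) * y a * ?S ^ i) / fact (Suc i)"
      by (simp add: field_simps del: of_nat_Suc)
    also have "\<dots> \<le> (?S + y a) ^ Suc i / fact (Suc i)"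
      using insert S by (intro divide_right_mono power_Suc_add_ge) auto
    finally show ?thesis using insert Suc by (simp add: add.commute)
  qed
qed

lemma bonferroni:
  assumes "finite D" "\<And>r. r \<in> D \<Longrightarrow> 0 \<le> y r \<and> y r \<le> 1"
  shows "0 \<le> (-1) ^ k * ((\<Sum>j\<le>k. (-1) ^ j * esym j D y) - (\<Prod>r\<in>D. 1 - y r)) \<and>
     (-1) ^ k * ((\<Sum>j\<le>k. (-1) ^ j * esym j D y) - (\<Prod>r\<in>D. 1 - y r)) \<le> esym (Suc k) D y"
  using assms
proof (induction D arbitrary: k rule: finite_induct)
  case empty
  have "(\<Sum>j\<le>k. (-1) ^ j * esym j {} y) = 1"
    by (induction k) (auto simp: esym_0 esym_Suc_empty)
  then show ?case by (simp add: esym_Suc_empty)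
next
  case (insert a D)
  define P where "P = (\<Prod>r\<in>D. 1 - y r)"
  define B where "B k = (\<Sum>j\<le>k. (-1) ^ j * esym j D y)" for k
  have P01: "0 \<le> P" "P \<le> 1" unfolding P_def using insert.prems
    by (auto intro!: prod_nonneg prod_le_1)
  have ya: "0 \<le> y a" "y a \<le> 1" using insert.prems by auto
  have IH: "0 \<le> (-1) ^ k * (B k - P)" "(-1) ^ k * (B k - P) \<le> esym (Suc k) D y" for k
    using insert.IH[of k] insert.prems unfolding B_def P_def by auto
  have Pa: "(\<Prod>r\<in>insert a D. 1 - y r) = (1 - y a) * P" using insert by (simp add: P_def)
  show ?case
  proof (cases k)
    case 0
    have "B 0 = 1" using insert by (simp add: B_def esym_0)
    then have "1 - P \<le> esym 1 D y" using IH[of 0] by simp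
    moreover have "y a * P \<le> y a" using P01 ya by (simp add: mult_left_le)
    moreover have "0 \<le> y a * P" using P01 ya by simp
    moreover have "esym (Suc 0) (insert a D) y = esym 1 D y + y a"
      using insert.hyps by (simp add: esym_insert esym_0)
    moreover have "(\<Sum>j\<le>k. (-1) ^ j * esym j (insert a D) y) = 1"
      using 0 insert.hyps by (simp add: esym_0)
    ultimately show ?thesis unfolding Pa 0 using P01 by (simp add: left_diff_distrib)
  next
    case (Suc i)
    have "(\<Sum>j\<le>k. (-1) ^ j * esym j (insert a D) y) = B k - y a * B i"
    proof -
      have "(\<Sum>j\<le>k. (-1) ^ j * esym j (insert a D) y) =
        esym 0 (insert a D) y + (\<Sum>j\<le>i. (-1) ^ Suc j * esym (Suc j) (insert a D) y)"
        unfolding Suc by (subst sum.atMost_Suc_shift) simp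
      also have "(\<Sum>j\<le>i. (-1) ^ Suc j * esym (Suc j) (insert a D) y) =
         (\<Sum>j\<le>i. (-1) ^ Suc j * esym (Suc j) D y) + (\<Sum>j\<le>i. - (y a * ((-1) ^ j * esym j D y)))"
        using insert by (simp add: esym_insert sum.distrib[symmetric] algebra_simps)
      also have "esym 0 (insert a D) y = esym 0 D y" using insert by (simp add: esym_0)
      also have "esym 0 D y + ((\<Sum>j\<le>i. (-1) ^ Suc j * esym (Suc j) D y)
          + (\<Sum>j\<le>i. - (y a * ((-1) ^ j * esym j D y))))
         = (esym 0 D y + (\<Sum>j\<le>i. (-1) ^ Suc j * esym (Suc j) D y)) - y a * B i"
        by (simp add: B_def sum_distrib_left sum_negf)
      also have "esym 0 D y + (\<Sum>j\<le>i. (-1) ^ Suc j * esym (Suc j) D y) = B k"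
        unfolding B_def Suc by (subst sum.atMost_Suc_shift) simp
      finally show ?thesis .
    qed
    then have "(-1) ^ k * ((\<Sum>j\<le>k. (-1) ^ j * esym j (insert a D) y) - (\<Prod>r\<in>insert a D. 1 - y r))
       = (-1) ^ k * ((B k - y a * B i) - (1 - y a) * P)" by (simp only: Pa)
    also have "\<dots> = (-1) ^ k * (B k - P) + y a * ((-1) ^ i * (B i - P))"
      unfolding Suc by (simp add: algebra_simps)
    finally have "(-1) ^ k * ((\<Sum>j\<le>k. (-1) ^ j * esym j (insert a D) y) - (\<Prod>r\<in>insert a D. 1 - y r))
       = (-1) ^ k * (B k - P) + y a * ((-1) ^ i * (B i - P))" .
    moreover have "y a * ((-1) ^ i * (B i - P)) \<le> y a * esym (Suc i) D y"
        "0 \<le> y a * ((-1) ^ i * (B i - P))"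
      using IH[of i] ya by (auto intro: mult_left_mono)
    ultimately show ?thesis using IH[of k] insert Suc by (simp add: esym_insert)
  qed
qed

section \<open>Residue classes in an interval and the sieve inequality\<close>

lemma card_residue_less:
  assumes "a < M"
  shows "card {m::nat. m < n \<and> m mod M = a} = (n + (M - 1 - a)) div M"
proof (induction n)
  case 0
  then show ?case using assms by simp
next
  case (Suc n)
  have "{m. m < Suc n \<and> m mod M = a} = (if n mod M
      = a then insert n {m. m < n \<and> m mod M = a} else {m. m < n \<and> m mod M = a})"
    by (auto simp: less_Suc_eq)
  then have c: "card {m. m < Suc n \<and> m mod M = a} = (n + (M - 1 - a)) div M
      + (if n mod M = a then 1 else 0)"
    using Suc by (auto simp: card_insert_if)
  have "Suc (n + (M - 1 - a)) mod M = 0 \<longleftrightarrow> n mod M = a"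
  proof -
    have "Suc (n + (M - 1 - a)) + a = n + M" using assms by simp
    then have "[Suc (n + (M - 1 - a)) + a = n] (mod M)" by (simp add: cong_def)
    then have "[Suc (n + (M - 1 - a)) = 0] (mod M) \<longleftrightarrow> [0 + a = n] (mod M)"
      by (metis cong_add_rcancel_nat cong_sym cong_trans)
    then show ?thesis using assms by (auto simp: cong_def)
  qed
  then show ?case unfolding c by (simp add: div_Suc)
qed

lemma card_residue_interval:
  assumes "a < M"
  shows "\<bar>real (card {m::nat. x \<le> m \<and> m < x + N \<and> m mod M = a}) - real N / real M\<bar> \<le> 1"
proof -
  have M: "M > 0" using assms by simp
  let ?c = "M - 1 - a"
  let ?A = "{m. m < x \<and> m mod M = a}" and ?B = "{m. x \<le> m \<and> m < x + N \<and> m mod M = a}"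
  have "{m. m < x + N \<and> m mod M = a} = ?A \<union> ?B" by auto
  moreover have "card (?A \<union> ?B) = card ?A + card ?B" by (intro card_Un_disjoint) auto
  ultimately have "card {m. m < x + N \<and> m mod M = a} = card ?A + card ?B" by simp
  then have eq: "real (card {m. x \<le> m \<and> m < x + N \<and> m mod M = a}) = real ((x + N + ?c) div M)
      - real ((x + ?c) div M)"
    using card_residue_less[OF assms] by simp
  have b: "real (k div M) \<le> real k / real M" "real k / real M \<le> real (k div M) + 1" for k
  proof -
    have "real k = real (k div M) * real M + real (k mod M)"
      by (metis div_mult_mod_eq of_nat_add of_nat_mult)
    moreover have "real (k mod M) < real M" using M by simp
    ultimately show "real (k div M) \<le> real k / real M" "real k / real M \<le> real (k div M) + 1"
      using M by (simp_all add: field_simps)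
  qed
  have "real (x + N + ?c) / real M = real (x + ?c) / real M + real N / real M"
    by (simp add: add_divide_distrib)
  then show ?thesis unfolding eq using b[of "x + N + ?c"] b[of "x + ?c"] by linarith
qed

text \<open>The class \<open>a\<close> modulo \<open>M\<close> is carried along for the induction:
  for each \<open>w\<close> in \<open>Om p\<close> the Chinese remainder theorem merges it with the
  class of \<open>w\<close> modulo \<open>p\<close> into one class modulo \<open>M * p\<close>. Each
  choice of classes costs an error of at most 1, hence the product on the right.\<close>

lemma card_residues_interval:
  fixes Om :: "nat \<Rightarrow> nat set"
  assumes "finite E" "\<And>r. r \<in> E \<Longrightarrow> prime r" "\<And>r. r \<in> E \<Longrightarrow> Om r \<subseteq> {..<r}"
    "a < M" "\<And>r. r \<in> E \<Longrightarrow> coprime M r"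
  shows "\<bar>real (card {m. x \<le> m \<and> m < x + N \<and> m mod M = a \<and> (\<forall>r\<in>E. m mod r \<in> Om r)}) -
      real N / real M * (\<Prod>r\<in>E. real (card (Om r)) / real r)\<bar> \<le> (\<Prod>r\<in>E. real (card (Om r)))"
  using assms
proof (induction E arbitrary: a M rule: finite_induct)
  case empty
  then show ?case using card_residue_interval[of a M x N] by simp
next
  case (insert p E)
  let ?S = "\<lambda>a M. {m. x \<le> m \<and> m < x + N \<and> m mod M = a \<and> (\<forall>r\<in>E. m mod r \<in> Om r)}"
  let ?P = "\<Prod>r\<in>E. real (card (Om r)) / real r" and ?Q = "\<Prod>r\<in>E. real (card (Om r))"
  have p: "prime p" "p > 0" "Om p \<subseteq> {..<p}" "coprime M p" using insert.prems
    by (auto simp: prime_gt_0_nat)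
  have M: "M > 0" using insert.prems by simp
  have finO: "finite (Om p)" using p(3) finite_subset by blast
  have "\<exists>b. b < M * p \<and> b mod M = a \<and> b mod p = w" if "w \<in> Om p" for w
    using binary_chinese_remainder_unique_nat[OF p(4), of a w] M p(2,3) that insert.prems(3)
    unfolding cong_def by (metis lessThan_iff mod_less not_less_zero subsetD)
  then obtain b where b: "\<And>w. w \<in> Om p \<Longrightarrow> b w < M * p \<and> b w mod M = a \<and> b w mod p = w" by metis
  have eq: "{m. x \<le> m \<and> m < x + N \<and> m mod M = a \<and> (\<forall>r\<in>insert p E. m mod r \<in> Om r)}
      = (\<Union>w\<in>Om p. ?S (b w) (M * p))"
  proof -
    have key: "m mod (M * p) = b w \<longleftrightarrow> m mod M = a \<and> m mod p = w" if "w \<in> Om p" for m w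
    proof
      assume "m mod (M * p) = b w"
      then show "m mod M = a \<and> m mod p = w" using b[OF that]
        by (metis mod_mod_cancel dvd_triv_left dvd_triv_right)
    next
      assume "m mod M = a \<and> m mod p = w"
      then have "[m = b w] (mod M)" "[m = b w] (mod p)" using b[OF that] by (auto simp: cong_def)
      then have "[m = b w] (mod M * p)" using p(4) by (intro coprime_cong_mult_nat)
      then show "m mod (M * p) = b w" using b[OF that] by (simp add: cong_def)
    qed
    show ?thesis
    proof (rule Set.set_eqI)
      fix m
      have "m \<in> {m. x \<le> m \<and> m < x + N \<and> m mod M = a \<and> (\<forall>r\<in>insert p E. m mod r \<in> Om r)} \<longleftrightarrow>
        (\<exists>w\<in>Om p. x \<le> m \<and> m < x + N \<and> (m mod M = a \<and> m mod p = w) \<and> (\<forall>r\<in>E. m mod r \<in> Om r))"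
        by blast
      also have "\<dots> \<longleftrightarrow> (\<exists>w\<in>Om p. x \<le> m \<and> m < x + N \<and> m mod (M * p) = b w \<and> (\<forall>r\<in>E. m mod r \<in> Om r))"
        by (intro bex_cong refl) (simp only: key)
      also have "\<dots> \<longleftrightarrow> m \<in> (\<Union>w\<in>Om p. ?S (b w) (M * p))" by (simp only: UN_iff mem_Collect_eq)
      finally show "m \<in> {m. x \<le> m \<and> m < x + N \<and> m mod M = a \<and> (\<forall>r\<in>insert p E. m mod r \<in> Om r)} \<longleftrightarrow>
        m \<in> (\<Union>w\<in>Om p. ?S (b w) (M * p))" .
    qed
  qed
  have "card (\<Union>w\<in>Om p. ?S (b w) (M * p)) = (\<Sum>w\<in>Om p. card (?S (b w) (M * p)))"
  proof (rule card_UN_disjoint[OF finO])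
    show "\<forall>i\<in>Om p. \<forall>j\<in>Om p. i \<noteq> j \<longrightarrow> ?S (b i) (M * p) \<inter> ?S (b j) (M * p) = {}"
    proof (intro ballI impI)
      fix i j assume ij: "i \<in> Om p" "j \<in> Om p" "i \<noteq> j"
      then have "b i \<noteq> b j" using b[OF ij(1)] b[OF ij(2)] by metis
      then show "?S (b i) (M * p) \<inter> ?S (b j) (M * p) = {}" by auto
    qed
    show "\<forall>i\<in>Om p. finite (?S (b i) (M * p))"
    proof
      fix i
      show "finite (?S (b i) (M * p))" by (rule finite_subset[of _ "{..<x + N}"]) auto
    qed
  qed
  then have "real (card (\<Union>w\<in>Om p. ?S (b w) (M * p))) = (\<Sum>w\<in>Om p. real (card (?S (b w) (M * p))))"
    by simp
  moreover have "\<bar>(\<Sum>w\<in>Om p. real (card (?S (b w) (M * p))))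
      - (\<Sum>w\<in>Om p. real N / real (M * p) * ?P)\<bar> \<le> (\<Sum>w\<in>Om p. ?Q)"
  proof -
    have "\<bar>(\<Sum>w\<in>Om p. real (card (?S (b w) (M * p)))) - (\<Sum>w\<in>Om p. real N / real (M * p) * ?P)\<bar>
       \<le> (\<Sum>w\<in>Om p. \<bar>real (card (?S (b w) (M * p))) - real N / real (M * p) * ?P\<bar>)"
      unfolding sum_subtractf[symmetric] by (rule sum_abs)
    also have "\<dots> \<le> (\<Sum>w\<in>Om p. ?Q)"
    proof (rule sum_mono, rule insert.IH)
      fix w r assume "w \<in> Om p" "r \<in> E"
      then have "coprime M r" "coprime p r" using insert.prems insert.hyps
        by (auto intro: primes_coprime)
      then show "coprime (M * p) r" by simp
    qed (use insert.prems b in auto)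
    finally show ?thesis .
  qed
  moreover have "(\<Sum>w\<in>Om p. real N / real (M * p) * ?P) = real N / real M
      * (\<Prod>r\<in>insert p E. real (card (Om r)) / real r)"
    using insert by (simp add: field_simps)
  moreover have "(\<Sum>w\<in>Om p. ?Q) = (\<Prod>r\<in>insert p E. real (card (Om r)))" using insert by simp
  ultimately show ?case unfolding eq by simp
qed

text \<open>Inclusion-exclusion truncated at an even level is an upper bound.
  \<open>bonferroni\<close> is used twice: pointwise, for the indicators, and for the densities, to
  return from the truncated main terms to the full product at the cost of one term of order
  \<open>Suc k\<close>.\<close>

theorem brun_sieve:
  fixes Om :: "nat \<Rightarrow> nat set"
  assumes D: "finite D" "\<And>r. r \<in> D \<Longrightarrow> prime r" "\<And>r. r \<in> D \<Longrightarrow> Om r \<subseteq> {..<r}" and k: "even k"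
  shows "real (card {m. x \<le> m \<and> m < x + N \<and> (\<forall>r\<in>D. m mod r \<notin> Om r)})
     \<le> real N * (\<Prod>r\<in>D. 1 - real (card (Om r)) / real r)
       + real N * esym (Suc k) D (\<lambda>r. real (card (Om r)) / real r)
       + (\<Sum>j\<le>k. esym j D (\<lambda>r. real (card (Om r))))"
proof -
  let ?I = "{x..<x + N}"
  define y where "y m r = (if m mod r \<in> Om r then 1 else 0 :: real)" for m r
  define \<rho> where "\<rho> r = real (card (Om r)) / real r" for r
  define c where "c E = card {m. x \<le> m \<and> m < x + N \<and> m mod 1 = 0 \<and> (\<forall>r\<in>E. m mod r \<in> Om r)}" for E
  have \<rho>: "0 \<le> \<rho> r \<and> \<rho> r \<le> 1" if "r \<in> D" for r
  proof -
    have "card (Om r) \<le> r" using card_mono[OF _ D(3)[OF that]] by simp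
    then show ?thesis using D(2)[OF that] by (simp add: \<rho>_def divide_le_eq_1 prime_gt_0_nat)
  qed
  have cE: "\<bar>real (c E) - real N * (\<Prod>r\<in>E. \<rho> r)\<bar> \<le> (\<Prod>r\<in>E. real (card (Om r)))" if "E \<subseteq> D" for E
    using card_residues_interval[of E Om 0 1 x N] that D unfolding c_def \<rho>_def
    by (auto dest: finite_subset)
  have "real (card {m. x \<le> m \<and> m < x + N \<and> (\<forall>r\<in>D. m mod r \<notin> Om r)}) = (\<Sum>m\<in>?I. \<Prod>r\<in>D. 1 - y m r)"
  proof -
    have "(\<Prod>r\<in>D. 1 - y m r) = (if \<forall>r\<in>D. m mod r \<notin> Om r then 1 else 0)" for m
      using D(1) by (auto simp: y_def intro!: prod.neutral)
    then have "(\<Sum>m\<in>?I. \<Prod>r\<in>D. 1 - y m r) = (\<Sum>m\<in>?I. if \<forall>r\<in>D. m mod r \<notin> Om r then 1 else 0)" by simp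
    also have "\<dots> = real (card {m\<in>?I. \<forall>r\<in>D. m mod r \<notin> Om r})"
      by (subst sum.inter_filter[symmetric]) auto
    also have "{m\<in>?I. \<forall>r\<in>D. m mod r \<notin> Om r} = {m. x \<le> m \<and> m < x + N \<and> (\<forall>r\<in>D. m mod r \<notin> Om r)}"
      by auto
    finally show ?thesis by simp
  qed
  also have "\<dots> \<le> (\<Sum>m\<in>?I. \<Sum>j\<le>k. (-1) ^ j * esym j D (y m))"
  proof (rule sum_mono)
    fix m
    show "(\<Prod>r\<in>D. 1 - y m r) \<le> (\<Sum>j\<le>k. (-1) ^ j * esym j D (y m))"
      using bonferroni[of D "y m" k] D(1) k by (auto simp: y_def)
  qed
  also have "\<dots> = (\<Sum>j\<le>k. (-1) ^ j * (\<Sum>m\<in>?I. esym j D (y m)))"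
    by (subst sum.swap) (simp add: sum_distrib_left)
  also have "\<dots> = (\<Sum>j\<le>k. (-1) ^ j * (\<Sum>E | E \<subseteq> D \<and> card E = j. real (c E)))"
  proof (intro sum.cong refl arg_cong2[where f = "(*)"])
    fix j
    have "(\<Sum>m\<in>?I. esym j D (y m)) = (\<Sum>E | E \<subseteq> D \<and> card E = j. \<Sum>m\<in>?I. \<Prod>r\<in>E. y m r)"
      unfolding esym_def by (rule sum.swap)
    also have "\<dots> = (\<Sum>E | E \<subseteq> D \<and> card E = j. real (c E))"
    proof (intro sum.cong refl)
      fix E assume "E \<in> {E. E \<subseteq> D \<and> card E = j}"
      then have "finite E" using D(1) by (auto dest: finite_subset)
      then have "(\<Prod>r\<in>E. y m r) = (if \<forall>r\<in>E. m mod r \<in> Om r then 1 else 0)" for m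
        by (auto simp: y_def intro!: prod.neutral)
      then have "(\<Sum>m\<in>?I. \<Prod>r\<in>E. y m r) = (\<Sum>m\<in>?I. if \<forall>r\<in>E. m mod r \<in> Om r then 1 else 0)" by simp
      also have "\<dots> = real (card {m\<in>?I. \<forall>r\<in>E. m mod r \<in> Om r})"
        by (subst sum.inter_filter[symmetric]) auto
      also have "{m\<in>?I. \<forall>r\<in>E. m mod r \<in> Om r}
          = {m. x \<le> m \<and> m < x + N \<and> m mod 1 = 0 \<and> (\<forall>r\<in>E. m mod r \<in> Om r)}" by auto
      finally show "(\<Sum>m\<in>?I. \<Prod>r\<in>E. y m r) = real (c E)" by (simp add: c_def)
    qed
    finally show "(\<Sum>m\<in>?I. esym j D (y m)) = (\<Sum>E | E \<subseteq> D \<and> card E = j. real (c E))" .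
  qed
  also have "\<dots> \<le> (\<Sum>j\<le>k. (-1) ^ j * (real N * esym j D \<rho>) + esym j D (\<lambda>r. real (card (Om r))))"
  proof (rule sum_mono)
    fix j
    have "\<bar>(\<Sum>E | E \<subseteq> D \<and> card E = j. real (c E)) - (\<Sum>E | E \<subseteq> D \<and> card E = j. real N * (\<Prod>r\<in>E. \<rho> r))\<bar>
      \<le> (\<Sum>E | E \<subseteq> D \<and> card E = j. \<bar>real (c E) - real N * (\<Prod>r\<in>E. \<rho> r)\<bar>)"
      unfolding sum_subtractf[symmetric] by (rule sum_abs)
    also have "\<dots> \<le> esym j D (\<lambda>r. real (card (Om r)))"
      unfolding esym_def by (intro sum_mono cE) auto
    finally have "\<bar>(\<Sum>E | E \<subseteq> D \<and> card E = j. real (c E)) - real N * esym j D \<rho>\<bar>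
        \<le> esym j D (\<lambda>r. real (card (Om r)))"
      by (simp add: esym_def sum_distrib_left)
    then show "(-1) ^ j * (\<Sum>E | E \<subseteq> D \<and> card E = j. real (c E))
       \<le> (-1) ^ j * (real N * esym j D \<rho>) + esym j D (\<lambda>r. real (card (Om r)))"
      by (cases "even j") (simp_all add: abs_le_iff)
  qed
  also have "\<dots> = real N * (\<Sum>j\<le>k. (-1) ^ j * esym j D \<rho>) + (\<Sum>j\<le>k. esym j D (\<lambda>r. real (card (Om r))))"
    by (simp add: sum.distrib sum_distrib_left algebra_simps)
  also have "\<dots> \<le> real N * ((\<Prod>r\<in>D. 1 - \<rho> r) + esym (Suc k) D \<rho>)
      + (\<Sum>j\<le>k. esym j D (\<lambda>r. real (card (Om r))))"
    using bonferroni[of D \<rho> k] D(1) \<rho> k by (intro add_mono mult_left_mono) auto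
  finally show ?thesis by (simp add: \<rho>_def[abs_def] distrib_left)
qed

text \<open>Bounds the accumulated rounding errors of the sieve: the terms are dominated by those of
  the binomial expansion.\<close>

lemma sum_esym_le:
  assumes "finite D" "\<And>r. r \<in> D \<Longrightarrow> 0 \<le> y r"
  shows "(\<Sum>j\<le>k. esym j D y) \<le> (1 + (\<Sum>r\<in>D. y r)) ^ k"
proof -
  let ?S = "\<Sum>r\<in>D. y r"
  have S: "0 \<le> ?S" using assms by (intro sum_nonneg) auto
  have "(\<Sum>j\<le>k. esym j D y) \<le> (\<Sum>j\<le>k. real (k choose j) * ?S ^ j)"
  proof (rule sum_mono)
    fix j assume j: "j \<in> {..k}"
    have "esym j D y \<le> ?S ^ j / fact j" by (rule esym_le[OF assms])
    also have "\<dots> \<le> ?S ^ j / 1" using S by (intro divide_left_mono) (auto simp: fact_ge_1)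
    also have "\<dots> = 1 * ?S ^ j" by simp
    also have "1 * ?S ^ j \<le> real (k choose j) * ?S ^ j"
    proof -
      have "1 \<le> k choose j" using zero_less_binomial[of j k] j by (simp add: Suc_le_eq)
    then have "1 \<le> real (k choose j)" by (metis of_nat_1 of_nat_le_iff)
    then show ?thesis using S by (intro mult_right_mono) auto
    qed
    finally show "esym j D y \<le> real (k choose j) * ?S ^ j" .
  qed
  also have "\<dots> = (?S + 1) ^ k" by (simp add: binomial_ring)
  finally show ?thesis by (simp add: add.commute)
qed

section \<open>Elementary estimates for sums and products over primes\<close>

definition primes_upto :: "nat \<Rightarrow> nat set" where
  "primes_upto n = {p. prime p \<and> p \<le> n}"

lemma finite_primes_upto [simp]: "finite (primes_upto n)"
  by (rule finite_subset[of _ "{..n}"]) (auto simp: primes_upto_def)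

lemma primes_uptoD: "p \<in> primes_upto n \<Longrightarrow> prime p" "p \<in> primes_upto n \<Longrightarrow> p \<le> n"
  "p \<in> primes_upto n \<Longrightarrow> p \<ge> 2" "p \<in> primes_upto n \<Longrightarrow> 0 < p"
  by (auto simp: primes_upto_def prime_ge_2_nat prime_gt_0_nat)

lemma prime_power_dvd_fact: "p > 0 \<Longrightarrow> p ^ k dvd fact (k * p)" for p :: nat
proof (induction k)
  case (Suc k)
  have e: "fact (Suc k * p) = (Suc k * p) * fact (Suc k * p - 1)"
    using fact_reduce[of "Suc k * p", where 'a = nat] Suc.prems by simp
  have "fact (k * p) dvd (fact (Suc k * p - 1) :: nat)" using Suc.prems by (intro fact_dvd) simp
  then have "p * p ^ k dvd (Suc k * p) * fact (Suc k * p - 1)"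
    using Suc by (intro mult_dvd_mono) (auto intro: dvd_trans)
  then show ?case unfolding e by simp
qed simp

lemma prod_primes_dvd_fact:
  assumes "finite A" "\<And>p. p \<in> A \<Longrightarrow> prime p"
  shows "(\<Prod>p\<in>A. p ^ (n div p)) dvd (fact n :: nat)"
  using assms
proof (induction A rule: finite_induct)
  case (insert p A)
  have p: "prime p" using insert by simp
  have "p ^ (n div p) dvd fact ((n div p) * p)"
    by (rule prime_power_dvd_fact[OF prime_gt_0_nat[OF p]])
  also have "\<dots> dvd fact n" by (rule fact_dvd) simp
  finally have "p ^ (n div p) dvd (fact n :: nat)" .
  moreover have "coprime (p ^ (n div p)) (\<Prod>q\<in>A. q ^ (n div q))"
  proof (rule prod_coprime_right)
    fix q assume "q \<in> A"
    then have "prime q" "p \<noteq> q" using insert by auto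
    then have "coprime p q" using p primes_coprime by blast
    then show "coprime (p ^ (n div p)) (q ^ (n div q))"
      by (simp add: coprime_power_left_iff coprime_power_right_iff)
  qed
  ultimately have "p ^ (n div p) * (\<Prod>q\<in>A. q ^ (n div q)) dvd fact n"
    using insert by (intro divides_mult) auto
  then show ?case using insert by simp
qed simp

text \<open>The product of the \<open>p ^ (n div p)\<close> divides \<open>fact n\<close>, which is
  at most \<open>n ^ n\<close>. The factor 2 comes from \<open>n div p \<ge> n / (2 * p)\<close> for
  \<open>p \<le> n\<close>.\<close>

lemma sum_ln_primes_le:
  assumes "n \<ge> 1"
  shows "(\<Sum>p\<in>primes_upto n. ln (real p) / real p) \<le> 2 * ln (real n)"
proof -
  have "(\<Prod>p\<in>primes_upto n. p ^ (n div p)) \<le> (fact n :: nat)"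
    by (intro dvd_imp_le prod_primes_dvd_fact) (auto simp: primes_upto_def fact_gt_zero)
  also have "\<dots> \<le> n ^ n" using fact_le_power[of n, where 'a = nat] by simp
  finally have "real (\<Prod>p\<in>primes_upto n. p ^ (n div p)) \<le> real (n ^ n)" by (simp only: of_nat_le_iff)
  moreover have pos: "real (\<Prod>p\<in>primes_upto n. p ^ (n div p)) > 0"
    using primes_uptoD(4) by (simp add: prod_pos)
  ultimately have "ln (real (\<Prod>p\<in>primes_upto n. p ^ (n div p))) \<le> ln (real (n ^ n))"
    by (intro ln_mono) auto
  also have "\<dots> = real n * ln (real n)" using assms by (simp add: ln_realpow)
  also have "ln (real (\<Prod>p\<in>primes_upto n. p ^ (n div p)))
      = (\<Sum>p\<in>primes_upto n. ln (real p ^ (n div p)))"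
    unfolding of_nat_prod of_nat_power using primes_uptoD(4) by (auto intro!: ln_prod)
  also have "\<dots> = (\<Sum>p\<in>primes_upto n. real (n div p) * ln (real p))"
    by (simp add: ln_realpow)
  finally have 1: "(\<Sum>p\<in>primes_upto n. real (n div p) * ln (real p)) \<le> real n * ln (real n)" .
  have "(\<Sum>p\<in>primes_upto n. real n / 2 * (ln (real p) / real p))
      \<le> (\<Sum>p\<in>primes_upto n. real (n div p) * ln (real p))"
  proof (rule sum_mono)
    fix p assume p: "p \<in> primes_upto n"
    have "real n \<le> 2 * (real (n div p) * real p)"
    proof -
      have "n = (n div p) * p + n mod p" by simp
      moreover have "n mod p < p" using primes_uptoD(4)[OF p] by simp
      moreover have "1 * p \<le> (n div p) * p"
        using primes_uptoD(2,4)[OF p] by (intro mult_le_mono1)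
            (simp add: Suc_le_eq div_greater_zero_iff)
      ultimately have "n \<le> 2 * ((n div p) * p)" by linarith
      then have "real n \<le> real (2 * ((n div p) * p))" by (simp only: of_nat_le_iff)
      then show ?thesis by simp
    qed
    then have "real n / 2 / real p \<le> real (n div p)" using primes_uptoD(4)[OF p]
      by (simp add: field_simps)
    then have "real n / 2 / real p * ln (real p) \<le> real (n div p) * ln (real p)"
      using primes_uptoD(3)[OF p] by (intro mult_right_mono) auto
    then show "real n / 2 * (ln (real p) / real p) \<le> real (n div p) * ln (real p)" by simp
  qed
  then have "real n / 2 * (\<Sum>p\<in>primes_upto n. ln (real p) / real p) \<le> real n * ln (real n)"
    using 1 by (simp add: sum_distrib_left)
  then have "real n * (\<Sum>p\<in>primes_upto n. ln (real p) / real p) \<le> real n * (2 * ln (real n))" by simp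
  then show ?thesis using assms by (simp only: mult_le_cancel_left_pos of_nat_0_less_iff)
qed

text \<open>Each step squares the range. The new primes have \<open>ln p \<ge> 2 ^ J * ln 2\<close>,
  while the sum of \<open>ln p / p\<close> is at most \<open>2 ^ (J + 2) * ln 2\<close>, so a step
  adds at most 4.\<close>

lemma sum_inverse_primes_le: "(\<Sum>p\<in>primes_upto (2 ^ 2 ^ J). 1 / real p) \<le> 4 * real J + 1"
proof (induction J)
  case 0
  have "primes_upto 2 \<subseteq> {2}" by (auto simp: primes_upto_def dest: prime_ge_2_nat)
  then have "(\<Sum>p\<in>primes_upto 2. 1 / real p) \<le> (\<Sum>p\<in>{2}. 1 / real p)" by (intro sum_mono2) auto
  then show ?case by simp
next
  case (Suc J)
  let ?a = "2 ^ 2 ^ J :: nat" and ?b = "2 ^ 2 ^ Suc J :: nat"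
  have ab: "?a \<le> ?b" by (intro power_increasing) auto
  have un: "primes_upto ?b = primes_upto ?a \<union> (primes_upto ?b - primes_upto ?a)"
    using order_trans[OF _ ab] unfolding primes_upto_def by blast
  have L: "(2::real) ^ J * ln 2 > 0" by simp
  have "(\<Sum>p\<in>primes_upto ?b - primes_upto ?a. 1 / real p) \<le>
     (\<Sum>p\<in>primes_upto ?b - primes_upto ?a. (ln (real p) / real p) / (2 ^ J * ln 2))"
  proof (rule sum_mono)
    fix p assume "p \<in> primes_upto ?b - primes_upto ?a"
    then have p: "?a < p" "prime p" by (auto simp: primes_upto_def)
    then have "real ?a \<le> real p" by (simp only: of_nat_le_iff)
    then have "ln (real ?a) \<le> ln (real p)" by (intro ln_mono) auto
    then have "2 ^ J * ln 2 \<le> ln (real p)" by (simp add: ln_realpow)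
    then show "1 / real p \<le> (ln (real p) / real p) / (2 ^ J * ln 2)"
      using L prime_gt_0_nat[OF p(2)] by (simp add: field_simps)
  qed
  also have "\<dots> = (\<Sum>p\<in>primes_upto ?b - primes_upto ?a. ln (real p) / real p) / (2 ^ J * ln 2)"
    by (simp only: sum_divide_distrib)
  also have "\<dots> \<le> (\<Sum>p\<in>primes_upto ?b. ln (real p) / real p) / (2 ^ J * ln 2)"
    using L primes_uptoD(3)[of _ ?b] by (intro divide_right_mono sum_mono2)
        (auto dest!: primes_uptoD(4))
  also have "\<dots> \<le> (2 * ln (real ?b)) / (2 ^ J * ln 2)"
    using L by (intro divide_right_mono sum_ln_primes_le) auto
  also have "\<dots> = 4" by (simp add: ln_realpow)
  finally have "(\<Sum>p\<in>primes_upto ?b - primes_upto ?a. 1 / real p) \<le> 4" .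
  then show ?case using Suc by (subst un, subst sum.union_disjoint) auto
qed

lemma geometric_sum_le:
  fixes x :: real
  assumes "0 \<le> x" "x < 1"
  shows "(\<Sum>k\<le>K. x ^ k) \<le> 1 / (1 - x)"
proof -
  have "(1 - x) * (\<Sum>k\<le>K. x ^ k) = 1 - x ^ Suc K"
    using sum_gp_basic[of x K] by simp
  also have "\<dots> \<le> 1" using assms by simp
  finally show ?thesis using assms by (simp add: field_simps)
qed

text \<open>Induction on the set of primes: \<open>f\<close> splits \<open>m\<close> into the
  exponent of \<open>p\<close> and a cofactor prime to \<open>p\<close>, which embeds
  \<open>T\<close> into a product set. The sum over that set is a geometric sum times the sum for
  the smaller set of primes.\<close>

lemma euler_product_ge:
  assumes "finite A" "\<And>p. p \<in> A \<Longrightarrow> prime p" "finite T"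
    "\<And>m. m \<in> T \<Longrightarrow> 0 < m" "\<And>m p. m \<in> T \<Longrightarrow> prime p \<Longrightarrow> p dvd m \<Longrightarrow> p \<in> A"
  shows "(\<Sum>m\<in>T. 1 / real m) \<le> (\<Prod>p\<in>A. 1 / (1 - 1 / real p))"
  using assms
proof (induction A arbitrary: T rule: finite_induct)
  case empty
  have "T \<subseteq> {1}"
  proof
    fix m assume "m \<in> T"
    then show "m \<in> {1}" using empty.prems(4)[of m] prime_factor_nat[of m] by auto
  qed
  then have "(\<Sum>m\<in>T. 1 / real m) \<le> (\<Sum>m\<in>{1::nat}. 1 / real m)" by (intro sum_mono2) auto
  then show ?case by simp
next
  case (insert p A)
  have p: "prime p" using insert.prems by simp
  have p2: "real p \<ge> 2" using prime_ge_2_nat[OF p] by simp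
  define f where "f m = (multiplicity p m, m div p ^ multiplicity p m)" for m
  define T' where "T' = snd ` f ` T"
  define K where "K = Max (insert 0 (fst ` f ` T))"
  have dec: "m = p ^ fst (f m) * snd (f m)" for m
    by (simp add: f_def multiplicity_dvd)
  have ndvd: "\<not> p dvd snd (f m)" if "m \<in> T" for m
  proof -
    have "m \<noteq> 0" using insert.prems(3)[OF that] by simp
    then have "\<not> p dvd m div p ^ multiplicity p m"
      using multiplicity_decompose[of m p] prime_gt_1_nat[OF p] by simp
    then show ?thesis by (simp add: f_def)
  qed
  have inj: "inj_on f T"
    by (rule inj_onI) (metis dec)
  have sub: "f ` T \<subseteq> {..K} \<times> T'"
  proof
    fix z assume z: "z \<in> f ` T"
    have "fst z \<le> K" unfolding K_def using z insert.prems(2) by (intro Max_ge) auto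
    moreover have "snd z \<in> T'" using z by (auto simp: T'_def)
    ultimately show "z \<in> {..K} \<times> T'" by (cases z) auto
  qed
  have IH: "(\<Sum>m\<in>T'. 1 / real m) \<le> (\<Prod>p\<in>A. 1 / (1 - 1 / real p))"
  proof (rule insert.IH)
    show "finite T'" using insert.prems(2) by (simp add: T'_def)
    fix m' assume "m' \<in> T'"
    then obtain m where m: "m \<in> T" "m' = snd (f m)" by (auto simp: T'_def)
    have "m > 0" using insert.prems(3)[OF m(1)] .
    then show "0 < m'" using dec[of m] m(2) by (metis gr0I mult_0_right)
    fix q assume q: "prime q" "q dvd m'"
    then have "q dvd m" using dec[of m] m(2) by (metis dvd_mult)
    then have "q \<in> insert p A" using insert.prems(4)[OF m(1) q(1)] by simp
    moreover have "q \<noteq> p" using ndvd[OF m(1)] q(2) m(2) by auto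
    ultimately show "q \<in> A" by simp
  qed (use insert.prems in auto)
  have "(\<Sum>m\<in>T. 1 / real m) = (\<Sum>m\<in>T. (\<lambda>(k, m'). (1 / real p) ^ k * (1 / real m')) (f m))"
  proof (rule sum.cong[OF refl])
    fix m
    have "real m = real p ^ fst (f m) * real (snd (f m))" by (metis dec of_nat_mult of_nat_power)
    then show "1 / real m = (\<lambda>(k, m'). (1 / real p) ^ k * (1 / real m')) (f m)"
      by (simp add: case_prod_beta power_one_over)
  qed
  also have "\<dots> = (\<Sum>z\<in>f ` T. (\<lambda>(k, m'). (1 / real p) ^ k * (1 / real m')) z)"
    by (simp only: sum.reindex[OF inj] o_def)
  also have "\<dots> \<le> (\<Sum>z\<in>{..K} \<times> T'. (\<lambda>(k, m'). (1 / real p) ^ k * (1 / real m')) z)"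
    using sub insert.prems(2) by (intro sum_mono2) (auto simp: T'_def)
  also have "\<dots> = (\<Sum>k\<le>K. (1 / real p) ^ k) * (\<Sum>m'\<in>T'. 1 / real m')"
    by (simp only: sum.cartesian_product[symmetric] sum_product)
  also have "\<dots> \<le> (1 / (1 - 1 / real p)) * (\<Prod>p\<in>A. 1 / (1 - 1 / real p))"
    using IH p2 by (intro mult_mono geometric_sum_le sum_nonneg) auto
  finally show ?case using insert by simp
qed

lemma ln_le_harmonic: "ln (real (Suc n)) \<le> (\<Sum>m\<in>{1..n}. 1 / real m)"
proof (induction n)
  case (Suc n)
  have "ln (real (Suc (Suc n))) - ln (real (Suc n)) = ln (1 + 1 / real (Suc n))"
  proof -
    have "real (Suc (Suc n)) = real (Suc n) * (1 + 1 / real (Suc n))" by (simp add: field_simps)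
    then have "ln (real (Suc (Suc n))) = ln (real (Suc n) * (1 + 1 / real (Suc n)))"
      by (rule arg_cong)
    also have "\<dots> = ln (real (Suc n)) + ln (1 + 1 / real (Suc n))"
      by (intro ln_mult_pos) (auto simp: add_pos_nonneg)
    finally show ?thesis by simp
  qed
  also have "\<dots> \<le> 1 / real (Suc n)" by (rule ln_add_one_self_le_self) simp
  finally show ?case using Suc by simp
qed simp

text \<open>One direction of Mertens' product theorem, with constant 1: every
  \<open>m \<le> n\<close> has only prime factors up to \<open>n\<close>, so the Euler product
  dominates the harmonic sum.\<close>

lemma prod_primes_le:
  assumes "n \<ge> 2"
  shows "(\<Prod>p\<in>primes_upto n. 1 - 1 / real p) \<le> 1 / ln (real n)"
proof -
  have pos: "(\<Prod>p\<in>primes_upto n. 1 - 1 / real p) > 0"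
    by (intro prod_pos) (auto dest!: primes_uptoD(3))
  have "ln (real n) \<le> ln (real (Suc n))" using assms by simp
  also have "\<dots> \<le> (\<Sum>m\<in>{1..n}. 1 / real m)" by (rule ln_le_harmonic)
  also have "\<dots> \<le> (\<Prod>p\<in>primes_upto n. 1 / (1 - 1 / real p))"
    by (rule euler_product_ge) (auto simp: primes_upto_def dest: dvd_imp_le)
  also have "\<dots> = 1 / (\<Prod>p\<in>primes_upto n. 1 - 1 / real p)" by (simp add: prod_dividef)
  finally show ?thesis using pos assms by (simp add: field_simps)
qed

section \<open>Reciprocals of the split primes\<close>

lemma mertens_const_ge_1: "l \<ge> 3 \<Longrightarrow> mertens_const l \<ge> 1"
  by (simp add: mertens_const_def norm_scale_def box_modulus_def)

lemma split_primes_subset_primes_upto: "split_primes l n \<subseteq> primes_upto n"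
  by (auto simp: split_primes_def primes_upto_def)

lemma split_primes_mono: "m \<le> n \<Longrightarrow> split_primes l m \<subseteq> split_primes l n"
  by (auto simp: split_primes_def)

text \<open>Write \<open>A = mertens_const l\<close>. The sum of \<open>ln r / r\<close> is at least
  \<open>4 y\<close> for the split primes up to \<open>2 ^ (4 A y)\<close>, and at most
  \<open>2 y\<close> even for all primes up to \<open>2 ^ y\<close>. The remaining
  \<open>2 y\<close> comes from primes with \<open>ln r \<le> 4 A y\<close>.\<close>

lemma sum_inverse_good_block:
  assumes l: "prime l" "l \<ge> 3" and y: "y \<ge> 1"
  shows "1 / (2 * real (mertens_const l))
      \<le> (\<Sum>r\<in>split_primes l (2 ^ (4 * mertens_const l * y)) - split_primes l (2 ^ y). 1 / real r)"
proof -
  let ?A = "mertens_const l"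
  let ?big = "split_primes l (2 ^ (4 * ?A * y))" and ?small = "split_primes l (2 ^ y)"
  have A: "?A \<ge> 1" using mertens_const_ge_1[OF l(2)] .
  have small_prime_bound: "real y > 0" "real ?A > 0" using y A by auto
  have ln2: "ln (2::real) \<le> 1" using ln_add_one_self_le_self[of 1] by simp
  have "?A * 1 \<le> ?A * (4 * y)" using y by (intro mult_le_mono2) simp
  then have "?A \<le> 4 * ?A * y" by (simp add: mult_ac)
  from sum_ln_good_primes_ge[OF l this]
  have big: "4 * real y \<le> (\<Sum>r\<in>?big. ln (real r) / real r)" using small_prime_bound
    by (simp add: field_simps)
  have "(\<Sum>r\<in>?small. ln (real r) / real r) \<le> (\<Sum>r\<in>primes_upto (2 ^ y). ln (real r) / real r)"
    using split_primes_subset_primes_upto by (intro sum_mono2 ln_div_nat_nonneg) auto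
  also have "\<dots> \<le> 2 * ln (real (2 ^ y))" by (rule sum_ln_primes_le) simp
  also have "\<dots> = 2 * (real y * ln 2)" by (simp add: ln_realpow)
  also have "\<dots> \<le> 2 * (real y * 1)" using ln2 by (intro mult_left_mono) auto
  finally have small: "(\<Sum>r\<in>?small. ln (real r) / real r) \<le> 2 * real y" by simp
  have "?big \<subseteq> ?small \<union> (?big - ?small)" by auto
  then have "(\<Sum>r\<in>?big. ln (real r) / real r) \<le> (\<Sum>r\<in>?small \<union> (?big - ?small). ln (real r) / real r)"
    by (intro sum_mono2 ln_div_nat_nonneg) auto
  also have "\<dots> = (\<Sum>r\<in>?small. ln (real r) / real r) + (\<Sum>r\<in>?big - ?small. ln (real r) / real r)"
    by (intro sum.union_disjoint) auto
  finally have d: "2 * real y \<le> (\<Sum>r\<in>?big - ?small. ln (real r) / real r)" using big small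
    by linarith
  have "(\<Sum>r\<in>?big - ?small. ln (real r) / real r)
      \<le> (\<Sum>r\<in>?big - ?small. 4 * real ?A * real y * (1 / real r))"
  proof (rule sum_mono)
    fix r assume "r \<in> ?big - ?small"
    then have r: "prime r" "r \<le> 2 ^ (4 * ?A * y)" by (auto simp: split_primes_def)
    have r0: "real r > 0" using prime_gt_0_nat[OF r(1)] by simp
    have "real r \<le> real (2 ^ (4 * ?A * y))" using r(2) by (simp only: of_nat_le_iff)
    then have "ln (real r) \<le> ln (real (2 ^ (4 * ?A * y)))" using r0 by (intro ln_mono) auto
    also have "\<dots> = 4 * real ?A * real y * ln 2" by (simp add: ln_realpow)
    also have "\<dots> \<le> 4 * real ?A * real y * 1" using ln2 by (intro mult_left_mono) auto
    finally show "ln (real r) / real r \<le> 4 * real ?A * real y * (1 / real r)"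
      using r0 by (simp add: divide_right_mono)
  qed
  also have "\<dots> = 4 * real ?A * real y * (\<Sum>r\<in>?big - ?small. 1 / real r)"
    by (rule sum_distrib_left[symmetric])
  finally have "2 * real y \<le> 4 * real ?A * real y * (\<Sum>r\<in>?big - ?small. 1 / real r)" using d
    by linarith
  then have "(2 * real y) * 1 \<le> (2 * real y) * (2 * real ?A * (\<Sum>r\<in>?big - ?small. 1 / real r))"
    by (simp add: mult_ac)
  then have "1 \<le> 2 * real ?A * (\<Sum>r\<in>?big - ?small. 1 / real r)" using small_prime_bound
    by (simp only: mult_le_cancel_left_pos)
  then show ?thesis using small_prime_bound by (simp add: field_simps)
qed

text \<open>\<open>J\<close> measures \<open>log log x\<close> to base 2, so that this sum grows
  linearly in \<open>J\<close>.\<close>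

definition split_recip :: "nat \<Rightarrow> nat \<Rightarrow> real" where
  "split_recip l J = (\<Sum>r\<in>split_primes l (2 ^ 2 ^ J). 1 / real r)"

lemma split_recip_mono: "I \<le> J \<Longrightarrow> split_recip l I \<le> split_recip l J"
  unfolding split_recip_def by (intro sum_mono2 split_primes_mono power_increasing) auto

text \<open>With \<open>A = mertens_const l\<close>, one block multiplies the exponent
  \<open>y\<close> by \<open>4 * A \<le> 2 ^ (A + 2)\<close>, so it fits into \<open>A + 2\<close>
  steps of \<open>J\<close>.\<close>

lemma split_recip_multiple_ge:
  assumes l: "prime l" "l \<ge> 3"
  shows "real m / (2 * real (mertens_const l)) \<le> split_recip l (m * (mertens_const l + 2))"
proof (induction m)
  case 0
  show ?case by (simp add: split_recip_def sum_nonneg)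
next
  case (Suc m)
  let ?B = "mertens_const l + 2"
  define y where "y = (2::nat) ^ (m * ?B)"
  have "4 * mertens_const l \<le> 2 ^ ?B" using less_imp_le[OF less_exp[of "mertens_const l"]]
    by (simp add: power_add)
  then have "4 * mertens_const l * y \<le> 2 ^ ?B * y" by (rule mult_le_mono1)
  also have "\<dots> = 2 ^ (Suc m * ?B)" by (simp add: y_def power_add)
  finally have "split_primes l (2 ^ (4 * mertens_const l * y))
      \<subseteq> split_primes l (2 ^ 2 ^ (Suc m * ?B))"
    by (intro split_primes_mono power_increasing) auto
  then have sub: "split_primes l (2 ^ y)
      \<union> (split_primes l (2 ^ (4 * mertens_const l * y)) - split_primes l (2 ^ y)) \<subseteq> split_primes l
      (2 ^ 2 ^ (Suc m * ?B))"
    using split_primes_mono[of "2 ^ y" "2 ^ (4 * mertens_const l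
        * y)" l] mertens_const_ge_1[OF l(2)] by (auto dest!: subsetD)
  have "real (Suc m) / (2 * real (mertens_const l)) = real m / (2 * real (mertens_const l)) + 1
      / (2 * real (mertens_const l))"
    by (simp add: add_divide_distrib)
  also have "\<dots> \<le> split_recip l (m * ?B)
      + (\<Sum>r\<in>split_primes l (2 ^ (4 * mertens_const l * y)) - split_primes l (2 ^ y). 1 / real r)"
    using Suc sum_inverse_good_block[OF l, of y] by (intro add_mono) (auto simp: y_def)
  also have "\<dots> = (\<Sum>r\<in>split_primes l (2 ^ y)
      \<union> (split_primes l (2 ^ (4 * mertens_const l * y)) - split_primes l (2 ^ y)). 1 / real r)"
    unfolding split_recip_def y_def by (intro sum.union_disjoint[symmetric]) auto
  also have "\<dots> \<le> split_recip l (Suc m * ?B)"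
    unfolding split_recip_def by (intro sum_mono2 sub) auto
  finally show ?case .
qed

text \<open>The gain \<open>1 / (2 A)\<close> for every \<open>A + 2\<close> steps of
  \<open>J\<close>, with \<open>A = mertens_const l\<close>. The second residue class saves a factor
  \<open>exp (- sieve_exponent l * J)\<close> up to a constant.\<close>

definition sieve_exponent :: "nat \<Rightarrow> real" where
  "sieve_exponent l = 1 / (2 * real (mertens_const l) * real (mertens_const l + 2))"

lemma sieve_exponent_bounds: "l \<ge> 3 \<Longrightarrow> 0 < sieve_exponent l \<and> sieve_exponent l \<le> 1 / 2"
proof -
  assume "l \<ge> 3"
  then have A: "real (mertens_const l) \<ge> 1" using mertens_const_ge_1 by simp
  then have "1 * 1 \<le> real (mertens_const l) * real (mertens_const l + 2)" by (intro mult_mono) auto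
  then show ?thesis using A by (auto simp: sieve_exponent_def field_simps)
qed

lemma split_recip_ge:
  assumes l: "prime l" "l \<ge> 3"
  shows "sieve_exponent l * real J - 1 \<le> split_recip l J"
proof -
  let ?B = "mertens_const l + 2"
  have A: "real (mertens_const l) \<ge> 1" using mertens_const_ge_1[OF l(2)] by simp
  have "real J = real (J div ?B) * real ?B + real (J mod ?B)"
    by (metis div_mult_mod_eq of_nat_add of_nat_mult)
  moreover have "real (J mod ?B) \<le> real ?B" by (simp only: of_nat_le_iff) (rule less_imp_le, simp)
  ultimately have "real J \<le> real (J div ?B) * real ?B + real ?B" by linarith
  then have "real J / real ?B \<le> (real (J div ?B) * real ?B + real ?B) / real ?B"
    by (rule divide_right_mono) simp
  also have "\<dots> = real (J div ?B) + 1" by (simp add: add_divide_distrib)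
  finally have 1: "real J / real ?B - 1 \<le> real (J div ?B)" by simp
  have "sieve_exponent l * real J - 1 = (real J / real ?B) / (2 * real (mertens_const l)) - 1"
    by (simp add: sieve_exponent_def)
  also have "\<dots> \<le> (real J / real ?B) / (2 * real (mertens_const l)) - 1
      / (2 * real (mertens_const l))" using A by simp
  also have "\<dots> = (real J / real ?B - 1) / (2 * real (mertens_const l))"
    by (rule diff_divide_distrib[symmetric])
  also have "\<dots> \<le> real (J div ?B) / (2 * real (mertens_const l))" using 1 A
    by (intro divide_right_mono) auto
  also have "\<dots> \<le> split_recip l ((J div ?B) * ?B)" by (rule split_recip_multiple_ge[OF l])
  also have "\<dots> \<le> split_recip l J" by (rule split_recip_mono) (rule div_times_less_eq_dividend)
  finally show ?thesis .
qed

section \<open>The sieve in dyadic intervals\<close>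

lemma power_div_fact_le_exp:
  fixes x :: real
  assumes "0 \<le> x"
  shows "x ^ n / fact n \<le> exp x"
proof -
  have s: "(\<lambda>n. x ^ n /\<^sub>R fact n) sums exp x" by (rule exp_converges)
  have "(\<Sum>i\<in>{n}. x ^ i /\<^sub>R fact i) \<le> (\<Sum>i. x ^ i /\<^sub>R fact i)"
    using sums_summable[OF s] assms by (intro sum_le_suminf) auto
  then show ?thesis using sums_unique[OF s] by (simp add: divide_inverse mult.commute)
qed

text \<open>With \<open>n = Suc (100 * J)\<close>, insert \<open>5 ^ n\<close> and compare with the
  exponential series: \<open>(5 L) ^ n / fact n\<close> is at most
  \<open>exp (50 J) \<le> 3 ^ (50 J)\<close>. This is divided by
  \<open>5 ^ (100 J) = 25 ^ (50 J)\<close>, and \<open>3 / 25 \<le> 1 / 4\<close>.\<close>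

lemma power_div_fact_small:
  fixes L :: real
  assumes "0 \<le> L" "L \<le> 10 * real J"
  shows "L ^ Suc (100 * J) / fact (Suc (100 * J)) \<le> (1 / 2) ^ (100 * J)"
proof -
  let ?n = "Suc (100 * J)"
  have e: "exp (50 * real J) \<le> 3 ^ (50 * J)"
  proof -
    have "exp (50 * real J) = exp 1 ^ (50 * J)" by (simp flip: exp_of_nat_mult)
    also have "\<dots> \<le> 3 ^ (50 * J)" by (intro power_mono exp_le) auto
    finally show ?thesis .
  qed
  have "5 ^ ?n * (L ^ ?n / fact ?n) = (5 * L) ^ ?n / fact ?n"
    by (simp only: power_mult_distrib times_divide_eq_right)
  also have "\<dots> \<le> exp (5 * L)" using assms by (intro power_div_fact_le_exp) auto
  also have "\<dots> \<le> exp (50 * real J)" using assms by simp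
  finally have "5 ^ ?n * (L ^ ?n / fact ?n) \<le> 3 ^ (50 * J)" using e by linarith
  moreover have "5 ^ (100 * J) * (L ^ ?n / fact ?n) \<le> 5 ^ ?n * (L ^ ?n / fact ?n)"
    using assms by (intro mult_right_mono power_increasing) auto
  ultimately have "5 ^ (100 * J) * (L ^ ?n / fact ?n) \<le> 3 ^ (50 * J)" by linarith
  moreover have "(5::real) ^ (100 * J) = 25 ^ (50 * J)"
  proof -
    have "(5::real) ^ (100 * J) = (5 ^ 2) ^ (50 * J)" by (simp only: power_mult[symmetric]) simp
    then show ?thesis by simp
  qed
  ultimately have "L ^ ?n / fact ?n \<le> 3 ^ (50 * J) / 25 ^ (50 * J)"
    by (simp only:) (simp add: field_simps)
  also have "\<dots> = (3 / 25) ^ (50 * J)" by (simp only: power_divide)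
  also have "\<dots> \<le> (1 / 4) ^ (50 * J)" by (intro power_mono) auto
  also have "(1 / 4 :: real) ^ (50 * J) = ((1 / 2) ^ 2) ^ (50 * J)" by (simp add: power2_eq_square)
  also have "\<dots> = (1 / 2) ^ (100 * J)" by (simp only: power_mult[symmetric]) simp
  finally show ?thesis .
qed

text \<open>The truncation level \<open>100 J\<close> is a large multiple of the sum \<open>10 J\<close> of the densities, which makes
  the tail of the inclusion-exclusion sum negligible.\<close>

theorem sieve_count:
  assumes J: "J \<ge> 1" and i: "400 * J * 2 ^ J \<le> i"
    and w: "\<And>r. prime r \<Longrightarrow> r mod l = 1 \<Longrightarrow> r \<notin> V \<Longrightarrow> 0 < w r \<and> w r < r"
    and H: "(\<Sum>r\<in>split_primes l (2 ^ 2 ^ J) \<inter> V. 1 / real r) \<le> H"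
  shows "real (card {m. 2 ^ i \<le> m \<and> m < 2 ^ i + 2 ^ i \<and> (\<forall>r. prime r \<longrightarrow> r \<le> 2 ^ 2 ^ J \<longrightarrow>
      \<not> r dvd m \<and> (r mod l = 1 \<longrightarrow> r \<notin> V \<longrightarrow> m mod r \<noteq> w r))})
    \<le> 2 ^ i * (2 * exp (H - split_recip l J) / 2 ^ J + 2 * (1 / 2) ^ (100 * J))"
proof -
  define z where "z = (2::nat) ^ 2 ^ J"
  define D where "D = primes_upto z"
  define P where "P = split_primes l z - V"
  \<comment> \<open>Class 0 expresses that \<open>r\<close> does not divide \<open>m\<close>; the
    second class is available only for the split primes outside \<open>V\<close>.\<close>
  define Om where "Om r = (if r \<in> P then {0, w r} else {0})" for r
  define \<rho> where "\<rho> r = real (card (Om r)) / real r" for r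
  have PD: "P \<subseteq> D" using split_primes_subset_primes_upto by (auto simp: P_def D_def)
  have finD: "finite D" by (simp add: D_def)
  have wP: "0 < w r \<and> w r < r" if "r \<in> P" for r using w that by (auto simp: P_def split_primes_def)
  have cOm: "card (Om r) = (if r \<in> P then 2 else 1)" for r using wP[of r] by (auto simp: Om_def)
  have r2: "real r \<ge> 2" "prime r" "r \<le> z" if "r \<in> D" for r
    using primes_uptoD(1,2,3)[of r z] that by (auto simp: D_def)
  have z4: "z \<ge> 4"
  proof -
    have "(2::nat) ^ 1 \<le> 2 ^ J" using J by (intro power_increasing) auto
    then have "(2::nat) ^ 2 \<le> 2 ^ 2 ^ J" by (intro power_increasing) auto
    then show ?thesis by (simp add: z_def)
  qed
  have set_eq: "{m. 2 ^ i \<le> m \<and> m < 2 ^ i + 2 ^ i \<and> (\<forall>r. prime r \<longrightarrow> r \<le> 2 ^ 2 ^ J \<longrightarrow>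
      \<not> r dvd m \<and> (r mod l = 1 \<longrightarrow> r \<notin> V \<longrightarrow> m mod r \<noteq> w r))}
     = {m. 2 ^ i \<le> m \<and> m < 2 ^ i + 2 ^ i \<and> (\<forall>r\<in>D. m mod r \<notin> Om r)}"
    unfolding D_def primes_upto_def Om_def P_def split_primes_def z_def[symmetric]
    by (auto simp: dvd_eq_mod_eq_0 split: if_splits)
  have "real (card {m. 2 ^ i \<le> m \<and> m < 2 ^ i + 2 ^ i \<and> (\<forall>r\<in>D. m mod r \<notin> Om r)})
    \<le> real (2 ^ i) * (\<Prod>r\<in>D. 1 - \<rho> r) + real (2 ^ i) * esym (Suc (100 * J)) D \<rho>
       + (\<Sum>j\<le>100 * J. esym j D (\<lambda>r. real (card (Om r))))"
    unfolding \<rho>_def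
  proof (rule brun_sieve)
    fix r assume r: "r \<in> D"
    show "prime r" using r2[OF r] by simp
    show "Om r \<subseteq> {..<r}" using wP[of r] r2[OF r] by (auto simp: Om_def)
  qed (use finD in auto)
  also have "(\<Prod>r\<in>D. 1 - \<rho> r) \<le> 2 * exp (H - split_recip l J) / 2 ^ J"
  proof -
    \<comment> \<open>With \<open>x = 1 / r\<close>, use
      \<open>1 - 2 x \<le> (1 - x) ^ 2 \<le> (1 - x) * exp (- x)\<close>. The factors
      \<open>1 - x\<close> over all primes form the Mertens product; the factors
      \<open>exp (- x)\<close> over \<open>P\<close> give the exponential, as the reciprocals over
      \<open>P\<close> sum to at least \<open>split_recip l J - H\<close>.\<close>
    have "(\<Prod>r\<in>D. 1 - \<rho> r) \<le> (\<Prod>r\<in>D. (1 - 1 / real r) * exp (if r \<in> P then - (1 / real r) else 0))"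
    proof (rule prod_mono)
      fix r assume r: "r \<in> D"
      have x: "0 \<le> 1 / real r" "1 / real r \<le> 1 / 2" using r2[OF r] by (auto simp: field_simps)
      have "1 - 2 * (1 / real r) \<le> (1 - 1 / real r) * (1 - 1 / real r)" by (simp add: algebra_simps)
      also have "\<dots> \<le> (1 - 1 / real r) * exp (- (1 / real r))"
        using exp_ge_add_one_self[of "- (1 / real r)"] x by (intro mult_left_mono) auto
      finally show "0 \<le> 1 - \<rho> r \<and> 1 - \<rho> r \<le> (1 - 1 / real r)
          * exp (if r \<in> P then - (1 / real r) else 0)"
        using x by (auto simp: \<rho>_def cOm)
    qed
    also have "\<dots> = (\<Prod>r\<in>D. 1 - 1 / real r) * exp (\<Sum>r\<in>D. if r \<in> P then - (1 / real r) else 0)"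
      by (simp add: prod.distrib exp_sum[OF finD])
    also have "\<dots> \<le> (2 / 2 ^ J) * exp (H - split_recip l J)"
    proof (rule mult_mono)
      have "(\<Prod>r\<in>D. 1 - 1 / real r) \<le> 1 / ln (real z)" unfolding D_def using z4
        by (intro prod_primes_le) simp
      also have "ln (real z) = 2 ^ J * ln 2" by (simp add: z_def ln_realpow)
      also have "1 / (2 ^ J * ln 2) \<le> 1 / (2 ^ J * (1 / 2 :: real))"
        using ln2_ge_half by (intro divide_left_mono mult_left_mono) auto
      finally show "(\<Prod>r\<in>D. 1 - 1 / real r) \<le> 2 / 2 ^ J" by simp
      have "split_recip l J = (\<Sum>r\<in>split_primes l z \<inter> V. 1 / real r) + (\<Sum>r\<in>P. 1 / real r)"
        unfolding split_recip_def P_def z_def[symmetric]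
          by (subst sum.union_disjoint[symmetric]) (auto intro!: sum.cong)
      moreover have "(\<Sum>r\<in>D. if r \<in> P then - (1 / real r) else 0) = - (\<Sum>r\<in>P. 1 / real r)"
      proof -
        have "(\<Sum>r\<in>D. if r \<in> P then - (1 / real r) else 0) = (\<Sum>r\<in>{r\<in>D. r \<in> P}. - (1 / real r))"
          by (rule sum.inter_filter[OF finD, symmetric])
        also have "{r\<in>D. r \<in> P} = P" using PD by auto
        finally show ?thesis by (simp add: sum_negf)
      qed
      ultimately show "exp (\<Sum>r\<in>D. if r \<in> P then - (1 / real r) else 0) \<le> exp (H - split_recip l J)"
        using H by (simp add: z_def)
    qed auto
    finally show ?thesis by simp
  qed
  also have "esym (Suc (100 * J)) D \<rho> \<le> (1 / 2) ^ (100 * J)"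
  proof -
    have \<rho>0: "0 \<le> \<rho> r" for r by (simp add: \<rho>_def)
    have "(\<Sum>r\<in>D. \<rho> r) \<le> (\<Sum>r\<in>D. 2 * (1 / real r))"
      by (intro sum_mono) (auto simp: \<rho>_def cOm divide_right_mono)
    also have "\<dots> = 2 * (\<Sum>r\<in>D. 1 / real r)" by (rule sum_distrib_left[symmetric])
    also have "\<dots> \<le> 2 * (4 * real J + 1)"
      unfolding D_def z_def using sum_inverse_primes_le[of J] by simp
    also have "\<dots> \<le> 10 * real J" using J by simp
    finally have L: "(\<Sum>r\<in>D. \<rho> r) \<le> 10 * real J" .
    have "esym (Suc (100 * J)) D \<rho> \<le> (\<Sum>r\<in>D. \<rho> r) ^ Suc (100 * J) / fact (Suc (100 * J))"
      by (rule esym_le[OF finD \<rho>0])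
    also have "\<dots> \<le> (1 / 2) ^ (100 * J)"
      using \<rho>0 L by (intro power_div_fact_small sum_nonneg) auto
    finally show ?thesis .
  qed
  also have "(\<Sum>j\<le>100 * J. esym j D (\<lambda>r. real (card (Om r)))) \<le> 2 ^ i * (1 / 2) ^ (100 * J)"
  proof -
    have "(\<Sum>j\<le>100 * J. esym j D (\<lambda>r. real (card (Om r))))
        \<le> (1 + (\<Sum>r\<in>D. real (card (Om r)))) ^ (100 * J)"
      by (rule sum_esym_le[OF finD]) simp
    also have "\<dots> \<le> (real z ^ 2) ^ (100 * J)"
    proof (rule power_mono)
      have "(\<Sum>r\<in>D. real (card (Om r))) \<le> (\<Sum>r\<in>D. 2)" by (rule sum_mono) (simp add: cOm)
      also have "\<dots> = 2 * real (card D)" by simp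
      also have "card D \<le> card {2..z}" using primes_uptoD(2,3)[of _ z]
        by (intro card_mono) (auto simp: D_def)
      then have "2 * real (card D) \<le> 2 * (real z - 1)" using z4 by simp
      also have "1 + 2 * (real z - 1) \<le> real z * real z"
      proof -
        have "2 * real z \<le> real z * real z" using z4 by (intro mult_right_mono) auto
        then show ?thesis by simp
      qed
      finally show "1 + (\<Sum>r\<in>D. real (card (Om r))) \<le> real z ^ 2" by (simp add: power2_eq_square)
    qed (simp add: add_nonneg_nonneg sum_nonneg)
    \<comment> \<open>Twice this exponent is at most \<open>i\<close>, which leaves room for the
      factor \<open>(1 / 2) ^ (100 * J)\<close>.\<close>
    also have "\<dots> = 2 ^ (200 * J * 2 ^ J)"
      by (simp add: z_def power_mult[symmetric] mult_ac)
    also have "\<dots> \<le> 2 ^ i * (1 / 2) ^ (100 * J)"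
    proof -
      have "J \<le> J * 2 ^ J" by simp
      moreover have "400 * (J * 2 ^ J) \<le> i" using i by (simp only: mult.assoc)
      ultimately have "200 * (J * 2 ^ J) + 100 * J \<le> i" by linarith
      then have "200 * J * 2 ^ J + 100 * J \<le> i" by (simp only: mult.assoc)
      then have "(2::real) ^ (200 * J * 2 ^ J + 100 * J) \<le> 2 ^ i" by (rule power_increasing) simp
      then show ?thesis by (simp add: power_add field_simps power_divide)
    qed
    finally show ?thesis .
  qed
  finally show ?thesis unfolding set_eq by (simp add: algebra_simps)
qed

text \<open>Sieving with \<open>100 J\<close> steps by the primes up to \<open>2 ^ 2 ^ J\<close> is possible in the dyadic intervals
  from \<open>2 ^ block_start J\<close> on.\<close>

definition block_start :: "nat \<Rightarrow> nat" where "block_start J = 400 * J * 2 ^ J"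

text \<open>\<open>1638400 = 6400 * 256\<close>: the first factor collects the constants of the
  block in \<open>block_bound\<close>, the second is \<open>4 ^ 4\<close> from
  \<open>exp (- x) \<le> (4 / x) ^ 4\<close>.\<close>

definition tail_const :: "nat \<Rightarrow> real \<Rightarrow> real" where
  "tail_const l H = 1638400 * exp (H + 1) * (1 / sieve_exponent l) ^ 4"

text \<open>\<open>block_start (Suc J) = 800 * (J + 1) * 2 ^ J\<close> bounds the number of dyadic
  intervals in the block, and each contributes \<open>2 ^ (- J)\<close> times an exponentially small
  factor. The powers of 2 cancel; a fourth power taken from the exponential turns the remaining
  \<open>J\<close> into \<open>J ^ (- 3)\<close>.\<close>

lemma block_bound:
  assumes l: "prime l" "l \<ge> 3" and J: "J \<ge> 1" and H: "H \<ge> 0"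
  shows "real (block_start (Suc J)) * (2 * exp (H - split_recip l J) / 2 ^ J + 2
      * (1 / 2) ^ (100 * J)) \<le> tail_const l H / real J ^ 3"
proof -
  define E where "E = exp (H + 1) * exp (- (sieve_exponent l * real J))"
  have d: "0 < sieve_exponent l" "sieve_exponent l \<le> 1 / 2" using sieve_exponent_bounds[OF l(2)]
    by auto
  have Jr: "real J \<ge> 1" using J by simp
  have e1: "exp (H - split_recip l J) \<le> E"
    using split_recip_ge[OF l, of J] by (simp add: E_def flip: exp_add)
  have e2: "2 ^ J * (1 / 2) ^ (100 * J) \<le> E"
  proof -
    have "(2::real) ^ J * (1 / 2) ^ (100 * J) = (1 / 2) ^ (99 * J)"
    proof -
      have "(1 / 2 :: real) ^ (100 * J) = (1 / 2) ^ J * (1 / 2) ^ (99 * J)"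
        by (simp flip: power_add)
      then show ?thesis by (simp add: power_divide)
    qed
    also have "\<dots> \<le> (1 / 2) ^ J" by (rule power_decreasing) auto
    also have "\<dots> \<le> exp (- (1 / 2)) ^ J"
      using exp_half_le2 by (intro power_mono) (auto simp: exp_minus field_simps)
    also have "\<dots> = exp (- (1 / 2 * real J))" by (simp flip: exp_of_nat_mult)
    also have "\<dots> \<le> 1 * exp (- (sieve_exponent l * real J))" using d Jr
      by (simp add: mult_right_mono)
    also have "\<dots> \<le> exp (H + 1) * exp (- (sieve_exponent l * real J))" using H
      by (intro mult_right_mono) auto
    finally show ?thesis by (simp add: E_def)
  qed
  have e3: "exp (- (sieve_exponent l * real J)) \<le> 256 / (sieve_exponent l * real J) ^ 4"
  proof -
    define x where "x = sieve_exponent l * real J"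
    have x: "x > 0" using d Jr by (simp add: x_def)
    have "(x / 4) ^ 4 \<le> exp (x / 4) ^ 4"
    proof (rule power_mono)
      show "x / 4 \<le> exp (x / 4)" using exp_ge_add_one_self[of "x / 4"] by linarith
    qed (use x in simp)
    also have "\<dots> = exp x" by (simp flip: exp_of_nat_mult)
    finally have "x ^ 4 / 256 \<le> exp x" by (simp add: power_divide)
    then show ?thesis unfolding x_def[symmetric] using x by (simp add: exp_minus field_simps)
  qed
  have "real (block_start (Suc J)) * (2 * exp (H - split_recip l J) / 2 ^ J + 2
      * (1 / 2) ^ (100 * J))
    = 1600 * (real J + 1) * (exp (H - split_recip l J) + 2 ^ J * (1 / 2) ^ (100 * J))"
    by (simp add: block_start_def field_simps)
  also have "\<dots> \<le> 1600 * (real J + real J) * (E + E)"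
    using e1 e2 Jr by (intro mult_mono add_mono) auto
  also have "\<dots> = 6400 * real J * exp (H + 1) * exp (- (sieve_exponent l * real J))"
    by (simp add: E_def)
  also have "\<dots> \<le> 6400 * real J * exp (H + 1) * (256 / (sieve_exponent l * real J) ^ 4)"
    using e3 by (intro mult_left_mono) auto
  also have "\<dots> = tail_const l H / real J ^ 3"
    using Jr d by (simp add: tail_const_def field_simps power_mult_distrib power3_eq_cube
        power4_eq_xxxx)
  finally show ?thesis .
qed

lemma sum_blocks_le:
  fixes a :: "nat \<Rightarrow> nat" and f b :: "nat \<Rightarrow> real"
  assumes "mono a" "\<And>J. J \<ge> J1 \<Longrightarrow> (\<Sum>i\<in>{a J..<a (Suc J)}. f i) \<le> b J" "J1 \<le> Jm"
  shows "(\<Sum>i\<in>{a J1..<a Jm}. f i) \<le> (\<Sum>J\<in>{J1..<Jm}. b J)"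
  using assms(3)
proof (induction Jm rule: dec_induct)
  case (step n)
  have "(\<Sum>i\<in>{a J1..<a (Suc n)}. f i) = (\<Sum>i\<in>{a J1..<a n}. f i) + (\<Sum>i\<in>{a n..<a (Suc n)}. f i)"
    using assms(1) step by (intro sum.atLeastLessThan_concat[symmetric]) (auto simp: monoD)
  then show ?case using step assms(2)[of n] by simp
qed simp

text \<open>The sieving level has to grow with \<open>q\<close>: dyadic intervals with index from
  \<open>block_start J\<close> to below \<open>block_start (Suc J)\<close> are sieved by the primes
  up to \<open>2 ^ 2 ^ J\<close>. The block bounds are summable, and weakening
  \<open>1 / J ^ 3\<close> to \<open>1 / J ^ 2\<close> makes the tail telescope.\<close>

theorem sieve_tail:
  assumes l: "prime l" "l \<ge> 3" and J1: "J1 \<ge> 2"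
    and H: "\<And>n. (\<Sum>r\<in>split_primes l n \<inter> V. 1 / real r) \<le> H"
    and w: "\<And>r. prime r \<Longrightarrow> r mod l = 1 \<Longrightarrow> r \<notin> V \<Longrightarrow> 0 < w r \<and> w r < r"
    and Q: "finite Q" "\<And>q. q \<in> Q \<Longrightarrow> prime q" "\<And>q. q \<in> Q \<Longrightarrow> 2 ^ block_start J1 \<le> q"
    and avoid: "\<And>q r. q \<in> Q \<Longrightarrow> prime r \<Longrightarrow> r mod l = 1 \<Longrightarrow> r \<notin> V \<Longrightarrow> q mod r \<noteq> w r"
  shows "(\<Sum>q\<in>Q. 1 / real q) \<le> 2 * tail_const l H / real J1"
proof -
  have H0: "H \<ge> 0"
  proof -
    have "0 \<le> (\<Sum>r\<in>split_primes l 0 \<inter> V. 1 / real r)" by (intro sum_nonneg) auto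
    then show ?thesis using H[of 0] by linarith
  qed
  have Kc0: "tail_const l H \<ge> 0" using sieve_exponent_bounds[OF l(2)] by (simp add: tail_const_def)
  have mono: "mono block_start"
    by (rule monoI) (auto simp: block_start_def intro!: mult_le_mono power_increasing)
  \<comment> \<open>For \<open>q > 0\<close> this is the binary logarithm rounded down, the index of
    the dyadic interval of \<open>q\<close>.\<close>
  define g where "g q = (LEAST i. q < 2 ^ Suc i)" for q :: nat
  have g1: "q < 2 ^ Suc (g q)" for q
  proof -
    have "q < 2 ^ q" by (rule less_exp)
    also have "(2::nat) ^ q \<le> 2 ^ Suc q" by simp
    finally have "q < 2 ^ Suc q" .
    then show ?thesis unfolding g_def by (rule LeastI)
  qed
  have g2: "2 ^ g q \<le> q" if "q \<in> Q" for q
  proof (cases "g q")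
    case 0
    then show ?thesis using prime_gt_0_nat[OF Q(2)[OF that]] by simp
  next
    case (Suc j)
    then have "\<not> q < 2 ^ Suc j" using not_less_Least[of j "\<lambda>i. q < 2 ^ Suc i"] by (simp add: g_def)
    then show ?thesis using Suc by simp
  qed
  have g3: "block_start J1 \<le> g q" if "q \<in> Q" for q
  proof (rule ccontr)
    assume "\<not> block_start J1 \<le> g q"
    then have "(2::nat) ^ Suc (g q) \<le> 2 ^ block_start J1" by (intro power_increasing) auto
    then show False using g1[of q] Q(3)[OF that] by linarith
  qed
  define Jm where "Jm = Suc (Max (insert J1 (g ` Q)))"
  have Jm: "J1 \<le> Jm"
  proof -
    have "J1 \<le> Max (insert J1 (g ` Q))" using Q(1) by (intro Max_ge) auto
    then show ?thesis by (simp add: Jm_def)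
  qed
  have g4: "g q < block_start Jm" if "q \<in> Q" for q
  proof -
    have "g q \<le> Max (insert J1 (g ` Q))" using Q(1) that by (intro Max_ge) auto
    then have "g q < Jm" by (simp add: Jm_def)
    also have "Jm * 1 \<le> Jm * (400 * 2 ^ Jm)" by (intro mult_le_mono2) simp
    then have "Jm \<le> block_start Jm" by (simp add: block_start_def mult_ac)
    finally show ?thesis .
  qed
  have "(\<Sum>q\<in>Q. 1 / real q) = (\<Sum>i\<in>{block_start J1..<block_start Jm}. \<Sum>q\<in>{q\<in>Q. g q = i}. 1 / real q)"
    using Q(1) g3 g4 by (intro sum.group[symmetric]) auto
  also have "\<dots> \<le> (\<Sum>J\<in>{J1..<Jm}. tail_const l H / real J ^ 3)"
  proof (rule sum_blocks_le[OF mono _ Jm])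
    fix J assume "J \<ge> J1"
    then have J: "J \<ge> 1" using J1 by simp
    let ?W = "2 * exp (H - split_recip l J) / 2 ^ J + 2 * (1 / 2) ^ (100 * J)"
    have W0: "?W \<ge> 0" by (intro add_nonneg_nonneg) auto
    have "(\<Sum>q\<in>{q\<in>Q. g q = i}. 1 / real q) \<le> ?W" if i: "i \<in> {block_start J..<block_start (Suc J)}"
      for i
    proof -
      let ?C = "{m. 2 ^ i \<le> m \<and> m < 2 ^ i + 2 ^ i \<and> (\<forall>r. prime r \<longrightarrow> r \<le> 2 ^ 2 ^ J \<longrightarrow>
        \<not> r dvd m \<and> (r mod l = 1 \<longrightarrow> r \<notin> V \<longrightarrow> m mod r \<noteq> w r))}"
      have iJ: "400 * J * 2 ^ J \<le> i" using i by (simp add: block_start_def)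
      have "2 ^ J < i"
      proof -
        have "1 * 2 ^ J < 400 * J * 2 ^ J" using J by (intro mult_strict_right_mono) auto
        then have "2 ^ J < 400 * J * 2 ^ J" by (simp only: mult_1)
        then show ?thesis using iJ by (rule less_le_trans)
      qed
      \<comment> \<open>All sieving primes lie below the interval, so a prime \<open>q\<close> in it
        is different from each of them and avoids their class 0.\<close>
      then have zi: "(2::nat) ^ 2 ^ J < 2 ^ i" by (intro power_strict_increasing) auto
      have sub: "{q\<in>Q. g q = i} \<subseteq> ?C"
      proof
        fix q assume "q \<in> {q\<in>Q. g q = i}"
        then have q: "q \<in> Q" "g q = i" by auto
        have b: "2 ^ i \<le> q" "q < 2 ^ i + 2 ^ i" using g1[of q] g2[OF q(1)] q(2) by auto
        have "\<not> r dvd q" if r: "prime r" "r \<le> 2 ^ 2 ^ J" for r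
        proof
          assume "r dvd q"
          then have "r = q" using r(1) Q(2)[OF q(1)] primes_dvd_imp_eq by blast
          then show False using r(2) zi b(1) by linarith
        qed
        then show "q \<in> ?C" using b avoid[OF q(1)] by blast
      qed
      have finC: "finite ?C" by (rule finite_subset[of _ "{..<2 ^ i + 2 ^ i}"]) auto
      have "(\<Sum>q\<in>{q\<in>Q. g q = i}. 1 / real q) \<le> (\<Sum>q\<in>{q\<in>Q. g q = i}. 1 / 2 ^ i)"
      proof (rule sum_mono)
        fix q assume "q \<in> {q\<in>Q. g q = i}"
        then have "2 ^ i \<le> q" using g2 by auto
        then have "real (2 ^ i) \<le> real q" by (simp only: of_nat_le_iff)
        moreover have "0 < real (2 ^ i)" by simp
        ultimately have "0 < real q" "real (2 ^ i) \<le> real q" by linarith+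
        then show "1 / real q \<le> 1 / 2 ^ i" by (intro divide_left_mono mult_pos_pos) simp_all
      qed
      also have "\<dots> = real (card {q\<in>Q. g q = i}) / 2 ^ i" by simp
      also have "\<dots> \<le> real (card ?C) / 2 ^ i"
        using card_mono[OF finC sub] by (intro divide_right_mono) auto
      also have "\<dots> \<le> (2 ^ i * ?W) / 2 ^ i"
        by (intro divide_right_mono sieve_count[OF J iJ w H]) auto
      also have "\<dots> = ?W" by simp
      finally show ?thesis .
    qed
    then have "(\<Sum>i\<in>{block_start J..<block_start (Suc J)}. \<Sum>q\<in>{q\<in>Q. g q = i}. 1 / real q)
      \<le> (\<Sum>i\<in>{block_start J..<block_start (Suc J)}. ?W)" by (rule sum_mono)
    also have "\<dots> = real (block_start (Suc J) - block_start J) * ?W" by simp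
    also have "\<dots> \<le> real (block_start (Suc J)) * ?W" using W0 by (intro mult_right_mono) auto
    also have "\<dots> \<le> tail_const l H / real J ^ 3" by (rule block_bound[OF l J H0])
    finally show "(\<Sum>i\<in>{block_start J..<block_start (Suc J)}. \<Sum>q\<in>{q\<in>Q. g q = i}. 1 / real q)
        \<le> tail_const l H / real J ^ 3" .
  qed
  also have "\<dots> \<le> (\<Sum>J\<in>{J1..<Jm}. tail_const l H * (1 / real J ^ 2))"
  proof (rule sum_mono)
    fix J assume "J \<in> {J1..<Jm}"
    then have "real J \<ge> 1" using J1 by simp
    then have "real J ^ 2 \<le> real J ^ 3" by (intro power_increasing) auto
    then show "tail_const l H / real J ^ 3 \<le> tail_const l H * (1 / real J ^ 2)"
      using Kc0 \<open>real J \<ge> 1\<close> by (simp add: divide_left_mono)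
  qed
  also have "\<dots> = tail_const l H * (\<Sum>J\<in>{J1..<Jm}. 1 / real J ^ 2)"
    by (rule sum_distrib_left[symmetric])
  also have "\<dots> \<le> tail_const l H * (2 / real J1)"
  proof (rule mult_left_mono[OF _ Kc0])
    \<comment> \<open>\<open>J1 \<ge> 2\<close> keeps \<open>J1 - 1\<close> positive and gives
      \<open>1 / (J1 - 1) \<le> 2 / J1\<close>.\<close>
    have "{J1..<Jm} = {J1 - 1<..Jm - 1}" using J1 Jm by auto
    then have "(\<Sum>J\<in>{J1..<Jm}. 1 / real J ^ 2) \<le> 1 / real (J1 - 1) - 1 / real (Jm - 1)"
      using sum_inverse_squares_le[of "J1 - 1" "Jm - 1"] J1 Jm by simp
    also have "\<dots> \<le> 1 / real (J1 - 1)" by simp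
    also have "\<dots> \<le> 2 / real J1" using J1 by (simp add: field_simps of_nat_diff)
    finally show "(\<Sum>J\<in>{J1..<Jm}. 1 / real J ^ 2) \<le> 2 / real J1" .
  qed
  finally show ?thesis by (simp add: mult.commute)
qed

subsection \<open>The sum of divisors\<close>

lemma sigma_mult:
  assumes ab: "coprime a b" "a > 0" "b > 0"
  shows "sigma (a * b) = sigma a * sigma b"
proof -
  let ?f = "\<lambda>(x, y). x * y :: nat"
  let ?A = "{x. x dvd a}" and ?B = "{y. y dvd b}"
  have g: "gcd (x * y) a = x \<and> gcd (x * y) b = y" if "x dvd a" "y dvd b" for x y
  proof -
    have "coprime (gcd (x * y) a) y" by (rule coprime_divisors[OF gcd_dvd2 that(2) ab(1)])
    then have "gcd (x * y) a dvd x" using gcd_dvd1[of "x * y" a]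
      by (simp only: coprime_dvd_mult_left_iff)
    moreover have "x dvd gcd (x * y) a" using that by simp
    moreover have "coprime x (gcd (x * y) b)" by (rule coprime_divisors[OF that(1) gcd_dvd2 ab(1)])
    then have "coprime (gcd (x * y) b) x" by (simp only: coprime_commute)
    then have "gcd (x * y) b dvd y" using gcd_dvd1[of "x * y" b]
      by (simp only: coprime_dvd_mult_right_iff)
    moreover have "y dvd gcd (x * y) b" using that by simp
    ultimately show ?thesis by (simp add: dvd_antisym)
  qed
  have inj: "inj_on ?f (?A \<times> ?B)"
    by (rule inj_on_inverseI[of _ "\<lambda>m. (gcd m a, gcd m b)"]) (use g in auto)
  have im: "{d. d dvd a * b} = ?f ` (?A \<times> ?B)"
  proof (rule equalityI; rule subsetI)
    fix d assume "d \<in> {d. d dvd a * b}"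
    then obtain x y where "d = x * y" "x dvd a" "y dvd b" using division_decomp[of d a b] by auto
    then show "d \<in> ?f ` (?A \<times> ?B)" by (auto intro!: image_eqI[of _ _ "(x, y)"])
  next
    fix d assume "d \<in> ?f ` (?A \<times> ?B)"
    then show "d \<in> {d. d dvd a * b}" by (auto intro: mult_dvd_mono)
  qed
  have "sigma (a * b) = (\<Sum>z\<in>?A \<times> ?B. ?f z)"
    unfolding sigma_def im by (simp only: sum.reindex[OF inj] o_def)
  also have "\<dots> = (\<Sum>x\<in>?A. x) * (\<Sum>y\<in>?B. y)"
    by (simp only: sum.cartesian_product[symmetric] sum_product)
  finally show ?thesis by (simp add: sigma_def)
qed

lemma sigma_prime_power:
  assumes "prime q"
  shows "sigma (q ^ k) = (\<Sum>i<Suc k. q ^ i)"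
proof -
  have "{d. d dvd q ^ k} = (\<lambda>i. q ^ i) ` {..<Suc k}"
    using divides_primepow_nat[OF assms] by (auto simp: less_Suc_eq_le)
  moreover have "inj_on (\<lambda>i. q ^ i) {..<Suc k}"
    using prime_gt_1_nat[OF assms] by (auto intro!: inj_onI)
  ultimately show ?thesis unfolding sigma_def by (simp add: sum.reindex)
qed

lemma inverse_one_minus_le_exp:
  fixes x :: real
  assumes "0 \<le> x" "x \<le> 1 / 2"
  shows "1 / (1 - x) \<le> exp (2 * x)"
proof -
  have "1 \<le> (1 + 2 * x) * (1 - x)" 
  proof -
    have "x * x \<le> (1 / 2) * x" using assms by (intro mult_right_mono) auto
    then show ?thesis by (simp add: algebra_simps)
  qed
  also have "\<dots> \<le> exp (2 * x) * (1 - x)" using assms exp_ge_add_one_self[of "2 * x"]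
    by (intro mult_right_mono) auto
  finally show ?thesis using assms by (simp add: field_simps)
qed

text \<open>The geometric series bounds the ratio by \<open>1 / (1 - 1 / q)\<close>. The 2 in the
  exponent makes the comparison with the exponential valid up to
  \<open>1 / q = 1 / 2\<close>.\<close>

lemma h_prime_power_le:
  assumes q: "prime q"
  shows "h (q ^ k) \<le> exp (2 / real q)"
proof -
  have q2: "real q \<ge> 2" using prime_ge_2_nat[OF q] by simp
  have "(real q - 1) * (\<Sum>i<Suc k. real q ^ i) = real q ^ Suc k - 1"
    by (rule power_diff_1_eq[symmetric])
  also have "\<dots> \<le> real q * real q ^ k" by simp
  finally have "(real q - 1) * (\<Sum>i<Suc k. real q ^ i) \<le> real q * real q ^ k" .
  then have "(\<Sum>i<Suc k. real q ^ i) / real q ^ k \<le> real q / (real q - 1)" using q2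
    by (simp add: field_simps del: sum.lessThan_Suc)
  also have "\<dots> = 1 / (1 - 1 / real q)" using q2 by (simp add: field_simps)
  also have "\<dots> \<le> exp (2 * (1 / real q))" using q2
    by (intro inverse_one_minus_le_exp) (auto simp: field_simps)
  finally show ?thesis by (simp add: h_def sigma_prime_power[OF q] del: sum.lessThan_Suc)
qed

lemma h_le_exp:
  assumes "N > 0"
  shows "h N \<le> exp (\<Sum>p\<in>prime_factors N. 2 / real p)"
  using assms
proof (induction N rule: less_induct)
  case (less N)
  show ?case
  proof (cases "N = 1")
    case True
    then show ?thesis by (simp add: h_def sigma_def)
  next
    case False
    then obtain p where p: "prime p" "p dvd N" using prime_factor_nat by blast
    define k where "k = multiplicity p N"
    have "N \<noteq> 0" "\<not> is_unit p" using less.prems p by auto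
    then obtain m where m: "N = p ^ k * m" "\<not> p dvd m" using multiplicity_decompose'[of N p]
      unfolding k_def by blast
    have "k > 0" using p m less.prems by (cases k) auto
    have m0: "m > 0" using less.prems m by (cases m) auto
    have "1 * m < p ^ k * m" using m0 prime_gt_1_nat[OF p(1)] \<open>k > 0\<close>
      by (intro mult_less_mono1 one_less_power) auto
    then have mN: "m < N" using m(1) by simp
    have cop: "coprime (p ^ k) m" using p(1) m(2) by (simp add: prime_imp_coprime)
    have pk: "p ^ k > 0" using p(1) prime_gt_0_nat by simp
    have hN: "h N = h (p ^ k) * h m" unfolding m(1) h_def sigma_mult[OF cop pk m0] by simp
    have pf: "prime_factors N = insert p (prime_factors m)"
      unfolding m(1) using pk m0 p(1) \<open>k > 0\<close>
      by (subst prime_factors_product) (auto simp: prime_factors_power prime_prime_factors)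
    have "p \<notin> prime_factors m" using m(2) by auto
    then have s: "(\<Sum>p\<in>prime_factors N. 2 / real p) = 2 / real p
        + (\<Sum>p\<in>prime_factors m. 2 / real p)" unfolding pf by simp
    have "h m \<ge> 0" by (simp add: h_def)
    then show ?thesis unfolding hN s exp_add using less.IH[OF mN m0] h_prime_power_le[OF p(1)]
      by (intro mult_mono) auto
  qed
qed

text \<open>The quotients \<open>N div p\<close> are distinct divisors of \<open>N\<close>.\<close>

lemma sum_inverse_prime_factors_le_h:
  assumes "N > 0"
  shows "(\<Sum>p\<in>prime_factors N. 1 / real p) \<le> h N"
proof -
  have inj: "inj_on (\<lambda>p. N div p) (prime_factors N)"
  proof (rule inj_onI)
    fix p q assume "p \<in> prime_factors N" "q \<in> prime_factors N" and e: "N div p = N div q"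
    then have "p * (N div p) = N" "q * (N div q) = N" by (auto simp: in_prime_factors_iff)
    then have "p * (N div p) = q * (N div p)" using e by simp
    moreover have "N div p \<noteq> 0" using \<open>p * (N div p) = N\<close> assms by (metis mult_0_right less_irrefl)
    ultimately show "p = q" by simp
  qed
  have "(\<Sum>d\<in>(\<lambda>p. N div p) ` prime_factors N. d) \<le> sigma N"
    unfolding sigma_def using assms
    by (intro sum_mono2) (auto simp: in_prime_factors_iff intro: dvdI[of _ _ p
      for p, OF dvd_div_mult_self[symmetric]])
  then have "(\<Sum>p\<in>prime_factors N. N div p) \<le> sigma N" by (simp only: sum.reindex[OF inj] o_def)
  then have "real (\<Sum>p\<in>prime_factors N. N div p) \<le> real (sigma N)" by (simp only: of_nat_le_iff)
  moreover have "real (\<Sum>p\<in>prime_factors N. N div p) = real N * (\<Sum>p\<in>prime_factors N. 1 / real p)"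
    unfolding of_nat_sum sum_distrib_left
      by (intro sum.cong refl) (simp add: in_prime_factors_iff real_of_nat_div)
  ultimately show ?thesis using assms by (simp add: h_def field_simps)
qed

lemma geometric_sum_dvd:
  fixes q :: nat
  assumes "l dvd n"
  shows "(\<Sum>i<l. q ^ i) dvd (\<Sum>i<n. q ^ i)"
proof -
  obtain e where e: "n = e * l" using assms by (metis dvd_def mult.commute)
  have "(\<Sum>i<e * l. q ^ i) = (\<Sum>m<e. \<Sum>i=m * l..<m * l + l. q ^ i)" by (rule sum.nat_group[symmetric])
  also have "\<dots> = (\<Sum>m<e. q ^ (m * l) * (\<Sum>i<l. q ^ i))"
  proof (rule sum.cong[OF refl])
    fix m
    have "(\<Sum>i=m * l..<m * l + l. q ^ i) = (\<Sum>i=0..<l. q ^ (i + m * l))"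
      using sum.shift_bounds_nat_ivl[of "\<lambda>i. q ^ i" 0 "m * l" l] by (simp add: add.commute)
    then show "(\<Sum>i=m * l..<m * l + l. q ^ i) = q ^ (m * l) * (\<Sum>i<l. q ^ i)"
      by (simp add: power_add sum_distrib_left mult.commute lessThan_atLeast0)
  qed
  finally show ?thesis unfolding e by (auto intro: dvd_sum)
qed

lemma h_gt_1:
  assumes "N > 1"
  shows "h N > 1"
proof -
  have "(\<Sum>d\<in>{1, N}. d) \<le> sigma N" unfolding sigma_def using assms by (intro sum_mono2) auto
  then have "real N < real (sigma N)" using assms by simp
  then show ?thesis using assms by (simp add: h_def)
qed

subsection \<open>Computability of exponential towers\<close>

definition recf_add :: recf where
  "recf_add = PrimRec (Proj 0) (Comp Succ [Proj 1])"

text \<open>Base 4 lets one application dominate both \<open>x + x\<close> and \<open>x * x\<close>,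
  and multiplication by 4 can be programmed with \<open>recf_add\<close> alone.\<close>

definition pow4 :: "nat \<Rightarrow> nat" where "pow4 x = 4 ^ x"

definition recf_pow4 :: recf where
  "recf_pow4 = PrimRec (Comp Succ [Zero])
      (Comp recf_add [Comp recf_add [Proj 1, Proj 1], Comp recf_add [Proj 1, Proj 1]])"

lemma computes_Comp1: "computes g xs y \<Longrightarrow> computes f [y] z \<Longrightarrow> computes (Comp f [g]) xs z"
  by (rule computes.comp[of xs "[g]" "[y]"]) auto

lemma computes_Comp2:
  "computes g xs y \<Longrightarrow> computes g' xs y' \<Longrightarrow> computes f [y, y'] z \<Longrightarrow> computes (Comp f [g, g']) xs z"
  by (rule computes.comp[of xs "[g, g']" "[y, y']"]) auto

lemma computes_Proj: "i < length xs \<Longrightarrow> xs ! i = y \<Longrightarrow> computes (Proj i) xs y"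
  using computes.proj by blast

lemma computes_add: "computes recf_add [a, b] (a + b)"
  unfolding recf_add_def
proof (induction a)
  case 0
  show ?case by (rule computes.primrec_0) (rule computes_Proj, auto)
next
  case (Suc a)
  show ?case
    by (rule computes.primrec_Suc[OF Suc]) (auto intro!: computes_Comp1 computes_Proj computes.succ)
qed

lemma computes_pow4: "computes recf_pow4 [x] (pow4 x)"
  unfolding recf_pow4_def
proof (induction x)
  case 0
  have "computes (Comp Succ [Zero]) [] (Suc 0)"
    by (rule computes_Comp1[OF computes.zero computes.succ])
  then show ?case by (auto simp: pow4_def intro: computes.primrec_0)
next
  case (Suc x)
  have P: "computes (Proj 1) [x, pow4 x] (pow4 x)" by (rule computes_Proj) auto
  have Q: "computes (Comp recf_add [Proj 1, Proj 1]) [x, pow4 x] (pow4 x + pow4 x)"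
    by (rule computes_Comp2[OF P P computes_add])
  have "pow4 (Suc x) = (pow4 x + pow4 x) + (pow4 x + pow4 x)" by (simp add: pow4_def)
  then show ?case
    using computes.primrec_Suc[OF Suc computes_Comp2[OF Q Q computes_add]] by simp
qed

lemma computes_pow4_iterate:
  "computes g xs y \<Longrightarrow> computes (((\<lambda>f. Comp recf_pow4 [f]) ^^ k) g) xs ((pow4 ^^ k) y)"
  by (induction k) (auto intro: computes_Comp1 computes_pow4)

lemma effectively_computable_pow4_iterate:
  "effectively_computable (\<lambda>s n S. (pow4 ^^ k) (s + n + set_encode S))"
  unfolding effectively_computable_def
proof (intro exI allI impI)
  fix s n and S :: "nat set"
  have "computes (Comp recf_add [Proj 0, Proj 1]) [s, n, set_encode S] (s + n)"
    by (rule computes_Comp2[OF _ _ computes_add]) (auto intro!: computes_Proj)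
  then have "computes (Comp recf_add [Comp recf_add [Proj 0, Proj 1], Proj 2])
      [s, n, set_encode S] (s + n + set_encode S)"
    by (rule computes_Comp2[OF _ _ computes_add]) (auto intro!: computes_Proj)
  then show "computes (((\<lambda>f. Comp recf_pow4 [f]) ^^ k)
      (Comp recf_add [Comp recf_add [Proj 0, Proj 1], Proj 2]))
     [s, n, set_encode S] ((pow4 ^^ k) (s + n + set_encode S))"
    by (rule computes_pow4_iterate)
qed

subsection \<open>The theorem\<close>

text \<open>Enlarging the constant keeps the theorem true, so the explicit constants need not be
  programmed: it suffices to place them below a fixed iterate of \<open>pow4\<close>, applied to a
  number \<open>m\<close> that bounds the data.\<close>

definition tower :: "nat \<Rightarrow> nat \<Rightarrow> nat" where "tower m k = (pow4 ^^ k) m"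

lemma tower_Suc: "tower m (Suc k) = pow4 (tower m k)"
  by (simp add: tower_def)

lemma effectively_computable_tower: "effectively_computable (\<lambda>s n S. tower (s + n
    + set_encode S) k)"
  unfolding tower_def by (rule effectively_computable_pow4_iterate)

section \<open>Bounding the constants by towers\<close>

lemma pow4_ge: "x \<le> pow4 x"
proof -
  have "x < 2 ^ x" by (rule less_exp)
  also have "(2::nat) ^ x \<le> 4 ^ x" by (rule power_mono) auto
  finally show ?thesis by (simp add: pow4_def)
qed

lemma mono_pow4: "x \<le> y \<Longrightarrow> pow4 x \<le> pow4 y"
  by (simp add: pow4_def power_increasing)

lemma tower_mono: "j \<le> k \<Longrightarrow> tower m j \<le> tower m k"
  by (induction k rule: dec_induct) (auto simp: tower_Suc intro: order_trans[OF _ pow4_ge])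

lemma tower_le: "a \<le> tower m j \<Longrightarrow> j \<le> k \<Longrightarrow> a \<le> tower m k"
  using tower_mono le_trans by blast

lemma sq_le_pow4: "x * x \<le> pow4 x"
proof -
  have "x \<le> 2 ^ x" by (rule less_imp_le[OF less_exp])
  then have "x * x \<le> 2 ^ x * 2 ^ x" by (intro mult_le_mono)
  also have "\<dots> = pow4 x" by (simp add: pow4_def flip: power_mult_distrib)
  finally show ?thesis .
qed

lemma double_le_pow4: "x + x \<le> pow4 x"
proof (cases "x \<le> 1")
  case True
  then have "x = 0 \<or> x = 1" by auto
  then show ?thesis by (auto simp: pow4_def)
next
  case False
  then have "2 * x \<le> x * x" by (intro mult_le_mono1) simp
  then have "x + x \<le> x * x" by (simp only: mult_2)
  then show ?thesis using sq_le_pow4 by (rule le_trans)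
qed

text \<open>One level pays for a product, since \<open>x * x \<le> pow4 x\<close>.\<close>

lemma tower_mult:
  assumes "a \<le> tower m i" "b \<le> tower m j" "i < k" "j < k"
  shows "a * b \<le> tower m k"
proof -
  obtain k' where k: "k = Suc k'" using assms(3) by (cases k) auto
  have "a \<le> tower m k'" "b \<le> tower m k'"
    using tower_le[OF assms(1), of k'] tower_le[OF assms(2), of k'] assms(3,4) k by auto
  then have "a * b \<le> tower m k' * tower m k'" by (rule mult_le_mono)
  then show ?thesis unfolding k tower_Suc using sq_le_pow4 by (rule le_trans)
qed

lemma tower_add:
  assumes "a \<le> tower m i" "b \<le> tower m j" "i < k" "j < k"
  shows "a + b \<le> tower m k"
proof -
  obtain k' where k: "k = Suc k'" using assms(3) by (cases k) auto
  have "a \<le> tower m k'" "b \<le> tower m k'"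
    using tower_le[OF assms(1), of k'] tower_le[OF assms(2), of k'] assms(3,4) k by auto
  then have "a + b \<le> tower m k' + tower m k'" by (rule add_le_mono)
  then show ?thesis unfolding k tower_Suc using double_le_pow4 by (rule le_trans)
qed

text \<open>Two levels pay for a power: one writes the base below \<open>4 ^ x\<close>, the other
  absorbs the product \<open>x * x\<close> in the exponent.\<close>

lemma tower_power:
  assumes "a \<le> tower m i" "b \<le> tower m j" "Suc i < k" "Suc j < k"
  shows "a ^ b \<le> tower m k"
proof -
  define k' where "k' = k - 2"
  have k: "k = Suc (Suc k')" using assms(3) by (simp add: k'_def)
  let ?x = "tower m k'"
  have ab: "a \<le> ?x" "b \<le> ?x" using tower_le[OF assms(1), of k'] tower_le[OF assms(2), of k']
      assms(3,4) k by auto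
  have "a \<le> 4 ^ ?x" using le_trans[OF ab(1) pow4_ge] by (simp only: pow4_def)
  then have "a ^ b \<le> (4 ^ ?x) ^ b" by (intro power_mono) auto
  also have "\<dots> = 4 ^ (?x * b)" by (rule power_mult[symmetric])
  also have "\<dots> \<le> 4 ^ (?x * ?x)" using ab(2) by (intro power_increasing mult_le_mono2) auto
  also have "\<dots> \<le> 4 ^ pow4 ?x" by (intro power_increasing sq_le_pow4) auto
  finally show ?thesis by (simp add: k tower_Suc pow4_def)
qed

text \<open>\<open>256\<close> is the third iterate of \<open>pow4\<close> at 0, so three levels
  absorb small constants for every \<open>m\<close>.\<close>

lemma tower_const: "a \<le> 256 \<Longrightarrow> a \<le> tower m 3"
proof -
  assume "a \<le> 256"
  also have "(256::nat) = pow4 (pow4 (pow4 0))" by (simp add: pow4_def)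
  also have "\<dots> \<le> pow4 (pow4 (pow4 m))" by (intro mono_pow4) simp
  finally show ?thesis by (simp add: tower_def numeral_3_eq_3)
qed

lemma tower_const4: "a \<le> 4 ^ 256 \<Longrightarrow> a \<le> tower m 4"
proof -
  assume "a \<le> 4 ^ 256"
  also have "(4::nat) ^ 256 \<le> 4 ^ tower m 3" by (rule power_increasing) (auto intro: tower_const)
  also have "\<dots> = tower m (Suc 3)" by (simp only: tower_Suc pow4_def)
  finally show ?thesis by simp
qed

lemma mertens_const_le_tower:
  assumes l: "l \<le> tower m 3"
  shows "mertens_const l \<le> tower m 17"
proof -
  have l2: "l + 2 \<le> tower m 4" by (rule tower_add[OF l tower_const[of 2]]) auto
  have e: "2 ^ (l + 2) \<le> tower m 6" by (rule tower_power[OF tower_const[of 2] l2]) auto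
  have ll: "l ^ 2 \<le> tower m 4" unfolding power2_eq_square by (rule tower_mult[OF l l]) auto
  have 1: "8 * l ^ 2 \<le> tower m 5" by (rule tower_mult[OF tower_const[of 8] ll]) auto
  have "4 * 2 ^ (l + 2) \<le> tower m 7" by (rule tower_mult[OF tower_const[of 4] e]) auto
  moreover have "l - 1 \<le> tower m 3" using l by simp
  ultimately have "(4 * 2 ^ (l + 2)) ^ (l - 1) \<le> tower m 9" by (rule tower_power) auto
  from tower_mult[OF 1 this, of 10] have y: "small_prime_bound l \<le> tower m 10"
    by (simp add: small_prime_bound_def)
  have "box_modulus l \<le> small_prime_bound l ^ small_prime_bound l" unfolding box_modulus_def
    using fact_le_power[of "small_prime_bound l", where 'a = nat] by simp
  also have "\<dots> \<le> tower m 12" by (rule tower_power[OF y y]) auto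
  finally have M: "box_modulus l \<le> tower m 12" .
  have "3 * l \<le> tower m 4" by (rule tower_mult[OF tower_const[of 3] l]) auto
  from tower_mult[OF this M, of 13] have "3 * l * box_modulus l \<le> tower m 13" by simp
  from tower_mult[OF e this, of 14] have c: "norm_scale l \<le> tower m 14"
    by (simp add: norm_scale_def)
  have lll: "l ^ 3 \<le> tower m 5" by (rule tower_power[OF l tower_const[of 3]]) auto
  have 2: "64 * l ^ 3 \<le> tower m 6" by (rule tower_mult[OF tower_const[of 64] lll]) auto
  have "norm_scale l ^ l \<le> tower m 16" by (rule tower_power[OF c l]) auto
  from tower_mult[OF 2 this, of 17] show ?thesis by (simp add: mertens_const_def)
qed

text \<open>An integer above \<open>tail_const l (2 * real n)\<close>: \<open>e\<close> is replaced
  by 3, and \<open>1 / sieve_exponent l\<close> is an integer already.\<close>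

definition tail_const_nat :: "nat \<Rightarrow> nat \<Rightarrow> nat" where
  "tail_const_nat l n = 1638400 * 3 ^ (2 * n + 1)
      * (2 * mertens_const l * (mertens_const l + 2)) ^ 4"

lemma tail_const_le_tail_const_nat: "tail_const l (2 * real n) \<le> real (tail_const_nat l n)"
proof -
  have "exp (real (2 * n + 1) * 1) = exp (1::real) ^ (2 * n + 1)" by (rule exp_of_nat_mult)
  moreover have "real (2 * n + 1) * 1 = 2 * real n + 1" by simp
  ultimately have "exp (2 * real n + 1) = exp 1 ^ (2 * n + 1)" by (simp only:)
  also have "\<dots> \<le> 3 ^ (2 * n + 1)" by (intro power_mono exp_le) auto
  finally have "exp (2 * real n + 1) \<le> 3 ^ (2 * n + 1)" .
  then have "1638400 * exp (2 * real n + 1) * (1 / sieve_exponent l) ^ 4 \<le> 1638400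
      * 3 ^ (2 * n + 1) * (1 / sieve_exponent l) ^ 4"
    by (intro mult_right_mono mult_left_mono) auto
  moreover have "1 / sieve_exponent l = 2 * real (mertens_const l) * real (mertens_const l + 2)"
    by (simp add: sieve_exponent_def)
  then have "real (tail_const_nat l n) = 1638400 * 3 ^ (2 * n + 1) * (1 / sieve_exponent l) ^ 4"
    by (simp only: tail_const_nat_def of_nat_mult of_nat_power of_nat_numeral)
  ultimately show ?thesis by (simp only: tail_const_def)
qed

lemma tail_const_nat_le_tower:
  assumes l: "l \<le> tower m 3" and n: "n \<le> tower m 3"
  shows "tail_const_nat l n \<le> tower m 23"
proof -
  have A: "mertens_const l \<le> tower m 17" by (rule mertens_const_le_tower[OF l])
  have a: "mertens_const l + 2 \<le> tower m 18" by (rule tower_add[OF A tower_const[of 2]]) auto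
  have b: "2 * mertens_const l \<le> tower m 18" by (rule tower_mult[OF tower_const[of 2] A]) auto
  have c: "2 * mertens_const l * (mertens_const l + 2) \<le> tower m 19"
    by (rule tower_mult[OF b a]) auto
  have 1: "(2 * mertens_const l * (mertens_const l + 2)) ^ 4 \<le> tower m 21"
    by (rule tower_power[OF c tower_const[of 4]]) auto
  have d: "2 * n \<le> tower m 4" by (rule tower_mult[OF tower_const[of 2] n]) auto
  have e: "2 * n + 1 \<le> tower m 5" by (rule tower_add[OF d tower_const[of 1]]) auto
  have f: "3 ^ (2 * n + 1) \<le> tower m 7" by (rule tower_power[OF tower_const[of 3] e]) auto
  have "1638400 * 3 ^ (2 * n + 1) \<le> tower m 8" by (rule tower_mult[OF tower_const4 f]) auto
  from tower_mult[OF this 1, of 23] show ?thesis by (simp add: tail_const_nat_def)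
qed

text \<open>Supplies the class that the primes \<open>q\<close> avoid: a root found modulo
  \<open>r ^ 2\<close> is reduced modulo \<open>r\<close>. It is nonzero because the sum equals 1 at
  0.\<close>

lemma root_of_unity_nat:
  assumes l: "prime l" and r: "prime r" "r mod l = 1"
  shows "\<exists>w. 0 < w \<and> w < r \<and> r dvd (\<Sum>i<l. w ^ i)"
proof -
  have l1: "l > 1" using l by (rule prime_gt_1_nat)
  obtain W :: int where "int r ^ 2 dvd poly (Phi l) (W ^ 1)"
    using root_of_unity_mod[OF l r] l1 by (metis atLeastLessThan_iff order_refl)
  then have W: "int r dvd (\<Sum>i<l. W ^ i)"
    by (simp add: poly_Phi power2_eq_square) (metis dvd_mult_left)
  define w where "w = nat (W mod int r)"
  have r0: "r > 0" using r prime_gt_0_nat by blast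
  have wW: "[int w = W] (mod int r)" using r0 by (simp add: w_def cong_def)
  have "[(\<Sum>i<l. int w ^ i) = (\<Sum>i<l. W ^ i)] (mod int r)" by (intro cong_sum cong_pow wW)
  then have "int r dvd (\<Sum>i<l. int w ^ i)" using W cong_dvd_iff by blast
  then have "int r dvd int (\<Sum>i<l. w ^ i)" by simp
  then have d: "r dvd (\<Sum>i<l. w ^ i)" by (simp only: int_dvd_int_iff)
  have "w \<noteq> 0"
  proof
    assume "w = 0"
    then have "(\<Sum>i<l. w ^ i) = (\<Sum>i<l. if i = 0 then 1 else 0)"
      by (intro sum.cong) (auto simp: power_0_left)
    also have "\<dots> = 1" using l1 by simp
    finally show False using d r(1) by (simp add: not_prime_unit)
  qed
  moreover have "w < r" using r0 by (simp add: w_def nat_less_iff)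
  ultimately show ?thesis using d by auto
qed

lemma sum_UN_le:
  fixes f :: "nat \<Rightarrow> real"
  assumes "finite S" "\<And>b. b \<in> S \<Longrightarrow> finite (Q b)" "\<And>x. 0 \<le> f x"
  shows "(\<Sum>x\<in>(\<Union>b\<in>S. Q b). f x) \<le> (\<Sum>b\<in>S. \<Sum>x\<in>Q b. f x)"
  using assms(1,2)
proof (induction S rule: finite_induct)
  case (insert b S)
  have "(\<Sum>x\<in>Q b \<union> (\<Union>b\<in>S. Q b). f x) + (\<Sum>x\<in>Q b \<inter> (\<Union>b\<in>S. Q b). f x) = (\<Sum>x\<in>Q b. f x)
      + (\<Sum>x\<in>(\<Union>b\<in>S. Q b). f x)"
    using insert by (intro sum.union_inter) auto
  moreover have "0 \<le> (\<Sum>x\<in>Q b \<inter> (\<Union>b\<in>S. Q b). f x)" using assms(3) by (intro sum_nonneg) auto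
  ultimately show ?case using insert by simp
qed simp

text \<open>Handles the primes with one exponent \<open>2 b\<close>. As \<open>2 b + 1\<close> is
  odd and exceeds 1, it has a prime factor \<open>l \<ge> 3\<close>; a single root
  \<open>w r\<close> of the geometric sum is fixed for each \<open>r\<close>, and the sieve is
  applied with \<open>H = 2 n\<close>.\<close>

lemma sum_prime_factors_le:
  assumes N: "N > 0" and eq: "d * sigma N = n * N" and n: "n > 0" and hN: "h N \<le> real n"
    and b: "b > 0" and J1: "J1 \<ge> 2"
    and tail_const_nat: "\<And>l. l \<le> 2 * b + 1 \<Longrightarrow> tail_const_nat l n \<le> K"
    and Q: "finite Q" "\<And>q. q \<in> Q \<Longrightarrow> prime q" "\<And>q. q \<in> Q \<Longrightarrow> 2 ^ block_start J1 \<le> q"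
      "\<And>q. q \<in> Q \<Longrightarrow> \<exists>m. N = q ^ (2 * b) * m \<and> coprime q m"
  shows "(\<Sum>q\<in>Q. 1 / real q) \<le> 2 * real K / real J1"
proof -
  have "2 * b + 1 \<noteq> 1" using b by simp
  then obtain l where l: "prime l" "l dvd 2 * b + 1" using prime_factor_nat by blast
  have "odd l" using l(2) by (metis dvd_trans even_plus_one_iff even_mult_iff even_numeral)
  then have "l \<noteq> 2" by auto
  then have l3: "l \<ge> 3" using prime_ge_2_nat[OF l(1)] by linarith
  have lb: "l \<le> 2 * b + 1" using dvd_imp_le[OF l(2)] by simp
  \<comment> \<open>For \<open>r\<close> in \<open>V\<close> the divisibility of
    \<open>n * N\<close> by \<open>r\<close> is no contradiction. The reciprocals of these primes
    sum to at most \<open>h N \<le> n\<close> from \<open>N\<close>, and to at most the number of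
    primes dividing \<open>n\<close>, hence at most \<open>n\<close>, from \<open>n\<close>.\<close>
  define V where "V = {r. r dvd N \<or> r dvd n}"
  have "\<forall>r. \<exists>w. prime r \<longrightarrow> r mod l = 1 \<longrightarrow> 0 < w \<and> w < r \<and> r dvd (\<Sum>i<l. w ^ i)"
    using root_of_unity_nat[OF l(1)] by blast
  then obtain w where w: "\<And>r. prime r \<Longrightarrow> r mod l = 1 \<Longrightarrow> 0 < w r \<and> w r < r \<and> r dvd (\<Sum>i<l. w r ^ i)"
    by metis
  have "(\<Sum>q\<in>Q. 1 / real q) \<le> 2 * tail_const l (2 * real n) / real J1"
  proof (rule sieve_tail[OF l(1) l3 J1 _ _ Q(1,2,3)])
    fix k
    have "split_primes l k \<inter> V \<subseteq> prime_factors N \<union> prime_factors n"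
      using N n by (auto simp: split_primes_def V_def in_prime_factors_iff)
    then have "(\<Sum>r\<in>split_primes l k \<inter> V. 1 / real r)
        \<le> (\<Sum>r\<in>prime_factors N \<union> prime_factors n. 1 / real r)"
      by (intro sum_mono2) auto
    also have "\<dots> \<le> (\<Sum>r\<in>prime_factors N. 1 / real r) + (\<Sum>r\<in>prime_factors n. 1 / real r)"
    proof -
      have "0 \<le> (\<Sum>r\<in>prime_factors N \<inter> prime_factors n. 1 / real r)" by (intro sum_nonneg) auto
      then show ?thesis using sum.union_inter[of "prime_factors N" "prime_factors n"
          "\<lambda>r. 1 / real r"] by simp
    qed
    also have "(\<Sum>r\<in>prime_factors N. 1 / real r) \<le> real n"
      using sum_inverse_prime_factors_le_h[OF N] hN by linarith
    also have "(\<Sum>r\<in>prime_factors n. 1 / real r) \<le> (\<Sum>r\<in>prime_factors n. 1)"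
    proof (rule sum_mono)
      fix r assume "r \<in> prime_factors n"
      then have "1 \<le> r" using prime_ge_1_nat by (auto simp: in_prime_factors_iff)
      then show "1 / real r \<le> 1" by simp
    qed
    also have "\<dots> = real (card (prime_factors n))" by simp
    also have "card (prime_factors n) \<le> card {1..n}"
      using n by (intro card_mono) (auto simp: in_prime_factors_iff Suc_le_eq prime_gt_0_nat
          dvd_imp_le)
    finally show "(\<Sum>r\<in>split_primes l k \<inter> V. 1 / real r) \<le> 2 * real n" by simp
  next
    fix q r assume q: "q \<in> Q" and r: "prime r" "r mod l = 1" "r \<notin> V"
    show "q mod r \<noteq> w r"
    proof
      assume "q mod r = w r"
      then have "[q = w r] (mod r)" using w[OF r(1,2)] by (simp add: cong_def)
      then have "[(\<Sum>i<l. q ^ i) = (\<Sum>i<l. w r ^ i)] (mod r)" by (intro cong_sum cong_pow)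
      then have "r dvd (\<Sum>i<l. q ^ i)" using w[OF r(1,2)] cong_dvd_iff by blast
      also have "\<dots> dvd (\<Sum>i<2 * b + 1. q ^ i)" by (rule geometric_sum_dvd[OF l(2)])
      also have "\<dots> = sigma (q ^ (2 * b))" by
          (simp only: sigma_prime_power[OF Q(2)[OF q]] Suc_eq_plus1)
      finally have 1: "r dvd sigma (q ^ (2 * b))" .
      obtain m where m: "N = q ^ (2 * b) * m" "coprime q m" using Q(4)[OF q] by blast
      have "sigma N = sigma (q ^ (2 * b)) * sigma m"
        unfolding m(1) using m N by (intro sigma_mult) auto
      then have "r dvd d * sigma N" using 1 by simp
      then have "r dvd n * N" by (simp only: eq)
      then show False using r(1,3) by (auto simp: V_def prime_dvd_mult_iff)
    qed
  qed (use w in auto)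
  also have "\<dots> \<le> 2 * real K / real J1"
    using tail_const_le_tail_const_nat[of l n] tail_const_nat[OF lb]
      by (intro divide_right_mono mult_left_mono) auto
  finally show ?thesis .
qed

text \<open>The threshold of the final contradiction: the reciprocals of the prime factors sum to at
  most \<open>1 / (8 n)\<close>, and \<open>h_le_exp\<close> doubles this.\<close>

lemma exp_quarter_less:
  assumes "n > 0"
  shows "exp (1 / (4 * real n)) < 1 + 1 / real n"
proof -
  define x where "x = 1 / (4 * real n)"
  have n1: "real n \<ge> 1" using assms by simp
  have x: "0 < x" "x \<le> 1 / 4" using n1 by (auto simp: x_def field_simps)
  have "exp x * (1 - x) \<le> exp x * exp (- x)" using exp_ge_add_one_self[of "- x"]
    by (intro mult_left_mono) auto
  also have "\<dots> = 1" by (simp flip: exp_add)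
  also have "1 < (1 + 4 * x) * (1 - x)"
  proof -
    have "x * x \<le> (1 / 4) * x" using x by (intro mult_right_mono) auto
    then show ?thesis using x by (simp add: algebra_simps)
  qed
  finally have "exp x < 1 + 4 * x" using x by (simp only: mult_less_cancel_right)
  then show ?thesis by (simp add: x_def)
qed

theorem theorem1p1:
  "\<exists>C :: nat \<Rightarrow> nat \<Rightarrow> nat set \<Rightarrow> nat. effectively_computable C \<and>
    (\<forall>(s::nat) (n::nat) (S::nat set). n > 0 \<longrightarrow> finite S \<longrightarrow> (\<forall>b\<in>S. b > 0) \<longrightarrow>
      (\<forall>(d::nat) (t::nat) (\<beta>::nat \<Rightarrow> nat) (\<alpha>::nat \<Rightarrow> nat) (p::nat \<Rightarrow> nat) (q::nat \<Rightarrow> nat) (N::nat).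
        d > 0 \<longrightarrow>
        (\<forall>j\<in>{1..t}. \<beta> j \<in> S) \<longrightarrow>
        (\<forall>i\<in>{1..s}. \<alpha> i > 0) \<longrightarrow>
        (\<forall>i\<in>{1..s}. prime (p i)) \<longrightarrow>
        (\<forall>j\<in>{1..t}. prime (q j)) \<longrightarrow>
        inj_on p {1..s} \<longrightarrow> inj_on q {1..t} \<longrightarrow> p ` {1..s} \<inter> q ` {1..t} = {} \<longrightarrow>
        N = (\<Prod>i=1..s. p i ^ \<alpha> i) * (\<Prod>j=1..t. q j ^ (2 * \<beta> j)) \<longrightarrow>
        N > 1 \<longrightarrow> h N = real n / real d \<longrightarrow>
        (\<exists>r. prime r \<and> r dvd N \<and> r < C s n S)))"
proof (intro exI[of _ "\<lambda>s n S. tower (s + n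
    + set_encode S) 28"] conjI effectively_computable_tower allI impI)
  fix s n :: nat and S :: "nat set" and d t :: nat and \<beta> \<alpha> p q :: "nat \<Rightarrow> nat" and N :: nat
  assume n: "n > 0" and S: "finite S" "\<forall>b\<in>S. b > 0" and d: "d > 0"
    and \<beta>: "\<forall>j\<in>{1..t}. \<beta> j \<in> S" and \<alpha>: "\<forall>i\<in>{1..s}. \<alpha> i > 0"
    and p: "\<forall>i\<in>{1..s}. prime (p i)" and q: "\<forall>j\<in>{1..t}. prime (q j)"
    and inj: "inj_on p {1..s}" "inj_on q {1..t}" and disj: "p ` {1..s} \<inter> q ` {1..t} = {}"
    and N: "N = (\<Prod>i=1..s. p i ^ \<alpha> i) * (\<Prod>j=1..t. q j ^ (2 * \<beta> j))"
    and N1: "N > 1" and hN: "h N = real n / real d"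
  \<comment> \<open>\<open>set_encode S\<close> is at least each element of \<open>S\<close> and at
    least the cardinality of \<open>S\<close>, so \<open>m\<close> bounds all the data.\<close>
  define m where "m = s + n + set_encode S"
  \<comment> \<open>The heights: \<open>K\<close> bounds every tail constant that occurs, one more
    level lets \<open>J1\<close> exceed \<open>32 * n * card S * K\<close>, three more reach
    \<open>block_start J1\<close>, and a last one its power of 2.\<close>
  define C where "C = tower m 28"
  define J1 where "J1 = tower m 24"
  define K where "K = tower m 23"
  have N0: "N > 0" and n1: "real n \<ge> 1" using N1 n by auto
  have eq: "d * sigma N = n * N"
  proof -
    have "real d * real (sigma N) = real n * real N" using hN d N0 by (simp add: h_def field_simps)
    then have "real (d * sigma N) = real (n * N)" by simp
    then show ?thesis by (simp only: of_nat_eq_iff)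
  qed
  have hn: "h N \<le> real n"
  proof -
    have "real n / real d \<le> real n / 1" using d by (intro divide_left_mono) auto
    then show ?thesis by (simp add: hN)
  qed
  \<comment> \<open>Integrality frees the bound from \<open>d\<close>: \<open>h N > 1\<close> means
    \<open>d + 1 \<le> n\<close>, so \<open>n / d\<close> is at least \<open>1 + 1 / d\<close>, and
    \<open>d < n\<close>.\<close>
  have h_lower: "1 + 1 / real n \<le> h N"
  proof -
    have "1 < real n / real d" using h_gt_1[OF N1] hN by simp
    then have "d < n" using d by (simp add: field_simps)
    then have "real d + 1 \<le> real n" by simp
    then have "(real d + 1) / real d \<le> real n / real d" by (intro divide_right_mono) auto
    then have "1 + 1 / real d \<le> real n / real d" using d by (simp add: add_divide_distrib)
    moreover have "1 / real n \<le> 1 / real d" using d \<open>d < n\<close> by (intro divide_left_mono) auto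
    ultimately show ?thesis by (simp add: hN)
  qed
  have m0: "s \<le> tower m 0" "n \<le> tower m 0" by (simp_all add: tower_def m_def)
  have n3: "n \<le> tower m 3" by (rule tower_le[OF m0(2)]) simp
  have bm: "b \<le> set_encode S" if "b \<in> S" for b
  proof -
    have "b \<le> 2 ^ b" by (rule less_imp_le[OF less_exp])
    also have "\<dots> \<le> (\<Sum>i\<in>S. 2 ^ i)" using S(1) that by (intro member_le_sum) auto
    finally show ?thesis by (simp add: set_encode_def)
  qed
  have cS: "card S \<le> tower m 0"
  proof -
    have "S \<subseteq> {1..set_encode S}" using bm S(2) by (auto simp: Suc_le_eq)
    then have "card S \<le> card {1..set_encode S}" by (intro card_mono) auto
    then show ?thesis by (simp add: tower_def m_def)
  qed
  have KnK: "tail_const_nat l n \<le> K" if b: "b \<in> S" and l: "l \<le> 2 * b + 1" for b l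
  proof -
    have b0: "b \<le> tower m 0" using bm[OF b] by (simp add: tower_def m_def)
    have "b + b \<le> tower m 1" by (rule tower_add[OF b0 b0]) auto
    moreover have "1 \<le> tower m 1" by (simp add: tower_def pow4_def)
    ultimately have "b + b + 1 \<le> tower m 3" by (rule tower_add) auto
    then have "l \<le> tower m 3" using l by simp
    then show ?thesis unfolding K_def by (rule tail_const_nat_le_tower[OF _ n3])
  qed
  have J1_2: "2 \<le> J1" unfolding J1_def by (rule tower_le[OF tower_const]) auto
  have J1_large: "32 * n * card S * K \<le> J1"
  proof -
    have "32 * n \<le> tower m 4" by (rule tower_mult[OF tower_const[of 32] m0(2)]) auto
    from tower_mult[OF this cS, of 5] have "32 * n * card S \<le> tower m 5" by simp
    from tower_mult[OF this, of K 23 24] show ?thesis by (simp add: K_def J1_def)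
  qed
  have C_block: "2 ^ block_start J1 \<le> C"
  proof -
    have J: "J1 \<le> tower m 24" by (simp add: J1_def)
    have "400 * J1 \<le> tower m 25" by (rule tower_mult[OF tower_const4 J]) auto
    moreover have "2 ^ J1 \<le> tower m 26" by (rule tower_power[OF tower_const[of 2] J]) auto
    ultimately have b: "block_start J1 \<le> tower m 27" unfolding block_start_def
      by (rule tower_mult) auto
    have "(2::nat) ^ block_start J1 \<le> 4 ^ block_start J1" by (rule power_mono) auto
    also have "\<dots> \<le> 4 ^ tower m 27" using b by (rule power_increasing) simp
    also have "\<dots> = tower m (Suc 27)" by (simp only: tower_Suc pow4_def)
    finally show ?thesis by (simp add: C_def)
  qed
  have C_large: "16 * n * s \<le> C"
  proof -
    have "16 * n \<le> tower m 4" by (rule tower_mult[OF tower_const[of 16] m0(2)]) auto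
    from tower_mult[OF this m0(1), of 28] show ?thesis by (simp add: C_def)
  qed
  show "\<exists>r. prime r \<and> r dvd N \<and> r < tower (s + n + set_encode S) 28"
  proof (rule ccontr)
    assume "\<not> ?thesis"
    then have large: "C \<le> r" if "prime r" "r dvd N" for r
      using that by (auto simp: C_def m_def not_less)
    define Q where "Q b = q ` {j \<in> {1..t}. \<beta> j = b}" for b
    have finQ: "finite (Q b)" for b by (simp add: Q_def)
    have split: "\<exists>k. N = q j ^ (2 * \<beta> j) * k \<and> coprime (q j) k" if j: "j \<in> {1..t}" for j
    proof (intro exI conjI)
      let ?k = "(\<Prod>i=1..s. p i ^ \<alpha> i) * (\<Prod>i\<in>{1..t} - {j}. q i ^ (2 * \<beta> i))"
      have "(\<Prod>i=1..t. q i ^ (2 * \<beta> i)) = q j ^ (2 * \<beta> j) * (\<Prod>i\<in>{1..t} - {j}. q i ^ (2 * \<beta> i))"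
        using j by (intro prod.remove) auto
      then show "N = q j ^ (2 * \<beta> j) * ?k" unfolding N by (simp only: mult.left_commute)
      have 1: "coprime (q j) (p i ^ \<alpha> i)" if i: "i \<in> {1..s}" for i
      proof -
        have "q j \<noteq> p i" using disj i j by blast
        then have "coprime (q j) (p i)" using p q i j primes_coprime by blast
        then show ?thesis by simp
      qed
      have 2: "coprime (q j) (q i ^ (2 * \<beta> i))" if i: "i \<in> {1..t} - {j}" for i
      proof -
        have "q j \<noteq> q i" using inj(2) i j by (auto dest: inj_onD)
        then have "coprime (q j) (q i)" using q i j primes_coprime by blast
        then show ?thesis by simp
      qed
      show "coprime (q j) ?k"
        unfolding coprime_mult_right_iff by (intro conjI prod_coprime_right 1 2)
    qed
    have qN: "q j dvd N" if j: "j \<in> {1..t}" for j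
    proof -
      obtain k where k: "N = q j ^ (2 * \<beta> j) * k" using split[OF j] by blast
      have "\<beta> j > 0" using \<beta> j S(2) by blast
      then have "q j dvd q j ^ (2 * \<beta> j)" by (intro dvd_power) auto
      then show ?thesis unfolding k by (rule dvd_mult2)
    qed
    have pN: "p i dvd N" if i: "i \<in> {1..s}" for i
    proof -
      have "p i dvd p i ^ \<alpha> i" using \<alpha> i by (intro dvd_power) auto
      also have "\<dots> dvd (\<Prod>i=1..s. p i ^ \<alpha> i)" using i by (intro dvd_prodI) auto
      also have "\<dots> dvd N" by (simp add: N)
      finally show ?thesis .
    qed
    have "prime_factors N \<subseteq> p ` {1..s} \<union> (\<Union>b\<in>S. Q b)"
    proof
      fix r assume "r \<in> prime_factors N"
      then have r: "prime r" "r dvd N" by (auto simp: in_prime_factors_iff)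
      then consider "r dvd (\<Prod>i=1..s. p i ^ \<alpha> i)" | "r dvd (\<Prod>j=1..t. q j ^ (2 * \<beta> j))"
        using r(2) unfolding N prime_dvd_mult_iff[OF r(1)] by blast
      then show "r \<in> p ` {1..s} \<union> (\<Union>b\<in>S. Q b)"
      proof cases
        case 1
        then have "\<exists>i\<in>{1..s}. r dvd p i ^ \<alpha> i"
          using r(1) by (simp only: prime_dvd_prod_iff finite_atLeastAtMost)
        then obtain i where i: "i \<in> {1..s}" "r dvd p i ^ \<alpha> i" by blast
        have "prime (p i)" using p i(1) by blast
        then have "r = p i" by (rule primes_dvd_imp_eq[OF r(1) _ prime_dvd_power[OF r(1) i(2)]])
        then show ?thesis using i(1) by blast
      next
        case 2
        then have "\<exists>j\<in>{1..t}. r dvd q j ^ (2 * \<beta> j)"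
          using r(1) by (simp only: prime_dvd_prod_iff finite_atLeastAtMost)
        then obtain j where j: "j \<in> {1..t}" "r dvd q j ^ (2 * \<beta> j)" by blast
        have "prime (q j)" using q j(1) by blast
        then have "r = q j" by (rule primes_dvd_imp_eq[OF r(1) _ prime_dvd_power[OF r(1) j(2)]])
        then have "r \<in> Q (\<beta> j)" using j(1) by (auto simp: Q_def)
        then show ?thesis using \<beta> j(1) by blast
      qed
    qed
    then have "(\<Sum>r\<in>prime_factors N. 1 / real r) \<le> (\<Sum>r\<in>p ` {1..s} \<union> (\<Union>b\<in>S. Q b). 1 / real r)"
      using S(1) finQ by (intro sum_mono2) auto
    also have "\<dots> \<le> (\<Sum>r\<in>p ` {1..s}. 1 / real r) + (\<Sum>r\<in>(\<Union>b\<in>S. Q b). 1 / real r)"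
    proof -
      have "0 \<le> (\<Sum>r\<in>p ` {1..s} \<inter> (\<Union>b\<in>S. Q b). 1 / real r)" by (intro sum_nonneg) auto
      then show ?thesis
        using sum.union_inter[of "p ` {1..s}" "\<Union>b\<in>S. Q b" "\<lambda>r. 1 / real r"] S(1) finQ by simp
    qed
    also have "(\<Sum>r\<in>p ` {1..s}. 1 / real r) \<le> 1 / (16 * real n)"
    proof -
      have C0: "real C > 0"
      proof -
        have "(0::nat) < 2 ^ block_start J1" by simp
        then have "0 < C" using C_block by (rule less_le_trans)
        then show ?thesis by simp
      qed
      have "(\<Sum>r\<in>p ` {1..s}. 1 / real r) \<le> real (card (p ` {1..s})) * (1 / real C)"
      proof (rule sum_bounded_above)
        fix r assume "r \<in> p ` {1..s}"
        then have "C \<le> r" using large p pN by blast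
        then show "1 / real r \<le> 1 / real C" using C0 by (intro divide_left_mono) auto
      qed
      also have "\<dots> = real s / real C" using card_image[OF inj(1)] by simp
      also have "\<dots> \<le> 1 / (16 * real n)"
      proof -
        have "real (16 * n * s) \<le> real C" using C_large by (simp only: of_nat_le_iff)
        then show ?thesis using C0 n1 by (simp add: field_simps)
      qed
      finally show ?thesis .
    qed
    also have "(\<Sum>r\<in>(\<Union>b\<in>S. Q b). 1 / real r) \<le> 1 / (16 * real n)"
    proof -
      have "(\<Sum>r\<in>(\<Union>b\<in>S. Q b). 1 / real r) \<le> (\<Sum>b\<in>S. \<Sum>r\<in>Q b. 1 / real r)"
        by (rule sum_UN_le[OF S(1) finQ]) simp
      also have "\<dots> \<le> (\<Sum>b\<in>S. 2 * real K / real J1)"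
      proof (rule sum_mono)
        fix b assume b: "b \<in> S"
        show "(\<Sum>r\<in>Q b. 1 / real r) \<le> 2 * real K / real J1"
        proof (rule sum_prime_factors_le[OF N0 eq n hn _ J1_2 KnK[OF b] finQ])
          show "0 < b" using S(2) b by blast
          fix r assume "r \<in> Q b"
          then obtain j where j: "j \<in> {1..t}" "\<beta> j = b" "r = q j" by (auto simp: Q_def)
          show "prime r" using q j by blast
          show "2 ^ block_start J1 \<le> r" using C_block large[of r] \<open>prime r\<close> qN[OF j(1)] j(3)
            by force
          show "\<exists>k. N = r ^ (2 * b) * k \<and> coprime r k" using split[OF j(1)] j by simp
        qed
      qed
      also have "\<dots> = 2 * real (card S) * real K / real J1" by simp
      also have "\<dots> \<le> 1 / (16 * real n)"
      proof -
        have "real (32 * n * card S * K) \<le> real J1" using J1_large by (simp only: of_nat_le_iff)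
        then show ?thesis using J1_2 n1 by (simp add: field_simps)
      qed
      finally show ?thesis .
    qed
    finally have sum: "(\<Sum>r\<in>prime_factors N. 1 / real r) \<le> 1 / (8 * real n)" by simp
    have "h N \<le> exp (\<Sum>r\<in>prime_factors N. 2 / real r)" by (rule h_le_exp[OF N0])
    also have "(\<Sum>r\<in>prime_factors N. 2 / real r) = 2 * (\<Sum>r\<in>prime_factors N. 1 / real r)"
      by (simp add: sum_distrib_left)
    also have "exp \<dots> \<le> exp (1 / (4 * real n))" using sum by simp
    also have "\<dots> < 1 + 1 / real n" by (rule exp_quarter_less[OF n])
    finally show False using h_lower by simp
  qed
qed

end
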